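(* Let $R_0$ be a commutative unital ring, $V$ a free $R_0$-module of finite rank $n$, $E=\Lambda^*V$, and $\mathcal{A}$ a superfiltered $A_\infty$-deformation of $E$ with disc potential $\mathfrak{P}\in R$. The image of the embedding $\operatorname{H}^*(\mathcal{A}_{\bm{v}})\hookrightarrow C\ell(-\tfrac12\operatorname{Hess}(\mathfrak{P}))\otimes_R\operatorname{Jac}(\mathfrak{P})$, or equivalently the image of the embedding of $\operatorname{H}^*(\mathcal{C})$ into the same algebra, where $\mathcal{C}=(C\ell(-\tfrac12\operatorname{Hess}(\mathfrak{P})),-\mathrm{d}\mathfrak{P}\lrcorner\bullet)$, is contained in the centre of the codomain.
   Context: Tensor products are over $R_0$ unless indicated. A superfiltered module is a module $X$ with a $\mathbb{Z}/2$-grading and an increasing Hausdorff exhaustive filtration $(F^pX)_{p\in\mathbb{Z}}$ with $F^pX=(F^pX\cap X^0)\oplus(F^pX\cap X^1)$ and $F^{p+1}X\cap X^p=F^pX\cap X^p$ (superscripts on $X$ taken mod 2). A map is superfiltered of degree $r$ if it has degree $r$ mod 2 and sends $F^p$ into $F^{p+r}$; its leading term is the induced degree $r$ map on $\operatorname{gr}$. $A_\infty$-algebras (Seidel's signs): degree 1 operations $\mu^k:\mathcal{A}[1]^{\otimes k}\to\mathcal{A}[1]$, $k\ge1$, with $\sum_{i,j}(-1)^{\maltese_i}\mu^{k-j+1}(a_k,\dots,\mu^j(a_{i+j},\dots,a_{i+1}),a_i,\dots,a_1)=0$, $\maltese_i=|a_1|+\dots+|a_i|-i$. Minimal: $\mu^1=0$.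 Strict unit: $\mu^2(a,1)=a=(-1)^{|a|}\mu^2(1,a)$, and $\mu^k$ for $k\ne2$ vanishes if some input is $1$. A superfiltered $A_\infty$-deformation of $E$ is a strictly unital minimal $\mathbb{Z}/2$-graded $A_\infty$-algebra $\mathcal{A}$ over $R_0$ on a superfiltered module, with every $\mu^k$ superfiltered of degree 1 on the shifted modules, together with an isomorphism of graded modules $\operatorname{gr}\mathcal{A}\cong E$ under which the leading terms of the $\mu^k$ become the standard operations of $E$ (only $\mu^2(a_2,a_1)=(-1)^{|a_1|}a_2\wedge a_1$ nonzero). Then $F^0\mathcal{A}\cong R_0$ and $F^1\mathcal{A}\cap\mathcal{A}^1\cong V$. $R=R_0[[x_1,\dots,x_n]]$, with $x_i$ the coordinates dual to a basis $v_1,\dots,v_n$ of $V$; $\bm{v}=\sum_ix_iv_i$; operations are extended $R$-multilinearly. The disc potential is $\mathfrak{P}=\sum_{k\ge2}\mu^k(\bm{v},\dots,\bm{v})\in R$, and $\operatorname{Jac}(\mathfrak{P})=R/(\partial_1\mathfrak{P},\dots,\partial_n\mathfrak{P})$. $\mathcal{A}_{\bm{v}}$ is the $A_\infty$-algebra $R\otimes\mathcal{A}$ over $R$ with operations $\mu^k_{\bm{v}}(a_k,\dots,a_1)=\sum_{i_0,\dots,i_k\ge0}\mu^{k+i_0+\dots+i_k}(\bm{v}^{i_k},a_k,\bm{v}^{i_{k-1}},\dots,a_1,\bm{v}^{i_0})$, $k\ge1$ ($\bm{v}^i$ means $i$ consecutive inputs $\bm{v}$). Its differential is $\mathrm{d}_{\bm{v}}a=(-1)^{|a|}\mu^1_{\bm{v}}(a)$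 and its product is $a\cdot b=(-1)^{|b|}\mu^2_{\bm{v}}(a,b)$, associative up to homotopy. $C\ell(Q)$ is the tensor algebra over $R$ on $V_R=R\otimes V$ modulo the relations $v\otimes v=Q(v)$. $\tfrac12\operatorname{Hess}(\mathfrak{P})(\sum_ia_iv_i)=\sum_ia_i^2\,\tfrac12\partial_i^2\mathfrak{P}+\sum_{i<j}a_ia_j\,\partial_i\partial_j\mathfrak{P}$, where $\tfrac12\partial_i^2$ sends $x_i^{m}$ to $\tfrac{m(m-1)}2x_i^{m-2}$. The differential $-\mathrm{d}\mathfrak{P}\lrcorner\bullet$ on $C\ell(-\tfrac12\operatorname{Hess}(\mathfrak{P}))$ is the $R$-linear odd derivation with $v_i\mapsto-\partial_i\mathfrak{P}$. The embeddings. Each $\partial_i\mathfrak{P}=-\mathrm{d}_{\bm{v}}v_i$ acts as $0$ on $\operatorname{H}^*(\mathcal{A}_{\bm{v}})$, and $\mathrm{d}_{\bm{v}}$ vanishes after applying $\otimes_R\operatorname{Jac}(\mathfrak{P})$. The embedding of $\operatorname{H}^*(\mathcal{A}_{\bm{v}})$ is the composite $\operatorname{H}^*(\mathcal{A}_{\bm{v}})\cong\operatorname{H}^*(\mathcal{A}_{\bm{v}})\otimes_R\operatorname{Jac}(\mathfrak{P})\hookrightarrow\operatorname{H}^*(\mathcal{A}_{\bm{v}}\otimes_R\operatorname{Jac}(\mathfrak{P}))=\mathcal{A}_{\bm{v}}\otimes_R\operatorname{Jac}(\mathfrak{P})\cong C\ell(-\tfrac12\operatorname{Hess}(\mathfrak{P}))\otimes_R\operatorname{Jac}(\mathfrak{P})$,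 where the middle map is the universal coefficient map and the last is the algebra isomorphism sending, for $i_1<\dots<i_r$, the basis element $((v_{i_1}\cdot v_{i_2})\cdots)\cdot v_{i_r}$ to $v_{i_1}v_{i_2}\cdots v_{i_r}$. The embedding of $\operatorname{H}^*(\mathcal{C})$ is defined in the same way with $\mathcal{C}$ in place of $\mathcal{A}_{\bm{v}}$. The two embeddings have the same image. *)

theory Defs
  imports Complex_Main
    "HOL-Library.Multiset"
    "HOL-Library.Poly_Mapping"
    "HOL-Library.FuncSet"
    "HOL-Algebra.QuotRing"
    "HOL-Algebra.Generated_Groups"
begin

section \<open>Formal power series\<close>

text \<open>A monomial in the variables \<open>x\<^sub>0, x\<^sub>1, \<dots>\<close> is a finite multiset of indices. A value of type
  \<open>'a series\<close> assigns a coefficient in \<open>'a\<close> to each monomial; the series in the \<open>n\<close> variables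
  \<open>x\<^sub>0, \<dots>, x\<^bsub>n-1\<^esub>\<close> are singled out by \<open>series_over n\<close>. For \<open>'a\<close> the ground ring \<open>R\<^sub>0\<close> this is
  \<open>R = R\<^sub>0[[x\<^sub>0, \<dots>, x\<^bsub>n-1\<^esub>]]\<close>. For an \<open>R\<^sub>0\<close>-module \<open>M\<close> it is \<open>M[[x\<^sub>0, \<dots>, x\<^bsub>n-1\<^esub>]]\<close>, which for \<open>M\<close> free of
  finite rank is the tensor product of \<open>R\<close> and \<open>M\<close> over \<open>R\<^sub>0\<close>. It is only used for such \<open>M\<close>: for
  \<open>V\<close>, and for a superfiltered deformation of its exterior algebra.\<close>

typedef 'a series = "UNIV :: (nat multiset \<Rightarrow> 'a) set"
  morphisms coeff Series ..

lemma coeff_Series [simp]: "coeff (Series f) = f"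
  by (simp add: Series_inverse)

lemma series_eqI: "(\<And>m. coeff f m = coeff g m) \<Longrightarrow> f = g"
  by (metis coeff_inject ext)

instantiation series :: (ab_group_add) ab_group_add
begin
definition zero_series :: "'a series" where "0 = Series (\<lambda>_. 0)"
definition plus_series :: "'a series \<Rightarrow> 'a series \<Rightarrow> 'a series"
  where "f + g = Series (\<lambda>m. coeff f m + coeff g m)"
definition uminus_series :: "'a series \<Rightarrow> 'a series"
  where "- f = Series (\<lambda>m. - coeff f m)"
definition minus_series :: "'a series \<Rightarrow> 'a series \<Rightarrow> 'a series"
  where "f - g = Series (\<lambda>m. coeff f m - coeff g m)"
instance
  by standard
    (auto intro!: series_eqI simp: zero_series_def plus_series_def uminus_series_def minus_series_def)
end

text \<open>The Cauchy product of a scalar series with a module-valued series.\<close>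

definition sscale :: "('r \<Rightarrow> 'm \<Rightarrow> 'm) \<Rightarrow> 'r series \<Rightarrow> 'm series \<Rightarrow> ('m::comm_monoid_add) series"
  where "sscale s f a = Series (\<lambda>m. \<Sum>(p, q) | p + q = m. s (coeff f p) (coeff a q))"

definition sconst :: "'a \<Rightarrow> ('a::zero) series"
  where "sconst a = Series (\<lambda>m. if m = {#} then a else 0)"

definition svar :: "nat \<Rightarrow> ('r::zero_neq_one) series"
  where "svar i = Series (\<lambda>m. if m = {#i#} then 1 else 0)"

definition series_over :: "nat \<Rightarrow> ('a::zero) series set"
  where "series_over n = {f. \<forall>m. coeff f m \<noteq> 0 \<longrightarrow> set_mset m \<subseteq> {..<n}}"

lemma finite_splittings [simp]: "finite {(p, q). p + q = (m :: 'a multiset)}"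
proof (induction m)
  case empty
  have "{(p, q). p + q = ({#} :: 'a multiset)} = {({#}, {#})}" by auto
  then show ?case by simp
next
  case (add x m)
  have "{(p, q). p + q = add_mset x m} \<subseteq>
      (\<lambda>(p, q). (add_mset x p, q)) ` {(p, q). p + q = m} \<union>
      (\<lambda>(p, q). (p, add_mset x q)) ` {(p, q). p + q = m}"
  proof clarify
    fix p q assume pq: "p + q = add_mset x m"
      and n: "(p, q) \<notin> (\<lambda>(p, q). (p, add_mset x q)) ` {(p, q). p + q = m}"
    show "(p, q) \<in> (\<lambda>(p, q). (add_mset x p, q)) ` {(p, q). p + q = m}"
    proof (cases "x \<in># p")
      case True
      then obtain p' where "p = add_mset x p'" by (metis insert_DiffM)
      with pq show ?thesis by (auto intro!: image_eqI[of _ _ "(p', q)"])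
    next
      case False
      with pq have "x \<in># q" by (metis union_iff union_single_eq_member add_mset_add_single)
      then obtain q' where "q = add_mset x q'" by (metis insert_DiffM)
      with pq n show ?thesis by (auto simp: image_iff)
    qed
  qed
  with add show ?case by (meson finite_UnI finite_imageI finite_subset)
qed

instantiation series :: (comm_ring_1) comm_ring_1
begin
definition one_series :: "'a series" where "1 = sconst 1"
definition times_series :: "'a series \<Rightarrow> 'a series \<Rightarrow> 'a series" where "f * g = sscale (*) f g"
instance
proof
  fix a b c :: "'a series"
  have coeff_times: "coeff (f * g) m = (\<Sum>(p, q) | p + q = m. coeff f p * coeff g q)"
    for f g :: "'a series" and m
    by (simp add: times_series_def sscale_def)
  show "a * b * c = a * (b * c)"
  proof (rule series_eqI)
    fix m :: "nat multiset"
    have "coeff (a * b * c) m =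
        (\<Sum>z \<in> {(p, q). p + q = m}. \<Sum>w \<in> {(p, q). p + q = fst z}.
          coeff a (fst w) * coeff b (snd w) * coeff c (snd z))"
      by (simp add: coeff_times case_prod_beta sum_distrib_right)
    also have "\<dots> = (\<Sum>(z, w) \<in> (SIGMA z:{(p, q). p + q = m}. {(p, q). p + q = fst z}).
          coeff a (fst w) * coeff b (snd w) * coeff c (snd z))"
      by (subst sum.Sigma) auto
    also have "\<dots> = (\<Sum>(z, w) \<in> (SIGMA z:{(p, q). p + q = m}. {(p, q). p + q = snd z}).
          coeff a (fst z) * (coeff b (fst w) * coeff c (snd w)))"
      by (rule sum.reindex_bij_witness
            [of _ "\<lambda>(z, w). ((fst z + fst w, snd w), (fst z, fst w))"
                  "\<lambda>(z, w). ((fst w, snd w + snd z), (snd w, snd z))"])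
        (auto simp: mult.assoc add.assoc)
    also have "\<dots> = (\<Sum>z \<in> {(p, q). p + q = m}. \<Sum>w \<in> {(p, q). p + q = snd z}.
          coeff a (fst z) * (coeff b (fst w) * coeff c (snd w)))"
      by (subst sum.Sigma) auto
    also have "\<dots> = coeff (a * (b * c)) m"
      by (simp add: coeff_times case_prod_beta sum_distrib_left)
    finally show "coeff (a * b * c) m = coeff (a * (b * c)) m" .
  qed
  show "a * b = b * a"
  proof (rule series_eqI)
    fix m
    show "coeff (a * b) m = coeff (b * a) m"
      unfolding coeff_times
      by (rule sum.reindex_bij_witness[of _ prod.swap prod.swap])
        (auto simp: add.commute mult.commute)
  qed
  show "1 * a = a"
  proof (rule series_eqI)
    fix m
    have "coeff (1 * a) m = (\<Sum>z \<in> {(p, q). p + q = m}. if z = ({#}, m) then coeff a m else 0)"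
      unfolding coeff_times by (rule sum.cong) (auto simp: one_series_def sconst_def split: if_splits)
    also have "\<dots> = coeff a m" by (subst sum.delta) auto
    finally show "coeff (1 * a) m = coeff a m" .
  qed
  show "(a + b) * c = a * c + b * c"
    by (rule series_eqI)
      (simp add: coeff_times plus_series_def case_prod_beta distrib_right sum.distrib)
  show "(0 :: 'a series) \<noteq> 1"
  proof
    assume "(0 :: 'a series) = 1"
    then have "coeff (0 :: 'a series) {#} = coeff 1 {#}" by simp
    then show False by (simp add: zero_series_def one_series_def sconst_def)
  qed
qed
end

definition series_ring :: "nat \<Rightarrow> ('r::comm_ring_1) series ring"
  where "series_ring n =
    \<lparr>carrier = series_over n, monoid.mult = (*), one = 1, ring.zero = 0, add = (+)\<rparr>"

definition pderiv_series :: "nat \<Rightarrow> ('r::comm_ring_1) series \<Rightarrow> 'r series"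
  where "pderiv_series i f =
    Series (\<lambda>m. of_nat (count m i + 1) * coeff f (add_mset i m))"

text \<open>The operator \<open>\<^bold>\<onehalf>\<partial>\<^sub>i\<^sup>2\<close>, available without dividing by 2.\<close>

definition half_pderiv2 :: "nat \<Rightarrow> ('r::comm_ring_1) series \<Rightarrow> 'r series"
  where "half_pderiv2 i f =
    Series (\<lambda>m. of_nat ((count m i + 2) choose 2) * coeff f (add_mset i (add_mset i m)))"


section \<open>Clifford and exterior algebras\<close>

text \<open>Words form a monoid under concatenation, so that \<open>'m word \<Rightarrow>\<^sub>0 'k\<close> is the free associative
  algebra over \<open>'k\<close> on the set of symbols \<open>'m\<close>.\<close>

datatype 'm word = Word (letters: "'m list")

instantiation word :: (type) monoid_add
begin
definition zero_word :: "'a word" where "0 = Word []"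
definition plus_word :: "'a word \<Rightarrow> 'a word \<Rightarrow> 'a word"
  where "u + w = Word (letters u @ letters w)"
instance by standard (auto simp: zero_word_def plus_word_def)
end

definition wordlen :: "'m word \<Rightarrow> int"
  where "wordlen w = int (length (letters w))"

definition mono_word :: "'m list \<Rightarrow> ('m word \<Rightarrow>\<^sub>0 'k::comm_ring_1)"
  where "mono_word us = Poly_Mapping.single (Word us) 1"

definition scalar :: "'k::comm_ring_1 \<Rightarrow> ('m word \<Rightarrow>\<^sub>0 'k)"
  where "scalar c = Poly_Mapping.single 0 c"

definition free_algebra :: "'k::comm_ring_1 set \<Rightarrow> 'm set \<Rightarrow> ('m word \<Rightarrow>\<^sub>0 'k) ring"
  where "free_algebra K M =
    \<lparr>carrier = {t. (\<forall>w. Poly_Mapping.lookup t w \<in> K) \<and>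
                   (\<forall>w \<in> Poly_Mapping.keys t. set (letters w) \<subseteq> M)},
     monoid.mult = (*), one = 1, ring.zero = 0, add = (+)\<rparr>"

text \<open>The Clifford algebra of a \<open>K\<close>-module \<open>M\<close> with scalar multiplication \<open>s\<close> and quadratic form \<open>Q\<close>.
  The first two kinds of relation present the tensor algebra \<open>T(M)\<close> as a quotient of the free
  algebra on the underlying set of \<open>M\<close>; the third kind is \<open>u \<otimes> u = Q(u)\<close>. \<open>K\<close> and \<open>M\<close> are the
  carriers inside the ambient types.\<close>

definition clifford_relations ::
    "'k::comm_ring_1 set \<Rightarrow> 'm::ab_group_add set \<Rightarrow> ('k \<Rightarrow> 'm \<Rightarrow> 'm) \<Rightarrow> ('m \<Rightarrow> 'k) \<Rightarrow> ('m word \<Rightarrow>\<^sub>0 'k) set"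
  where "clifford_relations K M s Q =
    {mono_word [u + w] - mono_word [u] - mono_word [w] | u w. u \<in> M \<and> w \<in> M} \<union>
    {mono_word [s c u] - scalar c * mono_word [u] | c u. c \<in> K \<and> u \<in> M} \<union>
    {mono_word [u] * mono_word [u] - scalar (Q u) | u. u \<in> M}"

definition clifford_ideal ::
    "'k::comm_ring_1 set \<Rightarrow> 'm::ab_group_add set \<Rightarrow> ('k \<Rightarrow> 'm \<Rightarrow> 'm) \<Rightarrow> ('m \<Rightarrow> 'k) \<Rightarrow> ('m word \<Rightarrow>\<^sub>0 'k) set"
  where "clifford_ideal K M s Q =
    Idl\<^bsub>free_algebra K M\<^esub> (clifford_relations K M s Q)"

definition clifford ::
    "'k::comm_ring_1 set \<Rightarrow> 'm::ab_group_add set \<Rightarrow> ('k \<Rightarrow> 'm \<Rightarrow> 'm) \<Rightarrow> ('m \<Rightarrow> 'k) \<Rightarrow> ('m word \<Rightarrow>\<^sub>0 'k) set ring"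
  where "clifford K M s Q = free_algebra K M Quot clifford_ideal K M s Q"

definition clifford_class ::
    "'k::comm_ring_1 set \<Rightarrow> 'm::ab_group_add set \<Rightarrow> ('k \<Rightarrow> 'm \<Rightarrow> 'm) \<Rightarrow> ('m \<Rightarrow> 'k) \<Rightarrow>
      ('m word \<Rightarrow>\<^sub>0 'k) \<Rightarrow> ('m word \<Rightarrow>\<^sub>0 'k) set"
  where "clifford_class K M s Q t = clifford_ideal K M s Q +>\<^bsub>free_algebra K M\<^esub> t"

definition clifford_act ::
    "'k::comm_ring_1 set \<Rightarrow> 'm::ab_group_add set \<Rightarrow> ('k \<Rightarrow> 'm \<Rightarrow> 'm) \<Rightarrow> ('m \<Rightarrow> 'k) \<Rightarrow>
      'k \<Rightarrow> ('m word \<Rightarrow>\<^sub>0 'k) set \<Rightarrow> ('m word \<Rightarrow>\<^sub>0 'k) set"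
  where "clifford_act K M s Q c x =
    clifford_class K M s Q (scalar c) \<otimes>\<^bsub>clifford K M s Q\<^esub> x"

text \<open>Part of degree \<open>p\<close> mod 2.\<close>

definition clifford_part ::
    "'k::comm_ring_1 set \<Rightarrow> 'm::ab_group_add set \<Rightarrow> ('k \<Rightarrow> 'm \<Rightarrow> 'm) \<Rightarrow> ('m \<Rightarrow> 'k) \<Rightarrow>
      int \<Rightarrow> ('m word \<Rightarrow>\<^sub>0 'k) set set"
  where "clifford_part K M s Q p = clifford_class K M s Q `
    {t \<in> carrier (free_algebra K M). \<forall>w \<in> Poly_Mapping.keys t. even (wordlen w - p)}"

definition exterior :: "('r::comm_ring_1 \<Rightarrow> 'v::ab_group_add \<Rightarrow> 'v) \<Rightarrow> ('v word \<Rightarrow>\<^sub>0 'r) set ring"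
  where "exterior s = clifford UNIV UNIV s (\<lambda>_. 0)"

definition exterior_class ::
    "('r::comm_ring_1 \<Rightarrow> 'v::ab_group_add \<Rightarrow> 'v) \<Rightarrow> ('v word \<Rightarrow>\<^sub>0 'r) \<Rightarrow> ('v word \<Rightarrow>\<^sub>0 'r) set"
  where "exterior_class s = clifford_class UNIV UNIV s (\<lambda>_. 0)"

text \<open>The exterior power \<open>\<Lambda>\<^sup>p V\<close>; it is zero for negative \<open>p\<close>.\<close>

definition exterior_power ::
    "('r::comm_ring_1 \<Rightarrow> 'v::ab_group_add \<Rightarrow> 'v) \<Rightarrow> int \<Rightarrow> ('v word \<Rightarrow>\<^sub>0 'r) set set"
  where "exterior_power s p =
    exterior_class s ` {t. \<forall>w \<in> Poly_Mapping.keys t. wordlen w = p}"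


section \<open>Superfiltered deformations\<close>

definition free_basis :: "('r::comm_ring_1 \<Rightarrow> 'v::ab_group_add \<Rightarrow> 'v) \<Rightarrow> nat \<Rightarrow> (nat \<Rightarrow> 'v) \<Rightarrow> bool"
  where "free_basis s n v \<longleftrightarrow>
    Modules.module s \<and> inj_on v {..<n} \<and>
    \<not> module.dependent s (v ` {..<n}) \<and> module.span s (v ` {..<n}) = UNIV"

text \<open>The sign \<open>(-1)\<^sup>d\<close>.\<close>

definition signed :: "int \<Rightarrow> 'a::ab_group_add \<Rightarrow> 'a"
  where "signed d a = (if even d then a else - a)"

definition signed_in :: "('a, 'b) ring_scheme \<Rightarrow> int \<Rightarrow> 'a \<Rightarrow> 'a"
  where "signed_in G d a = (if even d then a else \<ominus>\<^bsub>G\<^esub> a)"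

text \<open>The \<open>\<int>/2\<close>-grading is indexed by integers, with period 2. The list \<open>[a\<^sub>k, \<dots>, a\<^sub>1]\<close> is sent by
  \<open>ops\<close> to \<open>\<mu>\<^sup>k(a\<^sub>k, \<dots>, a\<^sub>1)\<close>; the value at the empty list plays no role.\<close>

record ('r, 'x) filtered_ainf =
  smul :: "'r \<Rightarrow> 'x \<Rightarrow> 'x"
  part :: "int \<Rightarrow> 'x set"
  filt :: "int \<Rightarrow> 'x set"
  ops :: "'x list \<Rightarrow> 'x"
  unity :: 'x

definition superfiltered_module ::
    "('r::comm_ring_1 \<Rightarrow> 'x::ab_group_add \<Rightarrow> 'x) \<Rightarrow> (int \<Rightarrow> 'x set) \<Rightarrow> (int \<Rightarrow> 'x set) \<Rightarrow> bool"
  where "superfiltered_module s X F \<longleftrightarrow>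
    Modules.module s \<and>
    (\<forall>p. module.subspace s (X p)) \<and> (\<forall>p. X (p + 2) = X p) \<and>
    X 0 \<inter> X 1 = {0} \<and> (\<forall>a. \<exists>b \<in> X 0. \<exists>c \<in> X 1. a = b + c) \<and>
    (\<forall>p. module.subspace s (F p)) \<and> mono F \<and> (\<Inter>p. F p) = {0} \<and> (\<Union>p. F p) = UNIV \<and>
    (\<forall>p. \<forall>a \<in> F p. \<exists>b \<in> F p \<inter> X 0. \<exists>c \<in> F p \<inter> X 1. a = b + c) \<and>
    (\<forall>p. F (p + 1) \<inter> X p = F p \<inter> X p)"

definition multilinear :: "('r \<Rightarrow> 'x::ab_group_add \<Rightarrow> 'x) \<Rightarrow> ('x list \<Rightarrow> 'x) \<Rightarrow> bool"
  where "multilinear s m \<longleftrightarrow>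
    (\<forall>as bs a b. m (as @ (a + b) # bs) = m (as @ a # bs) + m (as @ b # bs)) \<and>
    (\<forall>as bs a c. m (as @ s c a # bs) = s c (m (as @ a # bs)))"

text \<open>The grading or filtration of the shifted module \<open>X[1]\<close>.\<close>

definition shifted :: "(int \<Rightarrow> 'x set) \<Rightarrow> int \<Rightarrow> 'x set"
  where "shifted G p = G (p + 1)"

text \<open>All operations have degree \<open>r\<close> with respect to a grading, or a filtration, \<open>G\<close>; the source
  carries the induced grading or filtration of the tensor power.\<close>

definition ops_degree :: "(int \<Rightarrow> 'x set) \<Rightarrow> int \<Rightarrow> ('x list \<Rightarrow> 'x) \<Rightarrow> bool"
  where "ops_degree G r m \<longleftrightarrow>
    (\<forall>as ps. as \<noteq> [] \<and> list_all2 (\<lambda>a p. a \<in> G p) as ps \<longrightarrow> m as \<in> G (sum_list ps + r))"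

text \<open>With \<open>as = [a\<^sub>k, \<dots>, a\<^sub>1]\<close>, the list \<open>drop (k - i) as\<close> is \<open>[a\<^sub>i, \<dots>, a\<^sub>1]\<close>.\<close>

definition ainf_relations :: "(int \<Rightarrow> 'x set) \<Rightarrow> ('x list \<Rightarrow> 'x::ab_group_add) \<Rightarrow> bool"
  where "ainf_relations X m \<longleftrightarrow>
    (\<forall>as ds. as \<noteq> [] \<and> list_all2 (\<lambda>a d. a \<in> X d) as ds \<longrightarrow>
      (let k = length as in
        (\<Sum>i<k. \<Sum>j=1..k-i.
          signed (sum_list (drop (k - i) ds) - int i)
            (m (take (k - i - j) as @ [m (take j (drop (k - i - j) as))] @ drop (k - i) as))) = 0))"

definition strict_unit :: "(int \<Rightarrow> 'x set) \<Rightarrow> ('x list \<Rightarrow> 'x::ab_group_add) \<Rightarrow> 'x \<Rightarrow> bool"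
  where "strict_unit X m e \<longleftrightarrow>
    e \<in> X 0 \<and> (\<forall>a. m [a, e] = a) \<and> (\<forall>d. \<forall>a \<in> X d. signed d (m [e, a]) = a) \<and>
    (\<forall>as. as \<noteq> [] \<and> length as \<noteq> 2 \<and> e \<in> set as \<longrightarrow> m as = 0)"

definition gr_class :: "(int \<Rightarrow> 'x set) \<Rightarrow> int \<Rightarrow> 'x \<Rightarrow> 'x::ab_group_add set"
  where "gr_class F p a = {b. b - a \<in> F (p - 1)}"

definition gr :: "(int \<Rightarrow> 'x set) \<Rightarrow> int \<Rightarrow> 'x::ab_group_add set set"
  where "gr F p = gr_class F p ` F p"

text \<open>\<open>\<phi> p\<close> identifies \<open>F\<^sup>p / F\<^bsup>p-1\<^esup>\<close> with \<open>\<Lambda>\<^sup>p V\<close>.\<close>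

definition gr_iso ::
    "('r::comm_ring_1 \<Rightarrow> 'v::ab_group_add \<Rightarrow> 'v) \<Rightarrow> ('r \<Rightarrow> 'x::ab_group_add \<Rightarrow> 'x) \<Rightarrow> (int \<Rightarrow> 'x set) \<Rightarrow>
      (int \<Rightarrow> 'x set \<Rightarrow> ('v word \<Rightarrow>\<^sub>0 'r) set) \<Rightarrow> bool"
  where "gr_iso s t F \<phi> \<longleftrightarrow> (\<forall>p.
    bij_betw (\<phi> p) (gr F p) (exterior_power s p) \<and>
    (\<forall>a \<in> F p. \<forall>b \<in> F p. \<phi> p (gr_class F p (a + b)) =
      \<phi> p (gr_class F p a) \<oplus>\<^bsub>exterior s\<^esub> \<phi> p (gr_class F p b)) \<and>
    (\<forall>c. \<forall>a \<in> F p. \<phi> p (gr_class F p (t c a)) =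
      clifford_act UNIV UNIV s (\<lambda>_. 0) c (\<phi> p (gr_class F p a))))"

text \<open>If \<open>a\<^sub>j \<in> F\<^bsup>p\<^sub>j\<^esup>\<close> then \<open>\<mu>\<^sup>k(a\<^sub>k, \<dots>, a\<^sub>1)\<close> lies in filtration level \<open>\<Sum> (p\<^sub>j - 1) + 1\<close> of the shifted
  module, that is in level \<open>\<Sum> p\<^sub>j - k + 2\<close> of the module itself, and its leading term is its class
  there.\<close>

definition standard_leading_terms ::
    "('r::comm_ring_1 \<Rightarrow> 'v::ab_group_add \<Rightarrow> 'v) \<Rightarrow> (int \<Rightarrow> 'x set) \<Rightarrow> ('x list \<Rightarrow> 'x::ab_group_add) \<Rightarrow>
      (int \<Rightarrow> 'x set \<Rightarrow> ('v word \<Rightarrow>\<^sub>0 'r) set) \<Rightarrow> bool"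
  where "standard_leading_terms s F m \<phi> \<longleftrightarrow>
    (\<forall>p q. \<forall>a \<in> F p. \<forall>b \<in> F q.
      \<phi> (p + q) (gr_class F (p + q) (m [a, b])) =
        signed_in (exterior s) q (\<phi> p (gr_class F p a) \<otimes>\<^bsub>exterior s\<^esub> \<phi> q (gr_class F q b))) \<and>
    (\<forall>as ps. as \<noteq> [] \<and> length as \<noteq> 2 \<and> list_all2 (\<lambda>a p. a \<in> F p) as ps \<longrightarrow>
      (let r = sum_list ps - int (length as) + 2 in
        \<phi> r (gr_class F r (m as)) = \<zero>\<^bsub>exterior s\<^esub>))"

definition superfiltered_deformation ::
    "('r::comm_ring_1 \<Rightarrow> 'v::ab_group_add \<Rightarrow> 'v) \<Rightarrow> ('r, 'x::ab_group_add) filtered_ainf \<Rightarrow>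
      (int \<Rightarrow> 'x set \<Rightarrow> ('v word \<Rightarrow>\<^sub>0 'r) set) \<Rightarrow> bool"
  where "superfiltered_deformation s A \<phi> \<longleftrightarrow>
    superfiltered_module (smul A) (part A) (filt A) \<and>
    multilinear (smul A) (ops A) \<and>
    ops_degree (shifted (part A)) 1 (ops A) \<and>
    ops_degree (shifted (filt A)) 1 (ops A) \<and>
    ainf_relations (part A) (ops A) \<and>
    (\<forall>a. ops A [a] = 0) \<and>
    strict_unit (part A) (ops A) (unity A) \<and>
    gr_iso s (smul A) (filt A) \<phi> \<and>
    standard_leading_terms s (filt A) (ops A) \<phi>"


section \<open>The disc potential and the deformed algebra\<close>

text \<open>\<open>v\<^sub>i\<close> as an element of \<open>A\<close>, via \<open>F\<^sup>1A \<inter> A\<^sup>1 \<cong> gr\<^sup>1 A \<cong> V\<close>.\<close>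

definition lift_basis ::
    "('r::comm_ring_1 \<Rightarrow> 'v::ab_group_add \<Rightarrow> 'v) \<Rightarrow> (nat \<Rightarrow> 'v) \<Rightarrow> ('r, 'x::ab_group_add) filtered_ainf \<Rightarrow>
      (int \<Rightarrow> 'x set \<Rightarrow> ('v word \<Rightarrow>\<^sub>0 'r) set) \<Rightarrow> nat \<Rightarrow> 'x"
  where "lift_basis s v A \<phi> i =
    (THE a. a \<in> filt A 1 \<inter> part A 1 \<and>
      \<phi> 1 (gr_class (filt A) 1 a) = exterior_class s (mono_word [v i]))"

definition bounding ::
    "nat \<Rightarrow> ('r::comm_ring_1 \<Rightarrow> 'v::ab_group_add \<Rightarrow> 'v) \<Rightarrow> (nat \<Rightarrow> 'v) \<Rightarrow>
      ('r, 'x::ab_group_add) filtered_ainf \<Rightarrow>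
      (int \<Rightarrow> 'x set \<Rightarrow> ('v word \<Rightarrow>\<^sub>0 'r) set) \<Rightarrow> 'x series"
  where "bounding n s v A \<phi> =
    (\<Sum>i<n. sscale (smul A) (svar i) (sconst (lift_basis s v A \<phi> i)))"

definition extend_ops :: "('x list \<Rightarrow> 'x) \<Rightarrow> 'x series list \<Rightarrow> ('x::ab_group_add) series"
  where "extend_ops m fs = Series (\<lambda>e.
    \<Sum>es | length es = length fs \<and> sum_list es = e. m (map2 coeff fs es))"

text \<open>As \<open>bounding\<close> is homogeneous of degree 1 in the variables, \<open>\<mu>\<^sup>k(v, \<dots>, v)\<close> only has terms of
  degree \<open>k\<close>, and the infinite sum over \<open>k\<close> reduces to a finite one in each coefficient. The
  coefficients lie in \<open>F\<^sup>0A\<close>, which is identified with \<open>R\<^sub>0\<close> by means of the unit.\<close>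

definition disc_potential ::
    "nat \<Rightarrow> ('r::comm_ring_1 \<Rightarrow> 'v::ab_group_add \<Rightarrow> 'v) \<Rightarrow> (nat \<Rightarrow> 'v) \<Rightarrow>
      ('r, 'x::ab_group_add) filtered_ainf \<Rightarrow>
      (int \<Rightarrow> 'x set \<Rightarrow> ('v word \<Rightarrow>\<^sub>0 'r) set) \<Rightarrow> 'r series"
  where "disc_potential n s v A \<phi> = Series (\<lambda>e. THE c. smul A c (unity A) =
    (\<Sum>k=2..size e. coeff (extend_ops (ops A) (replicate k (bounding n s v A \<phi>))) e))"

text \<open>\<open>weave b [i\<^sub>k, \<dots>, i\<^sub>0] [a\<^sub>k, \<dots>, a\<^sub>1]\<close> is the list \<open>b\<^bsup>i\<^sub>k\<^esup>, a\<^sub>k, \<dots>, a\<^sub>1, b\<^bsup>i\<^sub>0\<^esup>\<close>.\<close>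

fun weave :: "'a \<Rightarrow> nat list \<Rightarrow> 'a list \<Rightarrow> 'a list" where
  "weave b (i # is) (a # as) = replicate i b @ a # weave b is as"
| "weave b (i # is) [] = replicate i b"
| "weave b [] as = as"

text \<open>Again only finitely many terms of the sum over \<open>i\<^sub>k, \<dots>, i\<^sub>0\<close> contribute to the coefficient of a
  given monomial: those with \<open>i\<^sub>k + \<dots> + i\<^sub>0\<close> at most its degree.\<close>

definition bounded_ops :: "('x list \<Rightarrow> 'x) \<Rightarrow> 'x series \<Rightarrow> 'x series list \<Rightarrow> ('x::ab_group_add) series"
  where "bounded_ops m b fs = Series (\<lambda>e.
    \<Sum>is | length is = length fs + 1 \<and> sum_list is \<le> size e.
      coeff (extend_ops m (weave b is fs)) e)"

text \<open>The linear map equal to \<open>(-1)\<^bsup>|a|\<^esup> a\<close> on homogeneous \<open>a\<close>.\<close>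

definition parity_sign :: "(int \<Rightarrow> 'x set) \<Rightarrow> 'x \<Rightarrow> 'x::ab_group_add"
  where "parity_sign X a = (THE b. \<exists>c \<in> X 0. \<exists>d \<in> X 1. a = c + d \<and> b = c - d)"

definition parity_sign_series :: "(int \<Rightarrow> 'x set) \<Rightarrow> 'x series \<Rightarrow> ('x::ab_group_add) series"
  where "parity_sign_series X f = Series (\<lambda>e. parity_sign X (coeff f e))"

definition def_diff :: "('r, 'x::ab_group_add) filtered_ainf \<Rightarrow> 'x series \<Rightarrow> 'x series \<Rightarrow> 'x series"
  where "def_diff A b f = bounded_ops (ops A) b [parity_sign_series (part A) f]"

definition def_prod ::
    "('r, 'x::ab_group_add) filtered_ainf \<Rightarrow> 'x series \<Rightarrow> 'x series \<Rightarrow> 'x series \<Rightarrow> 'x series"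
  where "def_prod A b f g = bounded_ops (ops A) b [f, parity_sign_series (part A) g]"

text \<open>The module \<open>R \<otimes> A\<close> with the product of \<open>A\<^sub>v\<close>, which is associative only up to homotopy.\<close>

definition def_alg ::
    "nat \<Rightarrow> ('r, 'x::ab_group_add) filtered_ainf \<Rightarrow> 'x series \<Rightarrow> 'x series ring"
  where "def_alg n A b =
    \<lparr>carrier = series_over n, monoid.mult = def_prod A b, one = sconst (unity A),
     ring.zero = 0, add = (+)\<rparr>"

text \<open>For a list \<open>[i\<^sub>1, \<dots>, i\<^sub>r]\<close>, the product \<open>((v\<^bsub>i\<^sub>1\<^esub> \<cdot> v\<^bsub>i\<^sub>2\<^esub>) \<cdots>) \<cdot> v\<^bsub>i\<^sub>r\<^esub>\<close> in \<open>A\<^sub>v\<close>.\<close>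

fun left_product :: "('a, 'b) monoid_scheme \<Rightarrow> (nat \<Rightarrow> 'a) \<Rightarrow> nat list \<Rightarrow> 'a" where
  "left_product G w [] = \<one>\<^bsub>G\<^esub>"
| "left_product G w (i # is) = foldl (\<lambda>a j. a \<otimes>\<^bsub>G\<^esub> w j) (w i) is"


section \<open>The Clifford algebra of the Hessian and its differential\<close>

definition coordinate ::
    "nat \<Rightarrow> ('r::comm_ring_1 \<Rightarrow> 'v::ab_group_add \<Rightarrow> 'v) \<Rightarrow> (nat \<Rightarrow> 'v) \<Rightarrow> nat \<Rightarrow> 'v series \<Rightarrow> 'r series"
  where "coordinate n s v i u =
    Series (\<lambda>e. module.representation s (v ` {..<n}) (coeff u e) (v i))"

definition half_hess ::
    "nat \<Rightarrow> ('r::comm_ring_1 \<Rightarrow> 'v::ab_group_add \<Rightarrow> 'v) \<Rightarrow> (nat \<Rightarrow> 'v) \<Rightarrow> 'r series \<Rightarrow> 'v series \<Rightarrow> 'r series"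
  where "half_hess n s v P u =
    (\<Sum>i<n. (coordinate n s v i u)\<^sup>2 * half_pderiv2 i P) +
    (\<Sum>j<n. \<Sum>i<j. coordinate n s v i u * coordinate n s v j u * pderiv_series i (pderiv_series j P))"

definition hess_clifford ::
    "nat \<Rightarrow> ('r::comm_ring_1 \<Rightarrow> 'v::ab_group_add \<Rightarrow> 'v) \<Rightarrow> (nat \<Rightarrow> 'v) \<Rightarrow> 'r series \<Rightarrow>
      ('v series word \<Rightarrow>\<^sub>0 'r series) set ring"
  where "hess_clifford n s v P =
    clifford (series_over n) (series_over n) (sscale s) (\<lambda>u. - half_hess n s v P u)"

definition hess_class ::
    "nat \<Rightarrow> ('r::comm_ring_1 \<Rightarrow> 'v::ab_group_add \<Rightarrow> 'v) \<Rightarrow> (nat \<Rightarrow> 'v) \<Rightarrow> 'r series \<Rightarrow>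
      ('v series word \<Rightarrow>\<^sub>0 'r series) \<Rightarrow> ('v series word \<Rightarrow>\<^sub>0 'r series) set"
  where "hess_class n s v P =
    clifford_class (series_over n) (series_over n) (sscale s) (\<lambda>u. - half_hess n s v P u)"

definition hess_act ::
    "nat \<Rightarrow> ('r::comm_ring_1 \<Rightarrow> 'v::ab_group_add \<Rightarrow> 'v) \<Rightarrow> (nat \<Rightarrow> 'v) \<Rightarrow> 'r series \<Rightarrow> 'r series \<Rightarrow>
      ('v series word \<Rightarrow>\<^sub>0 'r series) set \<Rightarrow> ('v series word \<Rightarrow>\<^sub>0 'r series) set"
  where "hess_act n s v P =
    clifford_act (series_over n) (series_over n) (sscale s) (\<lambda>u. - half_hess n s v P u)"

definition hess_part ::
    "nat \<Rightarrow> ('r::comm_ring_1 \<Rightarrow> 'v::ab_group_add \<Rightarrow> 'v) \<Rightarrow> (nat \<Rightarrow> 'v) \<Rightarrow> 'r series \<Rightarrow> int \<Rightarrow>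
      ('v series word \<Rightarrow>\<^sub>0 'r series) set set"
  where "hess_part n s v P =
    clifford_part (series_over n) (series_over n) (sscale s) (\<lambda>u. - half_hess n s v P u)"

text \<open>The \<open>R\<close>-linear odd derivation \<open>-dP \<lrcorner> \<bullet>\<close>, taken extensional to make it unique as a function.\<close>

definition contraction ::
    "nat \<Rightarrow> ('r::comm_ring_1 \<Rightarrow> 'v::ab_group_add \<Rightarrow> 'v) \<Rightarrow> (nat \<Rightarrow> 'v) \<Rightarrow> 'r series \<Rightarrow>
      ('v series word \<Rightarrow>\<^sub>0 'r series) set \<Rightarrow> ('v series word \<Rightarrow>\<^sub>0 'r series) set"
  where "contraction n s v P =
    (let C = hess_clifford n s v P; cls = hess_class n s v P; act = hess_act n s v P;
         deg = hess_part n s v P in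
     THE d. d \<in> carrier C \<rightarrow>\<^sub>E carrier C \<and>
       (\<forall>x \<in> carrier C. \<forall>y \<in> carrier C. d (x \<oplus>\<^bsub>C\<^esub> y) = d x \<oplus>\<^bsub>C\<^esub> d y) \<and>
       (\<forall>r \<in> series_over n. \<forall>x \<in> carrier C. d (act r x) = act r (d x)) \<and>
       (\<forall>p. \<forall>x \<in> deg p. d x \<in> deg (p + 1)) \<and>
       (\<forall>p. \<forall>x \<in> deg p. \<forall>y \<in> carrier C.
         d (x \<otimes>\<^bsub>C\<^esub> y) = (d x \<otimes>\<^bsub>C\<^esub> y) \<oplus>\<^bsub>C\<^esub> signed_in C p (x \<otimes>\<^bsub>C\<^esub> d y)) \<and>
       (\<forall>i<n. d (cls (mono_word [sconst (v i)])) = cls (scalar (- pderiv_series i P))))"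


section \<open>Cohomology and its embeddings\<close>

definition cohomology :: "('a, 'b) ring_scheme \<Rightarrow> ('a \<Rightarrow> 'a) \<Rightarrow> 'a set set"
  where "cohomology G d =
    (\<lambda>z. (d ` carrier G) +>\<^bsub>G\<^esub> z) ` {z \<in> carrier G. d z = \<zero>\<^bsub>G\<^esub>}"

text \<open>The Jacobian ideal \<open>J\<close>, so that \<open>Jac(P) = R/J\<close>. The base change of an \<open>R\<close>-module \<open>G\<close> to \<open>R/J\<close> is
  formed as \<open>G/JG\<close>, where \<open>JG\<close> is the additive subgroup generated by the products of elements of
  \<open>J\<close> and \<open>G\<close>.\<close>

definition jac_ideal :: "nat \<Rightarrow> ('r::comm_ring_1) series \<Rightarrow> 'r series set"
  where "jac_ideal n P = Idl\<^bsub>series_ring n\<^esub> ((\<lambda>i. pderiv_series i P) ` {..<n})"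

definition ideal_mult ::
    "'k set \<Rightarrow> ('k \<Rightarrow> 'a \<Rightarrow> 'a) \<Rightarrow> ('a, 'b) ring_scheme \<Rightarrow> 'a set"
  where "ideal_mult J act G = generate (add_monoid G) {act r x | r x. r \<in> J \<and> x \<in> carrier G}"

definition jac_hess ::
    "nat \<Rightarrow> ('r::comm_ring_1 \<Rightarrow> 'v::ab_group_add \<Rightarrow> 'v) \<Rightarrow> (nat \<Rightarrow> 'v) \<Rightarrow> 'r series \<Rightarrow>
      ('v series word \<Rightarrow>\<^sub>0 'r series) set set"
  where "jac_hess n s v P =
    ideal_mult (jac_ideal n P) (hess_act n s v P) (hess_clifford n s v P)"

text \<open>The algebra \<open>Cl(-\<^bold>\<onehalf>Hess P) \<otimes> Jac(P)\<close> over \<open>R\<close>, and its \<open>\<int>/2\<close>-grading.\<close>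

definition jac_clifford ::
    "nat \<Rightarrow> ('r::comm_ring_1 \<Rightarrow> 'v::ab_group_add \<Rightarrow> 'v) \<Rightarrow> (nat \<Rightarrow> 'v) \<Rightarrow> 'r series \<Rightarrow>
      ('v series word \<Rightarrow>\<^sub>0 'r series) set set ring"
  where "jac_clifford n s v P = hess_clifford n s v P Quot jac_hess n s v P"

definition jac_class ::
    "nat \<Rightarrow> ('r::comm_ring_1 \<Rightarrow> 'v::ab_group_add \<Rightarrow> 'v) \<Rightarrow> (nat \<Rightarrow> 'v) \<Rightarrow> 'r series \<Rightarrow>
      ('v series word \<Rightarrow>\<^sub>0 'r series) set \<Rightarrow> ('v series word \<Rightarrow>\<^sub>0 'r series) set set"
  where "jac_class n s v P x = jac_hess n s v P +>\<^bsub>hess_clifford n s v P\<^esub> x"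

definition jac_part ::
    "nat \<Rightarrow> ('r::comm_ring_1 \<Rightarrow> 'v::ab_group_add \<Rightarrow> 'v) \<Rightarrow> (nat \<Rightarrow> 'v) \<Rightarrow> 'r series \<Rightarrow> int \<Rightarrow>
      ('v series word \<Rightarrow>\<^sub>0 'r series) set set set"
  where "jac_part n s v P p = jac_class n s v P ` hess_part n s v P p"

text \<open>The \<open>R\<close>-linear map from \<open>A\<^sub>v \<otimes> Jac(P)\<close> to \<open>Cl \<otimes> Jac(P)\<close> sending the basis element
  \<open>((v\<^bsub>i\<^sub>1\<^esub> \<cdot> v\<^bsub>i\<^sub>2\<^esub>) \<cdots>) \<cdot> v\<^bsub>i\<^sub>r\<^esub>\<close> to \<open>v\<^bsub>i\<^sub>1\<^esub> \<cdots> v\<^bsub>i\<^sub>r\<^esub>\<close> for each \<open>I = {i\<^sub>1 < \<dots> < i\<^sub>r}\<close>. The argument \<open>y\<close> is a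
  coset in \<open>R \<otimes> A\<close>, and the family \<open>c\<close> consists of lifts to \<open>R\<close> of its coordinates.\<close>

definition basis_iso ::
    "nat \<Rightarrow> ('r::comm_ring_1 \<Rightarrow> 'v::ab_group_add \<Rightarrow> 'v) \<Rightarrow> (nat \<Rightarrow> 'v) \<Rightarrow>
      ('r, 'x::ab_group_add) filtered_ainf \<Rightarrow>
      (int \<Rightarrow> 'x set \<Rightarrow> ('v word \<Rightarrow>\<^sub>0 'r) set) \<Rightarrow> 'r series \<Rightarrow>
      'x series set \<Rightarrow> ('v series word \<Rightarrow>\<^sub>0 'r series) set set"
  where "basis_iso n s v A \<phi> P y =
    (THE z. \<exists>c \<in> Pow {..<n} \<rightarrow> series_over n.
      (\<Sum>I \<in> Pow {..<n}. sscale (smul A) (c I)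
         (left_product (def_alg n A (bounding n s v A \<phi>)) (\<lambda>i. sconst (lift_basis s v A \<phi> i))
            (sorted_list_of_set I))) \<in> y \<and>
      z = jac_class n s v P (hess_class n s v P
        (\<Sum>I \<in> Pow {..<n}. scalar (c I) *
           mono_word (map (\<lambda>i. sconst (v i)) (sorted_list_of_set I)))))"

text \<open>A cohomology class \<open>\<xi>\<close> is a coset modulo boundaries. As boundaries lie in \<open>JG\<close>, the composite
  \<open>H(G) \<cong> H(G) \<otimes> Jac(P) \<rightarrow> H(G \<otimes> Jac(P)) = G \<otimes> Jac(P)\<close> with the universal coefficient map sends \<open>\<xi>\<close> to
  the coset \<open>\<xi> + JG\<close>.\<close>

definition embed_def ::
    "nat \<Rightarrow> ('r::comm_ring_1 \<Rightarrow> 'v::ab_group_add \<Rightarrow> 'v) \<Rightarrow> (nat \<Rightarrow> 'v) \<Rightarrow>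
      ('r, 'x::ab_group_add) filtered_ainf \<Rightarrow>
      (int \<Rightarrow> 'x set \<Rightarrow> ('v word \<Rightarrow>\<^sub>0 'r) set) \<Rightarrow> 'r series \<Rightarrow>
      'x series set \<Rightarrow> ('v series word \<Rightarrow>\<^sub>0 'r series) set set"
  where "embed_def n s v A \<phi> P \<xi> =
    (let G = def_alg n A (bounding n s v A \<phi>) in
     basis_iso n s v A \<phi> P (\<xi> <+>\<^bsub>G\<^esub> ideal_mult (jac_ideal n P) (sscale (smul A)) G))"

text \<open>For the Clifford algebra itself the final identification is the identity.\<close>

definition embed_cl ::
    "nat \<Rightarrow> ('r::comm_ring_1 \<Rightarrow> 'v::ab_group_add \<Rightarrow> 'v) \<Rightarrow> (nat \<Rightarrow> 'v) \<Rightarrow> 'r series \<Rightarrow>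
      ('v series word \<Rightarrow>\<^sub>0 'r series) set set \<Rightarrow> ('v series word \<Rightarrow>\<^sub>0 'r series) set set"
  where "embed_cl n s v P \<xi> = \<xi> <+>\<^bsub>hess_clifford n s v P\<^esub> jac_hess n s v P"

text \<open>The centre of a \<open>\<int>/2\<close>-graded ring with homogeneous parts \<open>X p\<close>, in the graded sense: commutation
  carries the Koszul sign. The ungraded centre would not do: for \<open>P = 0\<close> the image of the embedding is
  all of an exterior algebra.\<close>

definition graded_centre :: "('a, 'b) ring_scheme \<Rightarrow> (int \<Rightarrow> 'a set) \<Rightarrow> 'a set"
  where "graded_centre G X =
    {z \<in> carrier G. \<exists>w. w 0 \<in> X 0 \<and> w 1 \<in> X 1 \<and> z = w 0 \<oplus>\<^bsub>G\<^esub> w 1 \<and>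
      (\<forall>p \<in> {0, 1}. \<forall>q. \<forall>b \<in> X q. w p \<otimes>\<^bsub>G\<^esub> b = signed_in G (p * q) (b \<otimes>\<^bsub>G\<^esub> w p))}"

end

(* Let Psi be the R-linear map from the module of Cl(-1/2 Hess P) to A_v that takes v_I, for
   I = {i_1 < ... < i_r}, to the left product ((v_{i_1} . v_{i_2}) ...) . v_{i_r}. A filtration
   argument shows that these left products form an R-basis of A_v, and the A-infinity relation with two
   inputs, of which the second is v_j, says that the differential of A_v satisfies the Leibniz rule for
   right multiplication by v_j. The contraction with -dP is given by the same formula on the basis
   (v_I), so Psi is an isomorphism of complexes, and the two embeddings have the same image.

   For a cocycle z of the Clifford algebra, let d_j z be the derivative of its coordinates in the
   basis (v_I). The commutator of v_j with an element is the contraction with -d(d_j P), so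
   differentiating -dP _| z = 0 gives [v_j, z] = dP _| d_j z, which is zero modulo the Jacobian ideal.
   Hence z commutes with the generators of the quotient algebra. *)

theory Submission
  imports Defs "HOL-Library.Function_Algebras"
begin

section \<open>Series\<close>

text \<open>The Clifford algebra is given by generators and relations over a ring in which 2 need
  not be invertible, so neither the independence of the v_I nor a symmetric bilinear form comes for
  free. Both are replaced by an explicit model: functions on sets of indices, on which v_i acts by
  exterior multiplication plus contractions from a triangular bilinear form whose quadratic form is
  the given one. Evaluating this action at the coordinates of 1 decides membership in the ideal of
  relations; from then on the differential, graded commutators and multiples of the Jacobian ideal
  are read off from coordinates. On the A-infinity side the obstacle is the unbounded number of
  insertions. Coefficient by coefficient they are sums over shuffles of inserted letters with
  inputs; the letters have reduced degree 0, so the relations of A add up to those of A_v without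
  new signs. The curvature is a multiple of the strict unit and drops out of the relation.\<close>

lemma coeff_zero [simp]: "coeff 0 m = 0"
  by (simp add: zero_series_def)

lemma coeff_add [simp]: "coeff (f + g) m = coeff f m + coeff g m"
  by (simp add: plus_series_def)

lemma coeff_uminus [simp]: "coeff (- f) m = - coeff f m"
  by (simp add: uminus_series_def)

lemma coeff_diff [simp]: "coeff (f - g) m = coeff f m - coeff g m"
  by (simp add: minus_series_def)

lemma coeff_sum: "coeff (\<Sum>i\<in>I. f i) m = (\<Sum>i\<in>I. coeff (f i) m)"
  by (induction I rule: infinite_finite_induct) auto

lemma coeff_sscale: "coeff (sscale s f a) m = (\<Sum>(p, q) | p + q = m. s (coeff f p) (coeff a q))"
  by (simp add: sscale_def)

lemma coeff_times: "coeff (f * g) m = (\<Sum>(p, q) | p + q = m. coeff f p * coeff g q)"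
  by (simp add: times_series_def coeff_sscale)

lemma coeff_sconst: "coeff (sconst a) m = (if m = {#} then a else 0)"
  by (simp add: sconst_def)

lemma coeff_one: "coeff 1 m = (if m = {#} then 1 else 0)"
  by (simp add: one_series_def coeff_sconst)

lemma coeff_svar: "coeff (svar i) m = (if m = {#i#} then 1 else 0)"
  by (simp add: svar_def)

text \<open>Both sides run over the splittings of \<open>m\<close> into three parts. This is the
  associativity behind the composition of coefficientwise operators.\<close>

lemma sum_splits_assoc:
  "(\<Sum>(p, q) | p + q = m. \<Sum>(a, b) | a + b = p. F a b q) =
   (\<Sum>(a, r) | a + r = m. \<Sum>(b, q) | b + q = r. F a b q)"
  for m :: "'a multiset"
proof -
  have "(\<Sum>(p, q) | p + q = m. \<Sum>(a, b) | a + b = p. F a b q) =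
      (\<Sum>(z, w) \<in> (SIGMA z:{(p, q). p + q = m}. {(a, b). a + b = fst z}). F (fst w) (snd w) (snd z))"
    by (subst sum.Sigma[symmetric]) (auto simp: case_prod_beta)
  also have "\<dots> = (\<Sum>(z, w) \<in> (SIGMA z:{(p, q). p + q = m}. {(a, b). a + b = snd z}).
      F (fst z) (fst w) (snd w))"
    by (rule sum.reindex_bij_witness
          [of _ "\<lambda>(z, w). ((fst z + fst w, snd w), (fst z, fst w))"
                "\<lambda>(z, w). ((fst w, snd w + snd z), (snd w, snd z))"])
      (auto simp: add.assoc)
  also have "\<dots> = (\<Sum>(a, r) | a + r = m. \<Sum>(b, q) | b + q = r. F a b q)"
    by (subst sum.Sigma[symmetric]) (auto simp: case_prod_beta)
  finally show ?thesis .
qed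

lemma sum_splits_commute:
  "(\<Sum>(p, q) | p + q = m. F p q) = (\<Sum>(p, q) | p + q = m. F q p)" for m :: "'a multiset"
  by (rule sum.reindex_bij_witness[of _ prod.swap prod.swap]) (auto simp: add.commute)

lemma sum_splits_empty_left:
  fixes m :: "'a multiset"
  assumes "\<And>p q. p + q = m \<Longrightarrow> p \<noteq> {#} \<Longrightarrow> F p q = 0"
  shows "(\<Sum>(p, q) | p + q = m. F p q) = F {#} m"
proof -
  have "(\<Sum>(p, q) | p + q = m. F p q) = (\<Sum>z \<in> {({#}, m)}. case z of (p, q) \<Rightarrow> F p q)"
  proof (rule sum.mono_neutral_right)
    show "\<forall>z \<in> {(p, q). p + q = m} - {({#}, m)}. (case z of (p, q) \<Rightarrow> F p q) = 0"
      using assms by (auto, metis add_0)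
  qed auto
  then show ?thesis by simp
qed

lemma sum_splits_empty_right:
  fixes m :: "'a multiset"
  assumes "\<And>p q. p + q = m \<Longrightarrow> q \<noteq> {#} \<Longrightarrow> F p q = 0"
  shows "(\<Sum>(p, q) | p + q = m. F p q) = F m {#}"
  by (subst sum_splits_commute, rule sum_splits_empty_left)
    (use assms add.commute in metis)

lemma coeff_pderiv: "coeff (pderiv_series i f) m = of_nat (count m i + 1) * coeff f (add_mset i m)"
  by (simp add: pderiv_series_def)

text \<open>A splitting whose left part omits \<open>i\<close> has weight 0; in the others one copy
  of \<open>i\<close> can be taken out of the left part. This is how the derivative of one factor of
  a Cauchy product appears.\<close>

lemma sum_splits_add_mset:
  fixes F :: "nat multiset \<Rightarrow> nat multiset \<Rightarrow> 'r::comm_ring_1"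
  shows "(\<Sum>(p, q) | p + q = add_mset i m. of_nat (count p i) * F p q) =
    (\<Sum>(p, q) | p + q = m. of_nat (count p i + 1) * F (add_mset i p) q)"
proof -
  have "(\<Sum>(p, q) | p + q = add_mset i m. of_nat (count p i) * F p q) =
      (\<Sum>(p, q) \<in> {(p, q). p + q = add_mset i m \<and> i \<in># p}. of_nat (count p i) * F p q)"
  proof (rule sum.mono_neutral_right)
    show "\<forall>z \<in> {(p, q). p + q = add_mset i m} - {(p, q). p + q = add_mset i m \<and> i \<in># p}.
        (case z of (p, q) \<Rightarrow> of_nat (count p i) * F p q) = 0"
    proof
      fix z assume "z \<in> {(p, q). p + q = add_mset i m} - {(p, q). p + q = add_mset i m \<and> i \<in># p}"
      then have "count (fst z) i = 0" by (cases z) (simp add: not_in_iff)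
      then show "(case z of (p, q) \<Rightarrow> of_nat (count p i) * F p q) = 0" by (cases z) simp
    qed
  qed auto
  also have "\<dots> = (\<Sum>(p, q) | p + q = m. of_nat (count p i + 1) * F (add_mset i p) q)"
    by (rule sum.reindex_bij_witness[of _ "\<lambda>(p, q). (add_mset i p, q)" "\<lambda>(p, q). (p - {#i#}, q)"])
      (auto simp: insert_DiffM)
  finally show ?thesis .
qed

text \<open>The exponent of a variable in a product monomial is the sum of its exponents in the two
  factors, so the weighted convolution splits in two; the second half is brought to the form of the
  first by swapping the factors.\<close>

lemma pderiv_series_mult:
  "pderiv_series i (f * g) = pderiv_series i f * g + f * pderiv_series i g"
proof (rule series_eqI)
  fix m
  have "coeff (pderiv_series i (f * g)) m =
      (\<Sum>(p, q) | p + q = add_mset i m. of_nat (count p i + count q i) * (coeff f p * coeff g q))"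
    unfolding coeff_pderiv coeff_times sum_distrib_left
  proof (rule sum.cong[OF refl], clarify)
    fix p q assume "p + q = add_mset i m"
    then have "count p i + count q i = count m i + 1"
      by (metis count_add_mset count_union Suc_eq_plus1)
    then show "of_nat (count m i + 1) * (coeff f p * coeff g q) =
        of_nat (count p i + count q i) * (coeff f p * coeff g q)" by simp
  qed
  also have "\<dots> = (\<Sum>(p, q) | p + q = add_mset i m. of_nat (count p i) * (coeff f p * coeff g q)) +
      (\<Sum>(p, q) | p + q = add_mset i m. of_nat (count q i) * (coeff f p * coeff g q))"
    by (simp add: case_prod_beta distrib_right sum.distrib)
  also have "(\<Sum>(p, q) | p + q = add_mset i m. of_nat (count q i) * (coeff f p * coeff g q)) =
      (\<Sum>(p, q) | p + q = add_mset i m. of_nat (count p i) * (coeff f q * coeff g p))"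
    by (rule sum_splits_commute)
  also have "\<dots> = (\<Sum>(p, q) | p + q = m. of_nat (count p i + 1) * (coeff f q * coeff g (add_mset i p)))"
    by (rule sum_splits_add_mset)
  also have "\<dots> = (\<Sum>(p, q) | p + q = m. of_nat (count q i + 1) * (coeff f p * coeff g (add_mset i q)))"
    by (rule sum_splits_commute)
  also have "\<dots> = coeff (f * pderiv_series i g) m"
    by (simp add: coeff_times coeff_pderiv algebra_simps)
  also have "(\<Sum>(p, q) | p + q = add_mset i m. of_nat (count p i) * (coeff f p * coeff g q)) =
      coeff (pderiv_series i f * g) m"
    by (subst sum_splits_add_mset) (simp add: coeff_times coeff_pderiv mult.assoc)
  finally show "coeff (pderiv_series i (f * g)) m =
      coeff (pderiv_series i f * g + f * pderiv_series i g) m" by simp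
qed

lemma pderiv_series_add: "pderiv_series i (f + g) = pderiv_series i f + pderiv_series i g"
  by (rule series_eqI) (simp add: coeff_pderiv algebra_simps)

lemma pderiv_series_zero [simp]: "pderiv_series i 0 = 0"
  by (rule series_eqI) (simp add: coeff_pderiv)

lemma pderiv_series_uminus: "pderiv_series i (- f) = - pderiv_series i f"
  by (rule series_eqI) (simp add: coeff_pderiv algebra_simps)

lemma pderiv_series_sum: "pderiv_series i (\<Sum>j\<in>J. f j) = (\<Sum>j\<in>J. pderiv_series i (f j))"
  by (induction J rule: infinite_finite_induct) (auto simp: pderiv_series_add)

lemma pderiv_series_commute:
  "pderiv_series i (pderiv_series j f) = pderiv_series j (pderiv_series i f)"
  by (rule series_eqI) (auto simp: coeff_pderiv algebra_simps add_mset_commute)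

text \<open>On coefficients this is (k+1)(k+2) = 2 * binom(k+2, 2). It identifies twice a diagonal
  entry of the halved Hessian with a true second derivative, as the commutator of v_j with itself
  requires.\<close>

lemma pderiv_series_twice: "pderiv_series i (pderiv_series i f) = half_pderiv2 i f + half_pderiv2 i f"
proof (rule series_eqI)
  fix m
  have "(count m i + 1) * (count m i + 2) = 2 * ((count m i + 2) choose 2)"
    by (simp add: choose_two)
  then have "(of_nat (count m i + 1) * of_nat (count m i + 2) :: 'a) =
      2 * of_nat ((count m i + 2) choose 2)"
    by (metis of_nat_mult of_nat_numeral)
  then have "of_nat (count m i + 1) * (of_nat (count m i + 2) * coeff f (add_mset i (add_mset i m))) =
      2 * (of_nat ((count m i + 2) choose 2) * coeff f (add_mset i (add_mset i m)))"
    by (simp only: mult.assoc[symmetric])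
  moreover have "count (add_mset i m) i + 1 = count m i + 2" by simp
  ultimately show "coeff (pderiv_series i (pderiv_series i f)) m =
      coeff (half_pderiv2 i f + half_pderiv2 i f) m"
    by (simp only: coeff_pderiv half_pderiv2_def coeff_add coeff_Series mult_2)
qed

lemma series_overI: "(\<And>m. coeff f m \<noteq> 0 \<Longrightarrow> set_mset m \<subseteq> {..<n}) \<Longrightarrow> f \<in> series_over n"
  by (auto simp: series_over_def)

lemma series_overD: "f \<in> series_over n \<Longrightarrow> \<not> set_mset m \<subseteq> {..<n} \<Longrightarrow> coeff f m = 0"
  by (auto simp: series_over_def)

lemma series_over_zero [simp]: "0 \<in> series_over n"
  by (auto intro: series_overI)

lemma series_over_one [simp]: "1 \<in> series_over n"
  by (auto intro!: series_overI simp: coeff_one split: if_splits)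

lemma series_over_sconst [simp]: "sconst a \<in> series_over n"
  by (auto intro!: series_overI simp: coeff_sconst split: if_splits)

lemma series_over_add [intro]: "f \<in> series_over n \<Longrightarrow> g \<in> series_over n \<Longrightarrow> f + g \<in> series_over n"
  by (force simp: series_over_def)

lemma series_over_uminus [intro]: "f \<in> series_over n \<Longrightarrow> - f \<in> series_over n"
  for f :: "'a::ab_group_add series"
  by (force simp: series_over_def)

lemma series_over_diff [intro]: "f \<in> series_over n \<Longrightarrow> g \<in> series_over n \<Longrightarrow> f - g \<in> series_over n"
  for f :: "'a::ab_group_add series"
  by (metis diff_conv_add_uminus series_over_add series_over_uminus)

lemma series_over_sum [intro]: "(\<And>i. i \<in> I \<Longrightarrow> f i \<in> series_over n) \<Longrightarrow> (\<Sum>i\<in>I. f i) \<in> series_over n"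
  for f :: "'i \<Rightarrow> 'a::ab_group_add series"
  by (induction I rule: infinite_finite_induct) auto

lemma series_over_convolution:
  assumes "\<And>m. coeff h m = (\<Sum>(p, q) | p + q = m. B p (coeff f p) q (coeff g q))"
    and "f \<in> series_over n" "g \<in> series_over n"
    and "\<And>p q a. B p 0 q a = 0" "\<And>p q a. B p a q 0 = 0"
  shows "h \<in> series_over n"
proof (rule series_overI, rule ccontr)
  fix m assume "coeff h m \<noteq> 0" and m: "\<not> set_mset m \<subseteq> {..<n}"
  moreover have "(\<Sum>(p, q) | p + q = m. B p (coeff f p) q (coeff g q)) = 0"
  proof (rule sum.neutral, clarify)
    fix p q assume "m = p + q"
    with m have "\<not> set_mset p \<subseteq> {..<n} \<or> \<not> set_mset q \<subseteq> {..<n}" by auto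
    with assms(2-5) series_overD show "B p (coeff f p) q (coeff g q) = 0" by metis
  qed
  ultimately show False using assms(1) by simp
qed

lemma series_over_times [intro]: "f \<in> series_over n \<Longrightarrow> g \<in> series_over n \<Longrightarrow> f * g \<in> series_over n"
  by (rule series_over_convolution[where B = "\<lambda>p a q b. a * b" and f = f and g = g])
    (auto simp: coeff_times)

lemma series_over_pderiv [intro]: "f \<in> series_over n \<Longrightarrow> pderiv_series i f \<in> series_over n"
proof (rule series_overI)
  fix m assume "f \<in> series_over n" "coeff (pderiv_series i f) m \<noteq> 0"
  then have "coeff f (add_mset i m) \<noteq> 0" by (auto simp: coeff_pderiv)
  with \<open>f \<in> series_over n\<close> have "set_mset (add_mset i m) \<subseteq> {..<n}" by (metis series_overD)
  then show "set_mset m \<subseteq> {..<n}" by auto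
qed

lemma series_over_half_pderiv2 [intro]: "f \<in> series_over n \<Longrightarrow> half_pderiv2 i f \<in> series_over n"
proof (rule series_overI)
  fix m assume f: "f \<in> series_over n" and "coeff (half_pderiv2 i f) m \<noteq> 0"
  then have "coeff f (add_mset i (add_mset i m)) \<noteq> 0" by (auto simp: half_pderiv2_def)
  with f have "set_mset (add_mset i (add_mset i m)) \<subseteq> {..<n}" by (metis series_overD)
  then show "set_mset m \<subseteq> {..<n}" by auto
qed

lemma series_ring_cring: "cring (series_ring n :: ('r::comm_ring_1) series ring)"
proof (rule cringI)
  show "abelian_group (series_ring n :: 'r series ring)"
  proof (rule abelian_groupI)
    fix x :: "'r series" assume "x \<in> carrier (series_ring n)"
    then show "\<exists>y\<in>carrier (series_ring n). y \<oplus>\<^bsub>series_ring n\<^esub> x = \<zero>\<^bsub>series_ring n\<^esub>"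
      by (intro bexI[of _ "- x"]) (auto simp: series_ring_def)
  qed (auto simp: series_ring_def algebra_simps)
  show "Group.comm_monoid (series_ring n :: 'r series ring)"
    by (rule comm_monoidI) (auto simp: series_ring_def algebra_simps)
qed (auto simp: series_ring_def algebra_simps)

section \<open>Wedge and contraction operators\<close>

definition scl :: "'k::comm_ring_1 \<Rightarrow> ('a \<Rightarrow> 'k) \<Rightarrow> 'a \<Rightarrow> 'k"
  where "scl c f = (\<lambda>I. c * f I)"

lemma scl_apply [simp]: "scl c f I = c * f I"
  by (simp add: scl_def)

definition linop :: "(('a \<Rightarrow> 'k::comm_ring_1) \<Rightarrow> ('b \<Rightarrow> 'k)) \<Rightarrow> bool"
  where "linop T \<longleftrightarrow> (\<forall>f g. T (f + g) = T f + T g) \<and> (\<forall>c f. T (scl c f) = scl c (T f))"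

lemma linop_add: "linop T \<Longrightarrow> T (f + g) = T f + T g"
  and linop_scl: "linop T \<Longrightarrow> T (scl c f) = scl c (T f)"
  by (auto simp: linop_def)

lemma linop_zero: "linop T \<Longrightarrow> T 0 = 0"
  using linop_add[of T 0 0] by simp

lemma linop_uminus: "linop T \<Longrightarrow> T (- f) = - T f"
  using linop_add[of T f "- f"] linop_zero[of T] by (simp add: minus_unique)

lemma linop_diff: "linop T \<Longrightarrow> T (f - g) = T f - T g"
  using linop_add[of T f "- g"] linop_uminus[of T g] by simp

lemma linop_sum: "linop T \<Longrightarrow> T (\<Sum>i\<in>J. f i) = (\<Sum>i\<in>J. T (f i))"
  by (induction J rule: infinite_finite_induct) (auto simp: linop_add linop_zero)

lemma sum_fun_apply: "(\<Sum>i\<in>J. f i) x = (\<Sum>i\<in>J. f i x)"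
  for f :: "'i \<Rightarrow> 'a \<Rightarrow> 'b::comm_monoid_add"
  by (induction J rule: infinite_finite_induct) auto

lemma linop_sum_ops: "(\<And>j. j \<in> J \<Longrightarrow> linop (T j)) \<Longrightarrow> linop (\<lambda>f. \<Sum>j\<in>J. T j f)"
  by (induction J rule: infinite_finite_induct) (auto simp: linop_def fun_eq_iff algebra_simps)

lemma linop_scl_op: "linop T \<Longrightarrow> linop (\<lambda>f. scl c (T f))"
  by (auto simp: linop_def fun_eq_iff algebra_simps)

lemma linop_add_ops: "linop T \<Longrightarrow> linop U \<Longrightarrow> linop (\<lambda>f. T f + U f)"
  by (auto simp: linop_def fun_eq_iff algebra_simps)

text \<open>A function on sets of indices is read as a coordinate vector: its value at
  \<open>I\<close> is the coefficient of the product of the v_k, k in \<open>I\<close>, in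
  increasing order. The sign is that of moving v_i from the far left to its sorted place, past the
  v_k with k < i.\<close>

definition sg :: "nat \<Rightarrow> nat set \<Rightarrow> 'k::comm_ring_1"
  where "sg i I = (- 1) ^ card {k \<in> I. k < i}"

text \<open>Left exterior multiplication by v_i in coordinates.\<close>

definition wedge :: "nat \<Rightarrow> (nat set \<Rightarrow> 'k) \<Rightarrow> nat set \<Rightarrow> 'k::comm_ring_1"
  where "wedge i f = (\<lambda>I. if i \<in> I then sg i I * f (I - {i}) else 0)"

text \<open>The interior product with the i-th dual basis vector in coordinates.\<close>

definition contr :: "nat \<Rightarrow> (nat set \<Rightarrow> 'k) \<Rightarrow> nat set \<Rightarrow> 'k::comm_ring_1"
  where "contr i f = (\<lambda>I. if i \<in> I then 0 else sg i I * f (insert i I))"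

lemma sg_insert: "sg i (insert j I) = (if j < i \<and> j \<notin> I then - sg i I else sg i I)"
proof -
  have "{k \<in> insert j I. k < i} = (if j < i then insert j {k \<in> I. k < i} else {k \<in> I. k < i})"
    by auto
  then show ?thesis by (auto simp: sg_def insert_absorb)
qed

lemma sg_remove: "(sg i (I - {j}) :: 'k::comm_ring_1) = (if j < i \<and> j \<in> I then - sg i I else sg i I)"
proof -
  have "(sg i (insert j (I - {j})) :: 'k) = (if j < i then - sg i (I - {j}) else sg i (I - {j}))"
    by (subst sg_insert) simp
  then show ?thesis by (cases "j \<in> I"; cases "j < i") (simp_all add: insert_absorb)
qed

lemma sg_self: "sg i I * sg i I = 1"
  by (simp add: sg_def flip: power_mult_distrib)

lemma sg_self': "sg i I * (sg i I * c) = c"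
  by (simp add: sg_self flip: mult.assoc)

lemma linop_wedge: "linop (wedge i)" and linop_contr: "linop (contr i)"
  by (auto simp: linop_def wedge_def contr_def fun_eq_iff algebra_simps)

lemma wedge_wedge_same: "wedge i (wedge i f) = 0"
  by (auto simp: wedge_def fun_eq_iff)

lemma wedge_wedge: "wedge i (wedge j f) = - wedge j (wedge i f)"
proof (cases "i = j")
  case False
  have "wedge i (wedge j f) I = - wedge j (wedge i f) I" for I
  proof (cases "i \<in> I \<and> j \<in> I")
    case True
    have *: "I - {i} - {j} = I - {j} - {i}" by auto
    show ?thesis using True False
      by (cases i j rule: linorder_cases)
        (simp_all add: wedge_def * sg_remove mult.left_commute)
  qed (auto simp: wedge_def)
  then show ?thesis by (simp add: fun_eq_iff)
qed (simp add: wedge_wedge_same)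

lemma contr_contr: "contr i (contr j f) = - contr j (contr i f)"
proof (cases "i = j")
  case False
  have "contr i (contr j f) I = - contr j (contr i f) I" for I
  proof (cases "i \<notin> I \<and> j \<notin> I")
    case True
    have *: "insert i (insert j I) = insert j (insert i I)" by auto
    show ?thesis using True False
      by (cases i j rule: linorder_cases)
        (simp_all add: contr_def * sg_insert mult.left_commute)
  qed (auto simp: contr_def)
  then show ?thesis by (simp add: fun_eq_iff)
qed (auto simp: contr_def fun_eq_iff)

text \<open>The canonical anticommutation relation. Together with the relations for two wedges and
  for two contractions it carries the verification of the Clifford relations, without further
  inspection of signs.\<close>

lemma contr_wedge: "contr i (wedge j f) = (if i = j then f else 0) - wedge j (contr i f)"
proof (cases "i = j")
  case True
  have "contr i (wedge i f) I + wedge i (contr i f) I = f I" for I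
  proof (cases "i \<in> I")
    case True
    then show ?thesis by (simp add: contr_def wedge_def sg_remove insert_absorb sg_self')
  next
    case False
    then show ?thesis by (simp add: contr_def wedge_def sg_insert sg_self')
  qed
  then show ?thesis using True by (simp add: fun_eq_iff eq_diff_eq)
next
  case False
  then have "contr i (wedge j f) I = - wedge j (contr i f) I" for I
  proof (cases "i \<notin> I \<and> j \<in> I")
    case True
    then have *: "insert i I - {j} = insert i (I - {j})" using False by auto
    show ?thesis using True False
      by (cases i j rule: linorder_cases)
        (simp_all add: contr_def wedge_def * sg_insert sg_remove mult.left_commute)
  qed (auto simp: contr_def wedge_def)
  then show ?thesis using False by (simp add: fun_eq_iff)
qed

text \<open>The coordinates of the basis product of \<open>J\<close>; in particular
  \<open>del {}\<close> are those of 1.\<close>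

definition del :: "nat set \<Rightarrow> nat set \<Rightarrow> 'k::comm_ring_1"
  where "del J = (\<lambda>L. if L = J then 1 else 0)"

text \<open>The interior product with a covector of components \<open>p i\<close>. For -dP it
  becomes the differential of the Clifford algebra, for a row of the polar form a graded
  commutator.\<close>

definition contrs :: "nat \<Rightarrow> (nat \<Rightarrow> 'k) \<Rightarrow> (nat set \<Rightarrow> 'k) \<Rightarrow> nat set \<Rightarrow> 'k::comm_ring_1"
  where "contrs n p f = (\<Sum>i<n. scl (p i) (contr i f))"

text \<open>Left multiplication by \<open>v i\<close> in the coordinates of a Clifford algebra with respect to the basis of
  increasing products \<open>v J\<close>. As only \<open>contr k\<close> with \<open>k \<le> i\<close> occurs, multiplying \<open>v J\<close> by a generator that
  precedes all of \<open>J\<close> needs no correction term.\<close>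

definition lop :: "(nat \<Rightarrow> nat \<Rightarrow> 'k) \<Rightarrow> nat \<Rightarrow> (nat set \<Rightarrow> 'k) \<Rightarrow> nat set \<Rightarrow> 'k::comm_ring_1"
  where "lop \<beta> i f = wedge i f + contrs (Suc i) (\<beta> i) f"

lemma scl_simps:
  "scl c (f + g) = scl c f + scl c g" "scl c (f - g) = scl c f - scl c g"
  "scl c (- f) = - scl c f" "scl c 0 = 0" "scl 0 f = 0" "scl 1 f = f"
  "scl c (scl d f) = scl (c * d) f" "scl (c + d) f = scl c f + scl d f"
  "scl (- c) f = - scl c f"
  by (auto simp: fun_eq_iff algebra_simps)

lemma scl_sum: "scl c (\<Sum>i\<in>I. f i) = (\<Sum>i\<in>I. scl c (f i))"
  by (auto simp: fun_eq_iff sum_fun_apply sum_distrib_left)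

lemma linop_contrs: "linop (contrs n p)"
  unfolding contrs_def by (intro linop_sum_ops linop_scl_op linop_contr)

lemma linop_lop: "linop (lop \<beta> i)"
  unfolding lop_def by (intro linop_add_ops linop_wedge linop_contrs)

lemma contrs_Suc: "contrs (Suc n) p f = contrs n p f + scl (p n) (contr n f)"
  by (simp add: contrs_def)

lemma contrs_contr: "contrs n p (contr j f) = - contr j (contrs n p f)"
  by (simp add: contrs_def linop_sum[OF linop_contr] linop_scl[OF linop_contr] contr_contr[of _ j]
      scl_simps sum_negf)

lemma contrs_contrs: "contrs n p (contrs m r f) = - contrs m r (contrs n p f)"
  by (simp add: contrs_def[of m r] linop_sum[OF linop_contrs] linop_scl[OF linop_contrs] contrs_contr
      scl_simps sum_negf)

lemma contrs_contrs_same: "contrs n p (contrs n p f) = 0"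
proof (induction n)
  case 0
  then show ?case by (simp add: contrs_def)
next
  case (Suc n)
  have "contr n (contr n f) = 0" by (auto simp: contr_def fun_eq_iff)
  then show ?case
    unfolding contrs_Suc linop_add[OF linop_contrs] linop_scl[OF linop_contrs] contrs_contr
      linop_add[OF linop_contr] linop_scl[OF linop_contr] Suc
    by (simp add: scl_simps)
qed

lemma contrs_wedge:
  "contrs n p (wedge j f) = (if j < n then scl (p j) f else 0) - wedge j (contrs n p f)"
proof -
  have "contrs n p (wedge j f) + wedge j (contrs n p f) = (\<Sum>i<n. if i = j then scl (p j) f else 0)"
    unfolding contrs_def linop_sum[OF linop_wedge] sum.distrib[symmetric]
    by (rule sum.cong) (auto simp: contr_wedge linop_scl[OF linop_wedge] scl_simps)
  then show ?thesis by (simp add: eq_diff_eq)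
qed

text \<open>The contraction part of \<open>lop\<close> anticommutes with \<open>contrs\<close>, so
  only the wedge part contributes a scalar. Hence a contraction is an odd derivation whatever the
  quadratic form is.\<close>

lemma contrs_lop:
  "contrs n p (lop \<beta> i f) = (if i < n then scl (p i) f else 0) - lop \<beta> i (contrs n p f)"
  by (simp add: lop_def linop_add[OF linop_contrs] contrs_wedge contrs_contrs[of n])

lemma lop_lop_same: "lop \<beta> i (lop \<beta> i f) = scl (\<beta> i i) f"
  by (simp add: lop_def[of \<beta> i] linop_add[OF linop_wedge] linop_add[OF linop_contrs] wedge_wedge_same
      contrs_wedge contrs_contrs_same)

text \<open>For j < i, \<open>lop \<beta> i\<close> contracts with index j but
  \<open>lop \<beta> j\<close> does not contract with index i. So exactly one cross term survives,
  and an arbitrary polar form is realised without halving it.\<close>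

lemma lop_lop: "j < i \<Longrightarrow> lop \<beta> i (lop \<beta> j f) = scl (\<beta> i j) f - lop \<beta> j (lop \<beta> i f)"
  by (simp add: lop_def linop_add[OF linop_wedge] linop_add[OF linop_contrs] wedge_wedge[of i]
      contrs_wedge contrs_contrs[of "Suc i"] algebra_simps)

definition supp_in :: "nat set \<Rightarrow> (nat set \<Rightarrow> 'k::zero) \<Rightarrow> bool"
  where "supp_in B f \<longleftrightarrow> (\<forall>J. f J \<noteq> 0 \<longrightarrow> J \<subseteq> B)"

lemma contrs_apply: "contrs n p f J = (\<Sum>i<n. p i * contr i f J)"
  by (simp add: contrs_def sum_fun_apply)

lemma lop_apply: "lop \<beta> i f J = wedge i f J + (\<Sum>k<Suc i. \<beta> i k * contr k f J)"
  by (simp only: lop_def plus_fun_apply contrs_apply)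

lemma supp_in_contr: "supp_in B f \<Longrightarrow> supp_in B (contr i f)"
  unfolding supp_in_def
proof (intro allI impI)
  fix J assume f: "\<forall>J. f J \<noteq> 0 \<longrightarrow> J \<subseteq> B" and "contr i f J \<noteq> 0"
  then have "f (insert i J) \<noteq> 0" by (auto simp: contr_def split: if_splits)
  with f show "J \<subseteq> B" by blast
qed

lemma supp_in_wedge: "supp_in B f \<Longrightarrow> i \<in> B \<Longrightarrow> supp_in B (wedge i f)"
  unfolding supp_in_def
proof (intro allI impI)
  fix J assume f: "\<forall>J. f J \<noteq> 0 \<longrightarrow> J \<subseteq> B" and "wedge i f J \<noteq> 0" "i \<in> B"
  then have "f (J - {i}) \<noteq> 0" by (auto simp: wedge_def split: if_splits)
  with f \<open>i \<in> B\<close> show "J \<subseteq> B" by blast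
qed

lemma supp_in_add: "supp_in B f \<Longrightarrow> supp_in B g \<Longrightarrow> supp_in B (f + g)" for f :: "_ \<Rightarrow> 'k::comm_ring_1"
  by (force simp: supp_in_def)

lemma supp_in_scl: "supp_in B f \<Longrightarrow> supp_in B (scl c f)"
  by (force simp: supp_in_def)

lemma supp_in_zero: "supp_in B 0"
  by (simp add: supp_in_def)

lemma supp_in_sum: "(\<And>i. i \<in> I \<Longrightarrow> supp_in B (f i)) \<Longrightarrow> supp_in B (\<Sum>i\<in>I. f i)"
  for f :: "_ \<Rightarrow> _ \<Rightarrow> 'k::comm_ring_1"
  by (induction I rule: infinite_finite_induct) (auto intro!: supp_in_add simp: supp_in_zero)

lemma supp_in_contrs: "supp_in B f \<Longrightarrow> supp_in B (contrs n p f)"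
  unfolding contrs_def by (intro supp_in_sum supp_in_scl supp_in_contr)

lemma supp_in_lop: "supp_in B f \<Longrightarrow> i \<in> B \<Longrightarrow> supp_in B (lop \<beta> i f)"
  unfolding lop_def by (intro supp_in_add supp_in_wedge supp_in_contrs)

lemma supp_in_del: "supp_in B (del J) \<longleftrightarrow> J \<subseteq> B"
  by (auto simp: supp_in_def del_def)

lemma lop_del:
  fixes \<beta> :: "nat \<Rightarrow> nat \<Rightarrow> 'k::comm_ring_1"
  assumes "\<And>k. k \<in> J \<Longrightarrow> i < k"
  shows "lop \<beta> i (del J) = del (insert i J)"
proof
  fix L
  have c: "contr k (del J) L = 0" if "k \<le> i" for k
    using that assms by (fastforce simp: contr_def del_def)
  have "(\<Sum>k<Suc i. \<beta> i k * contr k (del J) L) = 0"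
    by (rule sum.neutral) (simp add: c)
  moreover have "(wedge i (del J) L :: 'k) = del (insert i J) L"
  proof (cases "L = insert i J")
    case True
    have "i \<notin> J" using assms by blast
    moreover have "{k \<in> insert i J. k < i} = {}" using assms by force
    then have "sg i (insert i J) = (1 :: 'k)" by (simp only: sg_def card.empty power_0)
    ultimately show ?thesis using True by (simp add: wedge_def del_def)
  next
    case False
    then show ?thesis by (auto simp: wedge_def del_def)
  qed
  ultimately show "lop \<beta> i (del J) L = del (insert i J) L"
    by (simp only: lop_apply add_0_right)
qed

lemma contrs_del_empty: "contrs n p (del {} :: nat set \<Rightarrow> 'k::comm_ring_1) = 0"
proof -
  have "contr i (del {} :: nat set \<Rightarrow> 'k) J = 0" for i J
    by (cases "i \<in> J") (simp_all add: contr_def del_def)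
  then show ?thesis by (simp add: fun_eq_iff contrs_apply)
qed

lemma sum_square_split:
  "(\<Sum>i<n. \<Sum>j<n. F i j) = (\<Sum>i<n. F i i) + (\<Sum>j<n. \<Sum>i<j. F i j + F j i)"
  for F :: "nat \<Rightarrow> nat \<Rightarrow> 'a::ab_group_add"
proof (induction n)
  case (Suc n)
  have "(\<Sum>i<Suc n. \<Sum>j<Suc n. F i j) = (\<Sum>i<n. \<Sum>j<n. F i j) + (\<Sum>i<n. F i n + F n i) + F n n"
    by (simp add: sum.distrib algebra_simps)
  with Suc show ?case by (simp add: algebra_simps)
qed simp

lemma poly_mapping_sum_single: "t = (\<Sum>w\<in>Poly_Mapping.keys t. Poly_Mapping.single w (Poly_Mapping.lookup t w))"
proof (rule poly_mapping_eqI)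
  fix k
  have "Poly_Mapping.lookup (\<Sum>w\<in>Poly_Mapping.keys t. Poly_Mapping.single w (Poly_Mapping.lookup t w)) k =
      (\<Sum>w\<in>Poly_Mapping.keys t. if w = k then Poly_Mapping.lookup t w else 0)"
    by (simp add: lookup_sum lookup_single when_def)
  also have "\<dots> = Poly_Mapping.lookup t k"
    by (simp add: sum.delta' in_keys_iff)
  finally show "Poly_Mapping.lookup t k = Poly_Mapping.lookup (\<Sum>w\<in>Poly_Mapping.keys t.
      Poly_Mapping.single w (Poly_Mapping.lookup t w)) k" ..
qed

lemma poly_mapping_times_eq:
  "t * t' = (\<Sum>w\<in>Poly_Mapping.keys t. \<Sum>w'\<in>Poly_Mapping.keys t'.
     Poly_Mapping.single (w + w') (Poly_Mapping.lookup t w * Poly_Mapping.lookup t' w'))"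
proof -
  have "t * t' = (\<Sum>w\<in>Poly_Mapping.keys t. Poly_Mapping.single w (Poly_Mapping.lookup t w)) *
      (\<Sum>w\<in>Poly_Mapping.keys t'. Poly_Mapping.single w (Poly_Mapping.lookup t' w))"
    by (simp flip: poly_mapping_sum_single)
  then show ?thesis by (simp add: sum_product mult_single)
qed

lemma mono_word_append: "mono_word (us @ ws) = mono_word us * mono_word ws"
  by (simp add: mono_word_def mult_single plus_word_def)

lemma mono_word_Cons: "mono_word (u # ws) = mono_word [u] * mono_word ws"
  using mono_word_append[of "[u]" ws] by simp

lemma mono_word_Nil: "mono_word [] = 1"
  by (simp add: mono_word_def flip: zero_word_def)

lemma scalar_add: "scalar (c + d) = scalar c + scalar d"
  by (simp add: scalar_def single_add)

lemma scalar_mult: "scalar (c * d) = scalar c * scalar d"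
  by (simp add: scalar_def mult_single)

lemma scalar_zero [simp]: "scalar 0 = 0"
  by (simp add: scalar_def)

lemma scalar_one [simp]: "scalar 1 = 1"
  by (simp add: scalar_def)

lemma scalar_single: "scalar c * Poly_Mapping.single w d = Poly_Mapping.single w (c * d)"
  by (simp add: scalar_def mult_single)

lemma single_scalar: "Poly_Mapping.single w d * scalar c = Poly_Mapping.single w (d * c)"
  by (simp add: scalar_def mult_single)

lemma scalar_commute: "t * scalar c = scalar c * t"
  by (subst (1 2) poly_mapping_sum_single)
    (simp add: sum_distrib_left sum_distrib_right scalar_single single_scalar mult.commute)

lemma single_mono: "Poly_Mapping.single (Word us) c = scalar c * mono_word us"
  by (simp add: scalar_def mono_word_def mult_single)

section \<open>Clifford algebras of free modules\<close>

text \<open>\<open>K\<close> and \<open>M\<close> are carriers inside ambient types because the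
  series in n variables do not form a type. The form is given by its values \<open>q i\<close> on
  basis vectors and its polar values \<open>b i j\<close>, kept apart since 2 need not be
  invertible. The instances are the exterior algebra of V, with form 0, and the Clifford algebra of
  the Hessian.\<close>

locale clifford_setup =
  fixes K :: "'k::comm_ring_1 set" and M :: "'m::ab_group_add set" and s :: "'k \<Rightarrow> 'm \<Rightarrow> 'm"
    and Q :: "'m \<Rightarrow> 'k" and n :: nat and v :: "nat \<Rightarrow> 'm" and co :: "nat \<Rightarrow> 'm \<Rightarrow> 'k"
    and q :: "nat \<Rightarrow> 'k" and b :: "nat \<Rightarrow> nat \<Rightarrow> 'k"
  assumes K_one: "1 \<in> K" and K_diff: "\<And>c d. c \<in> K \<Longrightarrow> d \<in> K \<Longrightarrow> c - d \<in> K"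
    and K_mult: "\<And>c d. c \<in> K \<Longrightarrow> d \<in> K \<Longrightarrow> c * d \<in> K"
    and M_zero: "0 \<in> M" and M_add: "\<And>u w. u \<in> M \<Longrightarrow> w \<in> M \<Longrightarrow> u + w \<in> M"
    and M_scale: "\<And>c u. c \<in> K \<Longrightarrow> u \<in> M \<Longrightarrow> s c u \<in> M"
    and v_M: "\<And>i. i < n \<Longrightarrow> v i \<in> M"
    and co_K: "\<And>i u. i < n \<Longrightarrow> u \<in> M \<Longrightarrow> co i u \<in> K"
    and co_add: "\<And>i u w. i < n \<Longrightarrow> u \<in> M \<Longrightarrow> w \<in> M \<Longrightarrow> co i (u + w) = co i u + co i w"
    and co_scale: "\<And>i c u. i < n \<Longrightarrow> c \<in> K \<Longrightarrow> u \<in> M \<Longrightarrow> co i (s c u) = c * co i u"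
    and co_v: "\<And>i j. i < n \<Longrightarrow> j < n \<Longrightarrow> co i (v j) = (if i = j then 1 else 0)"
    and expand: "\<And>u. u \<in> M \<Longrightarrow> u = (\<Sum>i<n. s (co i u) (v i))"
    and Q_eq: "\<And>u. u \<in> M \<Longrightarrow>
      Q u = (\<Sum>i<n. (co i u)\<^sup>2 * q i) + (\<Sum>j<n. \<Sum>i<j. co i u * co j u * b i j)"
    and q_K: "\<And>i. i < n \<Longrightarrow> q i \<in> K" and b_K: "\<And>i j. i < n \<Longrightarrow> j < n \<Longrightarrow> b i j \<in> K"
    and b_sym: "\<And>i j. b i j = b j i"
begin

text \<open>Only the entries whose second index is at most the first enter \<open>lop\<close>; they
  form a triangular bilinear form with quadratic form \<open>Q\<close>, available without dividing
  by 2.\<close>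

definition \<beta> :: "nat \<Rightarrow> nat \<Rightarrow> 'k"
  where "\<beta> i j = (if i = j then q i else b i j)"

definition act :: "'m \<Rightarrow> (nat set \<Rightarrow> 'k) \<Rightarrow> nat set \<Rightarrow> 'k"
  where "act u f = (\<Sum>i<n. scl (co i u) (lop \<beta> i f))"

definition evw :: "'m word \<Rightarrow> (nat set \<Rightarrow> 'k) \<Rightarrow> nat set \<Rightarrow> 'k"
  where "evw w f = foldr act (letters w) f"

text \<open>The representation of the free algebra on coordinate vectors. The rightmost letter of a
  word acts first, so that products become compositions.\<close>

definition ev :: "('m word \<Rightarrow>\<^sub>0 'k) \<Rightarrow> (nat set \<Rightarrow> 'k) \<Rightarrow> nat set \<Rightarrow> 'k"
  where "ev t f = (\<Sum>w\<in>Poly_Mapping.keys t. scl (Poly_Mapping.lookup t w) (evw w f))"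

abbreviation F :: "('m word \<Rightarrow>\<^sub>0 'k) ring" where "F \<equiv> free_algebra K M"
abbreviation I :: "('m word \<Rightarrow>\<^sub>0 'k) set" where "I \<equiv> clifford_ideal K M s Q"
abbreviation C :: "('m word \<Rightarrow>\<^sub>0 'k) set ring" where "C \<equiv> clifford K M s Q"
abbreviation cls :: "('m word \<Rightarrow>\<^sub>0 'k) \<Rightarrow> ('m word \<Rightarrow>\<^sub>0 'k) set" where "cls \<equiv> clifford_class K M s Q"

lemma K_zero: "0 \<in> K"
  using K_diff[OF K_one K_one] by simp

lemma K_uminus: "c \<in> K \<Longrightarrow> - c \<in> K"
  using K_diff[OF K_zero] by fastforce

lemma K_add: "c \<in> K \<Longrightarrow> d \<in> K \<Longrightarrow> c + d \<in> K"
  using K_diff[OF _ K_uminus, of c d] by simp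

lemma K_sum: "(\<And>i. i \<in> J \<Longrightarrow> f i \<in> K) \<Longrightarrow> (\<Sum>i\<in>J. f i) \<in> K"
  by (induction J rule: infinite_finite_induct) (auto intro: K_zero K_add)

lemma K_sg: "sg i J \<in> K"
proof -
  have "(- 1) ^ m \<in> K" for m
    by (induction m) (auto intro: K_one K_uminus)
  then show ?thesis by (simp add: sg_def)
qed

lemma M_sum: "(\<And>i. i \<in> J \<Longrightarrow> f i \<in> M) \<Longrightarrow> (\<Sum>i\<in>J. f i) \<in> M"
  by (induction J rule: infinite_finite_induct) (auto intro: M_zero M_add)

lemma \<beta>_K: "i < n \<Longrightarrow> j < n \<Longrightarrow> \<beta> i j \<in> K"
  by (simp add: \<beta>_def q_K b_K)

lemma linop_act: "linop (act u)"
  unfolding act_def by (intro linop_sum_ops linop_scl_op linop_lop)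

lemma evw_Nil [simp]: "evw (Word []) f = f"
  by (simp add: evw_def)

lemma evw_Cons [simp]: "evw (Word (u # us)) f = act u (evw (Word us) f)"
  by (simp add: evw_def)

lemma evw_zero [simp]: "evw 0 f = f"
  by (simp add: zero_word_def)

lemma evw_plus: "evw (w + w') f = evw w (evw w' f)"
  by (simp add: evw_def plus_word_def)

lemma linop_evw: "linop (evw w)"
proof (induction w)
  case (Word us)
  then show ?case
    by (induction us) (auto simp: linop_def linop_add[OF linop_act] linop_scl[OF linop_act])
qed

lemma linop_ev: "linop (ev t)"
  unfolding ev_def by (intro linop_sum_ops linop_scl_op linop_evw)

lemma ev_superset:
  assumes "finite S" "Poly_Mapping.keys t \<subseteq> S"
  shows "ev t f = (\<Sum>w\<in>S. scl (Poly_Mapping.lookup t w) (evw w f))"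
  unfolding ev_def
  by (rule sum.mono_neutral_left) (use assms in \<open>auto simp: in_keys_iff scl_simps\<close>)

lemma ev_add: "ev (t + t') f = ev t f + ev t' f"
proof -
  let ?S = "Poly_Mapping.keys t \<union> Poly_Mapping.keys t'"
  have "Poly_Mapping.keys (t + t') \<subseteq> ?S" by (rule keys_add)
  then show ?thesis
    using ev_superset[of ?S t] ev_superset[of ?S t'] ev_superset[of ?S "t + t'"]
    by (simp add: lookup_add scl_simps sum.distrib)
qed

lemma ev_zero [simp]: "ev 0 f = 0"
  by (simp add: ev_def)

lemma ev_uminus: "ev (- t) f = - ev t f"
  using ev_add[of t "- t" f] by (simp add: minus_unique)

lemma ev_diff: "ev (t - t') f = ev t f - ev t' f"
  using ev_add[of t "- t'" f] by (simp add: ev_uminus)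

lemma ev_sum: "ev (\<Sum>i\<in>J. t i) f = (\<Sum>i\<in>J. ev (t i) f)"
  by (induction J rule: infinite_finite_induct) (auto simp: ev_add)

lemma ev_single: "ev (Poly_Mapping.single w c) f = scl c (evw w f)"
  by (simp add: ev_def scl_simps)

lemma ev_scalar [simp]: "ev (scalar c) f = scl c f"
  by (simp add: scalar_def ev_single)

lemma ev_one [simp]: "ev 1 f = f"
  using ev_scalar[of 1 f] by (simp add: scl_simps)

lemma ev_mono_word [simp]: "ev (mono_word us) f = evw (Word us) f"
  by (simp add: mono_word_def ev_single scl_simps)

lemma ev_mult: "ev (t * t') f = ev t (ev t' f)"
  unfolding poly_mapping_times_eq[of t t'] ev_sum ev_single evw_plus ev_def[of t] ev_def[of t']
  by (simp add: linop_sum[OF linop_evw] linop_scl[OF linop_evw] scl_sum scl_simps)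

lemma carrier_F: "t \<in> carrier F \<longleftrightarrow>
    (\<forall>w. Poly_Mapping.lookup t w \<in> K) \<and> (\<forall>w \<in> Poly_Mapping.keys t. set (letters w) \<subseteq> M)"
  by (simp add: free_algebra_def)

lemma F_simps [simp]: "mult F = (*)" "one F = 1" "zero F = 0" "add F = (+)"
  by (simp_all add: free_algebra_def)

lemma F_single: "c \<in> K \<Longrightarrow> set (letters w) \<subseteq> M \<Longrightarrow> Poly_Mapping.single w c \<in> carrier F"
  by (auto simp: carrier_F lookup_single when_def K_zero)

lemma F_scalar: "c \<in> K \<Longrightarrow> scalar c \<in> carrier F"
  by (simp add: scalar_def F_single zero_word_def)

lemma F_mono_word: "set us \<subseteq> M \<Longrightarrow> mono_word us \<in> carrier F"
  by (simp add: mono_word_def F_single K_one)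

lemma F_add: "t \<in> carrier F \<Longrightarrow> t' \<in> carrier F \<Longrightarrow> t + t' \<in> carrier F"
  using keys_add[of t t', THEN subsetD] unfolding carrier_F by (fastforce simp: lookup_add K_add)

lemma F_zero: "0 \<in> carrier F"
  by (simp add: carrier_F K_zero)

lemma F_uminus: "t \<in> carrier F \<Longrightarrow> - t \<in> carrier F"
  by (auto simp: carrier_F K_uminus in_keys_iff)

lemma F_diff: "t \<in> carrier F \<Longrightarrow> t' \<in> carrier F \<Longrightarrow> t - t' \<in> carrier F"
  using F_add[OF _ F_uminus, of t t'] by simp

lemma F_sum: "(\<And>i. i \<in> J \<Longrightarrow> t i \<in> carrier F) \<Longrightarrow> (\<Sum>i\<in>J. t i) \<in> carrier F"
  by (induction J rule: infinite_finite_induct) (auto intro: F_zero F_add)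

lemma F_mult:
  assumes "t \<in> carrier F" "t' \<in> carrier F"
  shows "t * t' \<in> carrier F"
proof -
  have "Poly_Mapping.single (w + w') (Poly_Mapping.lookup t w * Poly_Mapping.lookup t' w') \<in> carrier F"
    if "w \<in> Poly_Mapping.keys t" "w' \<in> Poly_Mapping.keys t'" for w w'
    by (rule F_single) (use assms that in \<open>auto simp: carrier_F plus_word_def K_mult subsetD\<close>)
  then show ?thesis
    unfolding poly_mapping_times_eq[of t t'] by (intro F_sum)
qed

sublocale F: ring F
proof (rule ringI)
  show "abelian_group F"
  proof (rule abelian_groupI)
    fix x assume "x \<in> carrier F"
    then show "\<exists>y\<in>carrier F. y \<oplus>\<^bsub>F\<^esub> x = \<zero>\<^bsub>F\<^esub>"
      by (intro bexI[of _ "- x"]) (auto simp: F_uminus)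
  qed (auto simp: F_add F_zero algebra_simps)
  show "Group.monoid F"
    by (rule monoidI) (use F_scalar[OF K_one] in \<open>auto simp: F_mult mult.assoc\<close>)
qed (auto simp: algebra_simps)

lemma Q_K: "u \<in> M \<Longrightarrow> Q u \<in> K"
  unfolding Q_eq power2_eq_square by (intro K_add K_sum K_mult co_K q_K b_K) simp_all

lemma relations_carrier: "clifford_relations K M s Q \<subseteq> carrier F"
proof -
  have "mono_word [u + w] - mono_word [u] - mono_word [w] \<in> carrier F" if "u \<in> M" "w \<in> M" for u w
    using that by (intro F_diff F_mono_word) (simp_all add: M_add)
  moreover have "mono_word [s c u] - scalar c * mono_word [u] \<in> carrier F" if "c \<in> K" "u \<in> M" for c u
    using that by (intro F_diff F_mono_word F_mult F_scalar) (simp_all add: M_scale)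
  moreover have "mono_word [u] * mono_word [u] - scalar (Q u) \<in> carrier F" if "u \<in> M" for u
    using that by (intro F_diff F_mono_word F_mult F_scalar) (simp_all add: Q_K)
  ultimately show ?thesis
    unfolding clifford_relations_def by blast
qed

lemma ideal_I: "ideal I F"
  unfolding clifford_ideal_def by (rule F.genideal_ideal[OF relations_carrier])

lemma I_carrier: "t \<in> I \<Longrightarrow> t \<in> carrier F"
  using ideal.Icarr[OF ideal_I] by simp

lemma I_add: "t \<in> I \<Longrightarrow> t' \<in> I \<Longrightarrow> t + t' \<in> I"
  using additive_subgroup.a_closed[OF ideal.axioms(1)[OF ideal_I]] by simp

lemma I_zero: "0 \<in> I"
  using additive_subgroup.zero_closed[OF ideal.axioms(1)[OF ideal_I]] by simp

lemma I_left: "t \<in> I \<Longrightarrow> c \<in> carrier F \<Longrightarrow> c * t \<in> I"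
  using ideal.I_l_closed[OF ideal_I] by simp

lemma I_right: "t \<in> I \<Longrightarrow> c \<in> carrier F \<Longrightarrow> t * c \<in> I"
  using ideal.I_r_closed[OF ideal_I] by simp

lemma I_uminus: "t \<in> I \<Longrightarrow> - t \<in> I"
  using I_left[OF _ F_uminus[OF F_scalar[OF K_one]]] by simp

lemma I_diff: "t \<in> I \<Longrightarrow> t' \<in> I \<Longrightarrow> t - t' \<in> I"
  using I_add[OF _ I_uminus] by fastforce

lemma I_sum: "(\<And>i. i \<in> J \<Longrightarrow> t i \<in> I) \<Longrightarrow> (\<Sum>i\<in>J. t i) \<in> I"
  by (induction J rule: infinite_finite_induct) (auto intro: I_zero I_add)

lemma I_relation: "t \<in> clifford_relations K M s Q \<Longrightarrow> t \<in> I"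
  unfolding clifford_ideal_def using F.genideal_self[OF relations_carrier] by blast

lemma rel_add: "u \<in> M \<Longrightarrow> w \<in> M \<Longrightarrow> mono_word [u + w] - mono_word [u] - mono_word [w] \<in> I"
  by (rule I_relation) (auto simp: clifford_relations_def)

lemma rel_scale: "c \<in> K \<Longrightarrow> u \<in> M \<Longrightarrow> mono_word [s c u] - scalar c * mono_word [u] \<in> I"
  by (rule I_relation) (auto simp: clifford_relations_def)

lemma rel_square: "u \<in> M \<Longrightarrow> mono_word [u] * mono_word [u] - scalar (Q u) \<in> I"
  by (rule I_relation) (auto simp: clifford_relations_def)

lemma act_add: "u \<in> M \<Longrightarrow> w \<in> M \<Longrightarrow> act (u + w) f = act u f + act w f"
  by (simp add: act_def co_add scl_simps sum.distrib)

lemma act_scale: "c \<in> K \<Longrightarrow> u \<in> M \<Longrightarrow> act (s c u) f = scl c (act u f)"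
  by (simp add: act_def co_scale scl_simps scl_sum)

lemma act_v: "i < n \<Longrightarrow> act (v i) f = lop \<beta> i f"
proof -
  assume i: "i < n"
  have "act (v i) f = (\<Sum>j<n. if j = i then lop \<beta> i f else 0)"
    unfolding act_def by (rule sum.cong) (use i in \<open>auto simp: co_v scl_simps\<close>)
  with i show ?thesis by simp
qed

text \<open>The cross terms of the double sum are paired: by \<open>lop_lop\<close> the two orders
  of a pair add up to the polar value \<open>b i j\<close>. This is the Clifford relation for an
  arbitrary vector.\<close>

lemma act_act:
  assumes "u \<in> M"
  shows "act u (act u f) = scl (Q u) f"
proof -
  let ?L = "lop \<beta>"
  have "act u (act u f) = (\<Sum>i<n. \<Sum>j<n. scl (co i u * co j u) (?L i (?L j f)))"
    unfolding act_def by (simp add: linop_sum[OF linop_lop] linop_scl[OF linop_lop] scl_simps scl_sum)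
  also have "\<dots> = (\<Sum>i<n. scl (co i u * co i u) (?L i (?L i f))) +
      (\<Sum>j<n. \<Sum>i<j. scl (co i u * co j u) (?L i (?L j f)) + scl (co j u * co i u) (?L j (?L i f)))"
    by (rule sum_square_split)
  also have "\<dots> = (\<Sum>i<n. scl ((co i u)\<^sup>2 * q i) f) + (\<Sum>j<n. \<Sum>i<j. scl (co i u * co j u * b i j) f)"
  proof -
    have "scl (co i u * co i u) (?L i (?L i f)) = scl ((co i u)\<^sup>2 * q i) f" for i
      by (simp add: lop_lop_same \<beta>_def scl_simps power2_eq_square)
    moreover have "scl (co i u * co j u) (?L i (?L j f)) + scl (co j u * co i u) (?L j (?L i f)) =
        scl (co i u * co j u * b i j) f" if "i < j" for i j
      using that by (simp add: lop_lop[of i j] \<beta>_def scl_simps mult.commute[of "co j u"] b_sym[of j])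
    ultimately show ?thesis by simp
  qed
  also have "\<dots> = scl (Q u) f"
    using assms by (simp add: Q_eq fun_eq_iff sum_fun_apply sum_distrib_right distrib_right)
  finally show ?thesis .
qed

text \<open>The elements acting by zero form a two-sided ideal that contains the relations.\<close>

lemma ev_I: "t \<in> I \<Longrightarrow> ev t f = 0"
proof -
  \<comment> \<open>Vanishing is required on every vector, not only on \<open>del {}\<close>:
    closure under right multiplication uses \<open>ev (t * c) f = ev t (ev c f)\<close>.\<close>
  let ?N = "{t \<in> carrier F. \<forall>f. ev t f = 0}"
  have "ideal ?N F"
  proof (rule idealI)
    show "ring F" by (rule F.ring_axioms)
    show "subgroup ?N (add_monoid F)"
    proof (rule F.add.group_incl_imp_subgroup)
      show "group (add_monoid F\<lparr>carrier := ?N\<rparr>)"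
      proof (rule groupI)
        fix x assume "x \<in> carrier (add_monoid F\<lparr>carrier := ?N\<rparr>)"
        then show "\<exists>y\<in>carrier (add_monoid F\<lparr>carrier := ?N\<rparr>).
            y \<otimes>\<^bsub>add_monoid F\<lparr>carrier := ?N\<rparr>\<^esub> x = \<one>\<^bsub>add_monoid F\<lparr>carrier := ?N\<rparr>\<^esub>"
          by (intro bexI[of _ "- x"]) (auto simp: F_uminus ev_uminus)
      qed (auto simp: F_add F_zero ev_add algebra_simps)
    qed auto
  qed (auto simp: F_mult ev_mult linop_zero[OF linop_ev])
  moreover have "clifford_relations K M s Q \<subseteq> ?N"
  proof -
    have "ev t f = 0" if "t \<in> clifford_relations K M s Q" for t f
      using that unfolding clifford_relations_def
      by (auto simp: ev_diff ev_mult act_add act_scale act_act)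
    then show ?thesis using relations_carrier by blast
  qed
  ultimately have "I \<subseteq> ?N" unfolding clifford_ideal_def by (rule F.genideal_minimal)
  then show "t \<in> I \<Longrightarrow> ev t f = 0" by auto
qed

end

lemma sorted_list_of_set_insert_min:
  assumes "finite J" "\<And>k. k \<in> J \<Longrightarrow> j < k"
  shows "sorted_list_of_set (insert j J) = j # sorted_list_of_set J"
proof -
  have "j \<notin> J" using assms(2) by blast
  then have "sorted_list_of_set (insert j J) = insort j (sorted_list_of_set J)"
    using assms(1) by simp
  also have "\<dots> = j # sorted_list_of_set J"
    by (rule insort_is_Cons) (use assms in \<open>auto simp: less_imp_le\<close>)
  finally show ?thesis .
qed

lemma supp_in_expand:
  assumes "supp_in B f" "finite B"
  shows "f = (\<Sum>J\<in>Pow B. scl (f J) (del J))"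
proof
  fix L
  have "(\<Sum>J\<in>Pow B. scl (f J) (del J)) L = (\<Sum>J\<in>Pow B. if J = L then f L else 0)"
    unfolding sum_fun_apply by (rule sum.cong) (auto simp: del_def)
  also have "\<dots> = f L"
    using assms by (auto simp: supp_in_def)
  finally show "f L = (\<Sum>J\<in>Pow B. scl (f J) (del J)) L" ..
qed

section \<open>Parity of coordinate vectors\<close>

definition par :: "int \<Rightarrow> (nat set \<Rightarrow> 'k::zero) \<Rightarrow> bool"
  where "par p f \<longleftrightarrow> (\<forall>J. f J \<noteq> 0 \<longrightarrow> even (int (card J) - p))"

lemma par_zero: "par p 0"
  by (simp add: par_def)

lemma par_add: "par p f \<Longrightarrow> par p g \<Longrightarrow> par p (f + g)" for f :: "_ \<Rightarrow> 'k::comm_ring_1"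
  unfolding par_def plus_fun_apply by (metis add.right_neutral)

lemma par_scl: "par p f \<Longrightarrow> par p (scl c f)"
  unfolding par_def scl_apply by (metis mult_zero_right)

lemma par_sum: "(\<And>i. i \<in> I \<Longrightarrow> par p (f i)) \<Longrightarrow> par p (\<Sum>i\<in>I. f i)"
  for f :: "_ \<Rightarrow> _ \<Rightarrow> 'k::comm_ring_1"
  by (induction I rule: infinite_finite_induct) (auto intro: par_add par_zero)

lemma parity_step: "a = b + 1 \<Longrightarrow> even (int a - p) \<Longrightarrow> even (int b - (p + 1))"
  and parity_step': "a = b + 1 \<Longrightarrow> even (int b - p) \<Longrightarrow> even (int a - (p + 1))"
  by auto

text \<open>The support condition keeps the sets finite, so that adding an index really changes
  \<open>card\<close> by one.\<close>

lemma par_contr: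
  assumes "par p f" "supp_in {..<n} f"
  shows "par (p + 1) (contr i f)"
  unfolding par_def
proof (intro allI impI)
  fix J assume "contr i f J \<noteq> 0"
  then have "i \<notin> J" and f: "f (insert i J) \<noteq> 0" by (auto simp: contr_def split: if_splits)
  then have "insert i J \<subseteq> {..<n}" using assms(2) by (simp add: supp_in_def del: insert_subset)
  then have "finite J" by (metis finite_insert finite_lessThan finite_subset)
  with \<open>i \<notin> J\<close> have "card (insert i J) = card J + 1" by simp
  moreover have "even (int (card (insert i J)) - p)" using assms(1) f by (simp add: par_def)
  ultimately show "even (int (card J) - (p + 1))"
    by (rule parity_step)
qed

lemma par_wedge:
  assumes "par p f" "supp_in {..<n} f"
  shows "par (p + 1) (wedge i f)"
  unfolding par_def
proof (intro allI impI)
  fix J assume "wedge i f J \<noteq> 0"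
  then have "i \<in> J" and f: "f (J - {i}) \<noteq> 0" by (auto simp: wedge_def split: if_splits)
  then have "J - {i} \<subseteq> {..<n}" using assms(2) by (simp add: supp_in_def)
  then have "finite (J - {i})" by (rule finite_subset) simp
  with \<open>i \<in> J\<close> have "card J = card (J - {i}) + 1"
    by (simp add: card_Suc_Diff1 del: card_Diff_insert)
  moreover have "even (int (card (J - {i})) - p)" using assms(1) f by (simp add: par_def)
  ultimately show "even (int (card J) - (p + 1))"
    by (rule parity_step')
qed

lemma par_contrs: "par p f \<Longrightarrow> supp_in {..<n} f \<Longrightarrow> par (p + 1) (contrs m r f)"
  unfolding contrs_def by (intro par_sum par_scl par_contr)

lemma par_lop: "par p f \<Longrightarrow> supp_in {..<n} f \<Longrightarrow> par (p + 1) (lop \<beta> i f)"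
  unfolding lop_def by (intro par_add par_wedge par_contrs)

lemma par_even: "even (p - p') \<Longrightarrow> par p f \<longleftrightarrow> par p' f"
proof -
  assume "even (p - p')"
  then have "even (int m - p) = even (int m - p')" for m by (auto simp: even_diff_iff)
  then show ?thesis by (simp add: par_def)
qed

lemma signed_simps:
  "signed p (a + b) = signed p a + signed p b" "signed p (- a) = - signed p a" "signed p 0 = 0"
  by (auto simp: signed_def)

lemma signed_sum: "signed p (\<Sum>i\<in>I. f i) = (\<Sum>i\<in>I. signed p (f i))"
  by (auto simp: signed_def sum_negf)

lemma scalar_left_commute: "t * (scalar c * t') = scalar c * (t * t')"
  by (simp only: mult.assoc[symmetric] scalar_commute[of t c])

lemma keys_sum_subset:
  "Poly_Mapping.keys (\<Sum>i\<in>I. t i) \<subseteq> (\<Union>i\<in>I. Poly_Mapping.keys (t i))"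
proof (induction I rule: infinite_finite_induct)
  case (insert i I)
  then show ?case using keys_add[of "t i" "\<Sum>i\<in>I. t i"] by auto
qed auto

section \<open>The ordered products form a basis of the Clifford algebra\<close>

context clifford_setup
begin

definition vw :: "nat set \<Rightarrow> ('m word \<Rightarrow>\<^sub>0 'k)"
  where "vw J = mono_word (map v (sorted_list_of_set J))"

text \<open>A section of the evaluation at \<open>del {}\<close>, see \<open>ev_canon\<close>: the
  representative in the free algebra with prescribed coordinates.\<close>

definition canon :: "(nat set \<Rightarrow> 'k) \<Rightarrow> ('m word \<Rightarrow>\<^sub>0 'k)"
  where "canon f = (\<Sum>J\<in>Pow {..<n}. scalar (f J) * vw J)"

text \<open>The free \<open>K\<close>-module with one coordinate for each subset of
  \<open>{..<n}\<close>. The other values are fixed to 0, so that equality of functions is equality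
  of coordinates.\<close>

definition Mdl :: "(nat set \<Rightarrow> 'k) set"
  where "Mdl = {f. (\<forall>J. f J \<in> K) \<and> supp_in {..<n} f}"

lemma canon_add: "canon (f + g) = canon f + canon g"
  by (simp add: canon_def scalar_add distrib_right sum.distrib)

lemma canon_scl: "canon (scl c f) = scalar c * canon f"
  by (simp add: canon_def scalar_mult sum_distrib_left mult.assoc)

lemma canon_zero: "canon 0 = 0"
  by (simp add: canon_def)

lemma canon_uminus: "canon (- f) = - canon f"
  using canon_add[of f "- f"] by (simp add: canon_zero minus_unique)

lemma canon_diff: "canon (f - g) = canon f - canon g"
  using canon_add[of f "- g"] by (simp add: canon_uminus)

lemma canon_sum: "canon (\<Sum>i\<in>J. f i) = (\<Sum>i\<in>J. canon (f i))"
  using sum_comp_morphism[of canon f J] by (simp add: canon_zero canon_add o_def)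

lemma canon_del:
  assumes "J \<subseteq> {..<n}"
  shows "canon (del J) = vw J"
proof -
  have "canon (del J) = (\<Sum>L\<in>Pow {..<n}. if L = J then vw J else 0)"
    unfolding canon_def by (rule sum.cong) (auto simp: del_def)
  with assms show ?thesis by simp
qed

lemma vw_empty: "vw {} = 1"
  by (simp add: vw_def mono_word_Nil)

lemma vw_insert:
  assumes "J \<subseteq> {..<n}" "\<And>k. k \<in> J \<Longrightarrow> j < k"
  shows "vw (insert j J) = mono_word [v j] * vw J"
proof -
  have "finite J" using assms(1) by (rule finite_subset) simp
  then have *: "sorted_list_of_set (insert j J) = j # sorted_list_of_set J"
    using assms(2) by (rule sorted_list_of_set_insert_min)
  show ?thesis unfolding vw_def * list.map by (rule mono_word_Cons)
qed

lemma F_vw: "J \<subseteq> {..<n} \<Longrightarrow> vw J \<in> carrier F"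
  unfolding vw_def by (rule F_mono_word) (auto simp: finite_subset intro!: v_M)

lemma F_v: "i < n \<Longrightarrow> mono_word [v i] \<in> carrier F"
  by (rule F_mono_word) (simp add: v_M)

lemma F_canon: "f \<in> Mdl \<Longrightarrow> canon f \<in> carrier F"
  unfolding canon_def by (intro F_sum F_mult F_scalar F_vw) (auto simp: Mdl_def)

lemma Mdl_add: "f \<in> Mdl \<Longrightarrow> g \<in> Mdl \<Longrightarrow> f + g \<in> Mdl"
  by (auto simp: Mdl_def K_add supp_in_add)

lemma Mdl_zero: "0 \<in> Mdl"
  by (auto simp: Mdl_def K_zero supp_in_zero)

lemma Mdl_scl: "c \<in> K \<Longrightarrow> f \<in> Mdl \<Longrightarrow> scl c f \<in> Mdl"
  by (auto simp: Mdl_def K_mult supp_in_scl)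

lemma Mdl_sum: "(\<And>i. i \<in> J \<Longrightarrow> f i \<in> Mdl) \<Longrightarrow> (\<Sum>i\<in>J. f i) \<in> Mdl"
  by (induction J rule: infinite_finite_induct) (auto intro: Mdl_add Mdl_zero)

lemma Mdl_uminus: "f \<in> Mdl \<Longrightarrow> - f \<in> Mdl"
  by (auto simp: Mdl_def K_uminus supp_in_def)

lemma Mdl_diff: "f \<in> Mdl \<Longrightarrow> g \<in> Mdl \<Longrightarrow> f - g \<in> Mdl"
  using Mdl_add[OF _ Mdl_uminus, of f g] by simp

lemma Mdl_del: "J \<subseteq> {..<n} \<Longrightarrow> del J \<in> Mdl"
  by (simp add: Mdl_def supp_in_del) (simp add: del_def K_zero K_one)

lemma Mdl_contr: "f \<in> Mdl \<Longrightarrow> contr i f \<in> Mdl"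
  by (auto simp: Mdl_def supp_in_contr) (simp add: contr_def K_zero K_mult K_sg)

lemma Mdl_wedge: "f \<in> Mdl \<Longrightarrow> i < n \<Longrightarrow> wedge i f \<in> Mdl"
  by (auto simp: Mdl_def supp_in_wedge) (simp add: wedge_def K_zero K_mult K_sg)

lemma Mdl_contrs: "f \<in> Mdl \<Longrightarrow> (\<And>i. i < m \<Longrightarrow> r i \<in> K) \<Longrightarrow> contrs m r f \<in> Mdl"
  unfolding contrs_def by (intro Mdl_sum Mdl_scl Mdl_contr) auto

lemma Mdl_lop: "f \<in> Mdl \<Longrightarrow> i < n \<Longrightarrow> lop \<beta> i f \<in> Mdl"
  unfolding lop_def by (intro Mdl_add Mdl_wedge Mdl_contrs \<beta>_K) auto

lemma Mdl_act: "f \<in> Mdl \<Longrightarrow> u \<in> M \<Longrightarrow> act u f \<in> Mdl"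
  unfolding act_def by (intro Mdl_sum Mdl_scl Mdl_lop co_K) auto

lemma Mdl_evw: "f \<in> Mdl \<Longrightarrow> set us \<subseteq> M \<Longrightarrow> evw (Word us) f \<in> Mdl"
  by (induction us) (auto intro: Mdl_act)

lemma Mdl_ev: "f \<in> Mdl \<Longrightarrow> t \<in> carrier F \<Longrightarrow> ev t f \<in> Mdl"
  unfolding ev_def
proof (intro Mdl_sum Mdl_scl)
  fix w assume "f \<in> Mdl" "t \<in> carrier F" "w \<in> Poly_Mapping.keys t"
  then have "set (letters w) \<subseteq> M" by (simp add: carrier_F)
  with \<open>f \<in> Mdl\<close> show "evw w f \<in> Mdl" by (cases w) (simp add: Mdl_evw)
qed (auto simp: carrier_F)

text \<open>Stripping the smallest index j leaves a set above j, where \<open>lop \<beta> j\<close>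
  acts without correction terms.\<close>

lemma ev_vw: "J \<subseteq> {..<n} \<Longrightarrow> ev (vw J) (del {}) = del J"
proof -
  assume J: "J \<subseteq> {..<n}"
  then have "finite J" by (rule finite_subset) simp
  from this J show ?thesis
  proof (induction J rule: finite_linorder_min_induct)
    case empty
    then show ?case by (simp add: vw_empty)
  next
    case (insert j J)
    then have "vw (insert j J) = mono_word [v j] * vw J" by (intro vw_insert) auto
    with insert show ?case by (simp add: ev_mult act_v lop_del)
  qed
qed

text \<open>Together with \<open>ev_I\<close> this is the linear independence of the ordered
  products: coordinates can be recovered from any representative of a class.\<close>

lemma ev_canon: "f \<in> Mdl \<Longrightarrow> ev (canon f) (del {}) = f"
proof -
  assume f: "f \<in> Mdl"
  have "ev (canon f) (del {}) = (\<Sum>J\<in>Pow {..<n}. scl (f J) (del J))"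
    unfolding canon_def ev_sum ev_mult ev_scalar by (rule sum.cong) (auto simp: ev_vw)
  also have "\<dots> = f" using f by (intro supp_in_expand[symmetric]) (auto simp: Mdl_def)
  finally show ?thesis .
qed

text \<open>The value is read off from \<open>act_act\<close> at the coefficient of the empty set,
  which avoids evaluating the sums in \<open>Q_eq\<close>.\<close>

lemma Q_v: "i < n \<Longrightarrow> Q (v i) = q i"
proof -
  assume i: "i < n"
  have "scl (Q (v i)) (del {}) = scl (q i) (del {})"
    using act_act[OF v_M[OF i], of "del {}"] i by (simp add: act_v lop_lop_same \<beta>_def)
  then have "scl (Q (v i)) (del {}) {} = scl (q i) (del {}) {}" by (rule fun_cong)
  then show ?thesis by (simp add: del_def)
qed

lemma Q_v_add:
  assumes "i < n" "j < i"
  shows "Q (v i + v j) = q i + q j + b i j"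
proof -
  have j: "j < n" using assms by simp
  have "scl (Q (v i + v j)) (del {}) = scl (q i + q j + b i j) (del {})"
    using act_act[OF M_add[OF v_M[OF assms(1)] v_M[OF j]], of "del {}"] assms j
    by (simp add: act_add v_M act_v linop_add[OF linop_lop] lop_lop_same lop_lop[of j i] \<beta>_def scl_simps add_ac)
  then have "scl (Q (v i + v j)) (del {}) {} = scl (q i + q j + b i j) (del {}) {}" by (rule fun_cong)
  then show ?thesis by (simp add: del_def)
qed

lemma rel_square_v: "i < n \<Longrightarrow> mono_word [v i] * mono_word [v i] - scalar (q i) \<in> I"
  using rel_square[OF v_M] by (simp add: Q_v)

text \<open>Polarisation of the square relation at v_i + v_j.\<close>

lemma rel_anticommute:
  assumes "i < n" "j < i"
  shows "mono_word [v i] * mono_word [v j] + mono_word [v j] * mono_word [v i] - scalar (b i j) \<in> I"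
proof -
  have j: "j < n" using assms by simp
  let ?x = "mono_word [v i]" and ?y = "mono_word [v j]" and ?z = "mono_word [v i + v j]"
  have F: "?x \<in> carrier F" "?y \<in> carrier F" "?z \<in> carrier F"
    using assms j by (auto intro!: F_mono_word M_add v_M)
  have d: "?z - ?x - ?y \<in> I" by (rule rel_add) (use assms j in \<open>auto intro: v_M\<close>)
  have z: "?z * ?z - scalar (q i + q j + b i j) \<in> I"
    using rel_square[OF M_add[OF v_M[OF assms(1)] v_M[OF j]]] assms by (simp add: Q_v_add)
  \<comment> \<open>The additivity relation, used once from each side, replaces the square of
    \<open>?z\<close> by that of \<open>?x + ?y\<close>; then the two single squares are taken
    off.\<close>
  have "?z * ?z - scalar (q i + q j + b i j) - (?z - ?x - ?y) * ?z - (?x + ?y) * (?z - ?x - ?y)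
      - (?x * ?x - scalar (q i)) - (?y * ?y - scalar (q j)) \<in> I"
    by (rule I_diff[OF I_diff[OF I_diff[OF I_diff[OF z]]]])
      (intro I_left I_right rel_square_v d F F_add assms j)+
  moreover have "?z * ?z - scalar (q i + q j + b i j) - (?z - ?x - ?y) * ?z - (?x + ?y) * (?z - ?x - ?y)
      - (?x * ?x - scalar (q i)) - (?y * ?y - scalar (q j)) = ?x * ?y + ?y * ?x - scalar (b i j)"
    by (simp add: scalar_add algebra_simps)
  ultimately show ?thesis by simp
qed

text \<open>All indices in the support exceed j, so v_j is simply prepended to ordered products.
  This is an equality in the free algebra itself, not only modulo the ideal.\<close>

lemma mono_mult_canon:
  assumes "supp_in {j<..<n} g" "j < n"
  shows "mono_word [v j] * canon g = canon (lop \<beta> j g)"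
proof -
  have B: "L \<subseteq> {..<n}" "\<And>k. k \<in> L \<Longrightarrow> j < k" if "L \<in> Pow {j<..<n}" for L using that by auto
  have g: "g = (\<Sum>L\<in>Pow {j<..<n}. scl (g L) (del L))"
    by (rule supp_in_expand) (use assms in auto)
  have "mono_word [v j] * canon g =
      (\<Sum>L\<in>Pow {j<..<n}. mono_word [v j] * (scalar (g L) * canon (del L)))"
    by (subst g) (simp only: canon_sum canon_scl sum_distrib_left)
  also have "\<dots> = (\<Sum>L\<in>Pow {j<..<n}. scalar (g L) * canon (lop \<beta> j (del L)))"
  proof (rule sum.cong[OF refl])
    fix L assume L: "L \<in> Pow {j<..<n}"
    then have "insert j L \<subseteq> {..<n}" using \<open>j < n\<close> by auto
    then have "canon (lop \<beta> j (del L)) = mono_word [v j] * canon (del L)"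
      using B[OF L] by (simp add: lop_del canon_del vw_insert)
    moreover have "mono_word [v j] * (scalar (g L) * canon (del L)) =
        scalar (g L) * (mono_word [v j] * canon (del L))"
      by (rule scalar_left_commute)
    ultimately show "mono_word [v j] * (scalar (g L) * canon (del L)) =
        scalar (g L) * canon (lop \<beta> j (del L))" by simp
  qed
  also have "\<dots> = canon (lop \<beta> j g)"
    by (subst (2) g) (simp only: linop_sum[OF linop_lop] linop_scl[OF linop_lop] canon_sum canon_scl)
  finally show ?thesis .
qed

text \<open>The core of the spanning half of the basis theorem. The induction strips the smallest
  index j of the set, and v_i is put in front of v_j, squared with it, or moved past it.\<close>

lemma mono_vw:
  assumes "J \<subseteq> {..<n}" "i < n"
  shows "mono_word [v i] * vw J - canon (lop \<beta> i (del J)) \<in> I"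
proof -
  have "finite J" using assms(1) by (rule finite_subset) simp
  from this assms(1) show ?thesis
  proof (induction J rule: finite_linorder_min_induct)
    case empty
    have "lop \<beta> i (del {}) = del {i}" using lop_del[of "{}" i] by simp
    moreover have "vw {i} = mono_word [v i] * vw {}" using vw_insert[of "{}" i] by simp
    ultimately show ?case using assms(2) by (simp add: canon_del I_zero)
  next
    case (insert j J)
    then have j: "j < n" and J: "J \<subseteq> {..<n}" and min: "\<And>k. k \<in> J \<Longrightarrow> j < k" by auto
    have vJ: "vw (insert j J) = mono_word [v j] * vw J" by (rule vw_insert[OF J min])
    have dJ: "del (insert j J) = lop \<beta> j (del J)" using lop_del[of J j \<beta>, OF min] by simp
    consider "i < j" | "i = j" | "j < i" by linarith
    then show ?case
    proof cases
      case 1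
      then have min': "k \<in> insert j J \<Longrightarrow> i < k" for k using min by fastforce
      have "vw (insert i (insert j J)) = mono_word [v i] * vw (insert j J)"
        by (rule vw_insert) (use insert min' in auto)
      moreover have "lop \<beta> i (del (insert j J)) = del (insert i (insert j J))"
        by (rule lop_del) (use min' in auto)
      ultimately show ?thesis using insert assms(2) by (simp add: canon_del I_zero)
    next
      case 2
      have "mono_word [v i] * vw (insert j J) - canon (lop \<beta> i (del (insert j J))) =
          (mono_word [v i] * mono_word [v i] - scalar (q i)) * vw J"
        using 2 J by (simp add: vJ dJ lop_lop_same \<beta>_def canon_scl canon_del algebra_simps)
      then show ?thesis using assms(2) J by (simp add: I_right rel_square_v F_vw)
    next
      case 3
      \<comment> \<open>The product of v_i with the rest involves only indices above j, so v_j can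
        be put back in front of it by \<open>mono_mult_canon\<close>.\<close>
      let ?g = "lop \<beta> i (del J)"
      have "supp_in {j<..<n} ?g"
        by (rule supp_in_lop) (use 3 assms(2) J min in \<open>auto simp: supp_in_del\<close>)
      then have g: "mono_word [v j] * canon ?g = canon (lop \<beta> j ?g)"
        using j by (rule mono_mult_canon)
      have "canon (lop \<beta> i (del (insert j J))) = scalar (b i j) * vw J - canon (lop \<beta> j ?g)"
        using 3 J by (simp add: dJ lop_lop[of j i] canon_diff canon_scl canon_del \<beta>_def)
      then have "mono_word [v i] * vw (insert j J) - canon (lop \<beta> i (del (insert j J))) =
          (mono_word [v i] * mono_word [v j] + mono_word [v j] * mono_word [v i] - scalar (b i j)) * vw J
          - mono_word [v j] * (mono_word [v i] * vw J - canon ?g)"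
        by (simp add: vJ g[symmetric] algebra_simps)
      moreover have "\<dots> \<in> I"
        by (rule I_diff[OF I_right[OF rel_anticommute] I_left])
          (use insert J j 3 assms(2) in \<open>auto intro!: F_vw F_v\<close>)
      ultimately show ?thesis by simp
    qed
  qed
qed

lemma mono_canon:
  assumes "f \<in> Mdl" "u \<in> M"
  shows "mono_word [u] * canon f - canon (act u f) \<in> I"
proof -
  have f: "f = (\<Sum>J\<in>Pow {..<n}. scl (f J) (del J))"
    using assms(1) by (intro supp_in_expand) (auto simp: Mdl_def)
  have v_canon: "mono_word [v i] * canon f - canon (lop \<beta> i f) \<in> I" if "i < n" for i
  proof -
    have "mono_word [v i] * canon f - canon (lop \<beta> i f) =
        (\<Sum>J\<in>Pow {..<n}. scalar (f J) * (mono_word [v i] * vw J - canon (lop \<beta> i (del J))))"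
    proof -
      have "canon (lop \<beta> i f) = (\<Sum>J\<in>Pow {..<n}. scalar (f J) * canon (lop \<beta> i (del J)))"
        by (subst f) (simp only: linop_sum[OF linop_lop] linop_scl[OF linop_lop] canon_sum canon_scl)
      moreover have "mono_word [v i] * canon f = (\<Sum>J\<in>Pow {..<n}. scalar (f J) * (mono_word [v i] * vw J))"
        unfolding canon_def sum_distrib_left
        by (rule sum.cong[OF refl]) (rule scalar_left_commute)
      ultimately show ?thesis by (simp add: right_diff_distrib sum_subtractf)
    qed
    also have "\<dots> \<in> I"
      using assms(1) that by (intro I_sum I_left mono_vw F_scalar) (auto simp: Mdl_def)
    finally show ?thesis .
  qed
  have sums: "mono_word [\<Sum>i\<in>J. s (co i u) (v i)] - (\<Sum>i\<in>J. scalar (co i u) * mono_word [v i]) \<in> I"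
    if "J \<subseteq> {..<n}" for J
  proof -
    have "finite J" using that by (rule finite_subset) simp
    from this that show ?thesis
    proof (induction J)
      case empty
      \<comment> \<open>As 0 + 0 = 0, this additivity relation is just the negative of the word of
        the zero vector, which the empty sum has to be.\<close>
      have "- (mono_word [0 + 0] - mono_word [0] - mono_word [0]) \<in> I"
        by (intro I_uminus rel_add M_zero)
      then show ?case by simp
    next
      case (insert i J)
      have i: "i < n" using insert by auto
      have "s (co i u) (v i) \<in> M" "(\<Sum>i\<in>J. s (co i u) (v i)) \<in> M"
        using insert assms(2) by (auto intro!: M_scale v_M co_K M_sum)
      then have "(mono_word [s (co i u) (v i) + (\<Sum>i\<in>J. s (co i u) (v i))] - mono_word [s (co i u) (v i)]
          - mono_word [\<Sum>i\<in>J. s (co i u) (v i)]) + (mono_word [s (co i u) (v i)] - scalar (co i u) * mono_word [v i])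
          + (mono_word [\<Sum>i\<in>J. s (co i u) (v i)] - (\<Sum>i\<in>J. scalar (co i u) * mono_word [v i])) \<in> I"
        using insert assms(2) i by (intro I_add rel_add rel_scale co_K v_M) auto
      with insert show ?case by (simp add: algebra_simps)
    qed
  qed
  have "(mono_word [u] - (\<Sum>i<n. scalar (co i u) * mono_word [v i])) * canon f +
      (\<Sum>i<n. scalar (co i u) * (mono_word [v i] * canon f - canon (lop \<beta> i f))) \<in> I"
  proof (rule I_add[OF I_right I_sum[OF I_left]])
    show "mono_word [u] - (\<Sum>i<n. scalar (co i u) * mono_word [v i]) \<in> I"
      using sums[of "{..<n}"] expand[OF assms(2)] by simp
  qed (use assms in \<open>auto intro!: co_K v_canon F_canon F_scalar\<close>)
  moreover have "canon (act u f) = (\<Sum>i<n. scalar (co i u) * canon (lop \<beta> i f))"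
    by (simp add: act_def canon_sum canon_scl)
  ultimately show ?thesis
    by (simp add: left_diff_distrib right_diff_distrib sum_distrib_right sum_subtractf mult.assoc)
qed

lemma word_canon: "set us \<subseteq> M \<Longrightarrow> mono_word us - canon (evw (Word us) (del {})) \<in> I"
proof (induction us)
  case Nil
  then show ?case by (simp add: canon_del vw_empty mono_word_Nil I_zero)
next
  case (Cons u us)
  let ?f = "evw (Word us) (del {})"
  have "mono_word [u] * (mono_word us - canon ?f) + (mono_word [u] * canon ?f - canon (act u ?f)) \<in> I"
    using Cons by (intro I_add I_left F_mono_word mono_canon Mdl_evw Mdl_del) auto
  then show ?case by (simp add: mono_word_Cons[of u us] algebra_simps)
qed

text \<open>Modulo the ideal every element equals the canonical element of its coordinates, so
  vanishing coordinates put it in the ideal.\<close>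

lemma ev_eq_zero:
  assumes "t \<in> carrier F" "ev t (del {}) = 0"
  shows "t \<in> I"
proof -
  have "t - canon (ev t (del {})) =
      (\<Sum>w\<in>Poly_Mapping.keys t. scalar (Poly_Mapping.lookup t w) *
        (mono_word (letters w) - canon (evw w (del {}))))"
  proof -
    have "t = (\<Sum>w\<in>Poly_Mapping.keys t. scalar (Poly_Mapping.lookup t w) * mono_word (letters w))"
      using poly_mapping_sum_single[of t] by (simp flip: single_mono)
    moreover have "canon (ev t (del {})) =
        (\<Sum>w\<in>Poly_Mapping.keys t. scalar (Poly_Mapping.lookup t w) * canon (evw w (del {})))"
      by (simp add: ev_def canon_sum canon_scl)
    ultimately show ?thesis
      by (simp only: right_diff_distrib sum_subtractf)
  qed
  also have "\<dots> \<in> I"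
  proof (intro I_sum I_left F_scalar)
    fix w assume "w \<in> Poly_Mapping.keys t"
    then show "mono_word (letters w) - canon (evw w (del {})) \<in> I"
      using word_canon[of "letters w"] assms(1) by (simp add: carrier_F)
  qed (use assms(1) in \<open>auto simp: carrier_F\<close>)
  finally show ?thesis using assms(2) by (simp add: canon_zero)
qed

text \<open>Membership in an ideal given by generators becomes an equation between coordinate
  vectors; equality in the quotient is decided by it.\<close>

lemma in_I_iff: "t \<in> carrier F \<Longrightarrow> t \<in> I \<longleftrightarrow> ev t (del {}) = 0"
  using ev_I ev_eq_zero by blast

end

text \<open>With \<open>B\<close> the boundaries and \<open>H\<close> the multiples of the Jacobian
  ideal, this evaluates both embeddings: since boundaries lie in \<open>H\<close>, a cohomology
  class goes to the coset of any of its cocycles.\<close>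

lemma a_coset_set_add:
  assumes "abelian_group G" "B \<subseteq> H" "\<zero>\<^bsub>G\<^esub> \<in> B" "H \<subseteq> carrier G" "z \<in> carrier G"
    and "\<And>x y. x \<in> H \<Longrightarrow> y \<in> H \<Longrightarrow> x \<oplus>\<^bsub>G\<^esub> y \<in> H"
  shows "(B +>\<^bsub>G\<^esub> z) <+>\<^bsub>G\<^esub> H = H +>\<^bsub>G\<^esub> z"
proof -
  interpret abelian_group G by fact
  show ?thesis
  proof (intro equalityI subsetI)
    fix x assume "x \<in> (B +>\<^bsub>G\<^esub> z) <+>\<^bsub>G\<^esub> H"
    then obtain b h where bh: "b \<in> B" "h \<in> H" "x = b \<oplus>\<^bsub>G\<^esub> z \<oplus>\<^bsub>G\<^esub> h"
      by (auto simp: set_add_def' a_r_coset_def')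
    then have "b \<in> carrier G" "h \<in> carrier G" using assms by auto
    then have "x = (b \<oplus>\<^bsub>G\<^esub> h) \<oplus>\<^bsub>G\<^esub> z" using bh(3) assms(5) by (simp add: a_ac)
    moreover have "b \<oplus>\<^bsub>G\<^esub> h \<in> H" using bh assms by auto
    ultimately show "x \<in> H +>\<^bsub>G\<^esub> z" by (auto simp: a_r_coset_def')
  next
    fix x assume "x \<in> H +>\<^bsub>G\<^esub> z"
    then obtain h where h: "h \<in> H" "x = h \<oplus>\<^bsub>G\<^esub> z" by (auto simp: a_r_coset_def')
    then have "x = (\<zero>\<^bsub>G\<^esub> \<oplus>\<^bsub>G\<^esub> z) \<oplus>\<^bsub>G\<^esub> h" using assms(4,5) by (auto simp: a_comm)
    moreover have "\<zero>\<^bsub>G\<^esub> \<oplus>\<^bsub>G\<^esub> z \<in> B +>\<^bsub>G\<^esub> z" using assms(3) by (auto simp: a_r_coset_def')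
    ultimately show "x \<in> (B +>\<^bsub>G\<^esub> z) <+>\<^bsub>G\<^esub> H"
      unfolding set_add_def' using h(1) by blast
  qed
qed

lemma linop_signed: "linop T \<Longrightarrow> T (signed p f) = signed p (T f)"
  using linop_uminus[of T f] by (cases "even p") (auto simp only: signed_def if_True if_False)

lemma signed_scl: "signed p (scl c f) = scl c (signed p f)"
  by (cases "even p") (simp_all add: signed_def scl_simps)

lemma signed_1: "odd p \<Longrightarrow> signed p a = - a"
  by (simp add: signed_def)

lemma signed_cong: "even (p - r) \<Longrightarrow> signed p a = signed r a"
  by (auto simp: signed_def)

section \<open>The quotient algebra in coordinates and its contraction derivations\<close>

context clifford_setup
begin

abbreviation cact :: "'k \<Rightarrow> ('m word \<Rightarrow>\<^sub>0 'k) set \<Rightarrow> ('m word \<Rightarrow>\<^sub>0 'k) set"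
  where "cact \<equiv> clifford_act K M s Q"
abbreviation cpart :: "int \<Rightarrow> ('m word \<Rightarrow>\<^sub>0 'k) set set"
  where "cpart \<equiv> clifford_part K M s Q"

lemma F_one: "1 \<in> carrier F"
  using F_scalar[OF K_one] by simp

lemma F_a_inv: "t \<in> carrier F \<Longrightarrow> \<ominus>\<^bsub>F\<^esub> t = - t"
  by (rule F.minus_equality) (auto simp: F_uminus)

lemma F_a_minus: "t \<in> carrier F \<Longrightarrow> t' \<in> carrier F \<Longrightarrow> t \<ominus>\<^bsub>F\<^esub> t' = t - t'"
  by (simp add: a_minus_def F_a_inv)

lemma carrier_C: "carrier C = cls ` carrier F"
  by (auto simp: clifford_def FactRing_def A_RCOSETS_def' clifford_class_def)

lemma cls_carrier: "t \<in> carrier F \<Longrightarrow> cls t \<in> carrier C"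
  by (simp add: carrier_C)

sublocale C: ring C
  unfolding clifford_def by (rule ideal.quotient_is_ring[OF ideal_I])

lemma cls_hom: "cls \<in> ring_hom F C"
  using ideal.rcos_ring_hom[OF ideal_I] by (simp add: clifford_def clifford_class_def[abs_def])

lemma cls_add: "t \<in> carrier F \<Longrightarrow> t' \<in> carrier F \<Longrightarrow> cls t \<oplus>\<^bsub>C\<^esub> cls t' = cls (t + t')"
  using ring_hom_add[OF cls_hom] by simp

lemma cls_mult: "t \<in> carrier F \<Longrightarrow> t' \<in> carrier F \<Longrightarrow> cls t \<otimes>\<^bsub>C\<^esub> cls t' = cls (t * t')"
  using ring_hom_mult[OF cls_hom] by simp

lemma cls_one: "\<one>\<^bsub>C\<^esub> = cls 1"
  using ring_hom_one[OF cls_hom] by simp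

lemma cls_zero: "\<zero>\<^bsub>C\<^esub> = cls 0"
  using ring_hom_zero[OF cls_hom F.ring_axioms C.ring_axioms] by simp

lemma cls_uminus: "t \<in> carrier F \<Longrightarrow> \<ominus>\<^bsub>C\<^esub> cls t = cls (- t)"
  by (rule C.minus_equality) (auto simp: cls_add cls_zero F_uminus cls_carrier)

lemma cls_eq_iff:
  assumes "t \<in> carrier F" "t' \<in> carrier F"
  shows "cls t = cls t' \<longleftrightarrow> ev t (del {}) = ev t' (del {})"
proof -
  have "cls t = cls t' \<longleftrightarrow> t - t' \<in> I"
    using F.quotient_eq_iff_same_a_r_cos[OF ideal_I assms] F_a_minus[OF assms]
    by (simp add: clifford_class_def)
  then show ?thesis by (simp add: in_I_iff F_diff assms ev_diff)
qed

text \<open>The coordinates of a class, by way of any representative; \<open>cls_eq_iff\<close>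
  makes the choice immaterial. On \<open>Mdl\<close> the inverse is the class of
  \<open>canon\<close>.\<close>

definition \<kappa> :: "('m word \<Rightarrow>\<^sub>0 'k) set \<Rightarrow> nat set \<Rightarrow> 'k"
  where "\<kappa> X = ev (SOME t. t \<in> carrier F \<and> cls t = X) (del {})"

lemma \<kappa>_cls: "t \<in> carrier F \<Longrightarrow> \<kappa> (cls t) = ev t (del {})"
  unfolding \<kappa>_def by (rule someI2[of _ t]) (auto simp: cls_eq_iff)

lemma C_E: "X \<in> carrier C \<Longrightarrow> (\<And>t. t \<in> carrier F \<Longrightarrow> X = cls t \<Longrightarrow> \<kappa> X = ev t (del {}) \<Longrightarrow> thesis) \<Longrightarrow> thesis"
  by (auto simp: carrier_C \<kappa>_cls)

lemma \<kappa>_Mdl: "X \<in> carrier C \<Longrightarrow> \<kappa> X \<in> Mdl"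
  by (elim C_E) (simp add: Mdl_ev Mdl_del)

lemma \<kappa>_inj: "X \<in> carrier C \<Longrightarrow> Y \<in> carrier C \<Longrightarrow> \<kappa> X = \<kappa> Y \<Longrightarrow> X = Y"
  by (elim C_E) (simp add: cls_eq_iff)

lemma cls_canon: "f \<in> Mdl \<Longrightarrow> cls (canon f) \<in> carrier C"
  by (simp add: cls_carrier F_canon)

lemma \<kappa>_canon: "f \<in> Mdl \<Longrightarrow> \<kappa> (cls (canon f)) = f"
  by (simp add: \<kappa>_cls F_canon ev_canon)

lemma canon_\<kappa>: "X \<in> carrier C \<Longrightarrow> cls (canon (\<kappa> X)) = X"
  by (rule \<kappa>_inj) (auto simp: cls_canon \<kappa>_Mdl \<kappa>_canon)

lemma \<kappa>_add: "X \<in> carrier C \<Longrightarrow> Y \<in> carrier C \<Longrightarrow> \<kappa> (X \<oplus>\<^bsub>C\<^esub> Y) = \<kappa> X + \<kappa> Y"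
  by (auto elim!: C_E simp: cls_add \<kappa>_cls F_add ev_add)

lemma \<kappa>_zero: "\<kappa> \<zero>\<^bsub>C\<^esub> = 0"
  by (simp add: cls_zero \<kappa>_cls F_zero)

lemma \<kappa>_uminus: "X \<in> carrier C \<Longrightarrow> \<kappa> (\<ominus>\<^bsub>C\<^esub> X) = - \<kappa> X"
  by (auto elim!: C_E simp: cls_uminus \<kappa>_cls F_uminus ev_uminus)

lemma \<kappa>_signed: "X \<in> carrier C \<Longrightarrow> \<kappa> (signed_in C p X) = signed p (\<kappa> X)"
  by (simp add: signed_in_def signed_def \<kappa>_uminus)

lemma signed_in_carrier: "X \<in> carrier C \<Longrightarrow> signed_in C p X \<in> carrier C"
  by (simp add: signed_in_def)

text \<open>Left multiplication in the quotient is the representation \<open>ev\<close>, so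
  identities between products become identities between operators.\<close>

lemma \<kappa>_mult: "t \<in> carrier F \<Longrightarrow> Y \<in> carrier C \<Longrightarrow> \<kappa> (cls t \<otimes>\<^bsub>C\<^esub> Y) = ev t (\<kappa> Y)"
  by (auto elim!: C_E simp: cls_mult \<kappa>_cls F_mult ev_mult)

lemma cact_carrier: "c \<in> K \<Longrightarrow> X \<in> carrier C \<Longrightarrow> cact c X \<in> carrier C"
  unfolding clifford_act_def by (intro C.m_closed cls_carrier F_scalar)

lemma \<kappa>_cact: "c \<in> K \<Longrightarrow> X \<in> carrier C \<Longrightarrow> \<kappa> (cact c X) = scl c (\<kappa> X)"
  by (simp add: clifford_act_def \<kappa>_mult F_scalar)

lemma cact_cls: "c \<in> K \<Longrightarrow> t \<in> carrier F \<Longrightarrow> cact c (cls t) = cls (scalar c * t)"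
  by (simp add: clifford_act_def cls_mult F_scalar)

lemma par_act: "par p f \<Longrightarrow> supp_in {..<n} f \<Longrightarrow> par (p + 1) (act u f)"
  unfolding act_def by (intro par_sum par_scl par_lop)

lemma supp_in_act: "supp_in {..<n} f \<Longrightarrow> supp_in {..<n} (act u f)"
  unfolding act_def by (intro supp_in_sum supp_in_scl supp_in_lop) auto

lemma par_evw: "par (int (length us)) (evw (Word us) (del {})) \<and> supp_in {..<n} (evw (Word us) (del {}))"
proof (induction us)
  case Nil
  then show ?case by (simp add: par_def del_def supp_in_def)
next
  case (Cons u us)
  then show ?case
    using par_act[of "int (length us)" "evw (Word us) (del {})" u] supp_in_act[of "evw (Word us) (del {})" u]
    by (simp add: add.commute)
qed

definition Fpar :: "int \<Rightarrow> ('m word \<Rightarrow>\<^sub>0 'k) set"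
  where "Fpar p = {t \<in> carrier F. \<forall>w \<in> Poly_Mapping.keys t. even (wordlen w - p)}"

lemma cpart_eq: "cpart p = cls ` Fpar p"
  by (simp add: clifford_part_def Fpar_def)

lemma Fpar_F: "t \<in> Fpar p \<Longrightarrow> t \<in> carrier F"
  by (simp add: Fpar_def)

lemma par_ev: "t \<in> Fpar p \<Longrightarrow> par p (ev t (del {}))"
  unfolding ev_def
proof (intro par_sum par_scl)
  fix w assume "t \<in> Fpar p" "w \<in> Poly_Mapping.keys t"
  then have "even (p - int (length (letters w)))" by (auto simp: Fpar_def wordlen_def)
  then show "par p (evw w (del {}))"
    using par_even[of p "int (length (letters w))" "evw w (del {})"] par_evw[of "letters w"] by simp
qed

lemma Fpar_canon:
  assumes "f \<in> Mdl" "par p f"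
  shows "canon f \<in> Fpar p"
  unfolding Fpar_def
proof (intro CollectI conjI ballI F_canon assms)
  fix w assume "w \<in> Poly_Mapping.keys (canon f)"
  then have "w \<in> (\<Union>J\<in>Pow {..<n}. Poly_Mapping.keys (scalar (f J) * vw J))"
    unfolding canon_def by (rule subsetD[OF keys_sum_subset])
  then obtain J where J: "J \<subseteq> {..<n}" and "w \<in> Poly_Mapping.keys (scalar (f J) * vw J)"
    by auto
  then have "w \<in> Poly_Mapping.keys (Poly_Mapping.single (Word (map v (sorted_list_of_set J))) (f J))"
    by (simp add: vw_def flip: single_mono)
  then have "f J \<noteq> 0" "w = Word (map v (sorted_list_of_set J))"
    by (auto simp: in_keys_iff lookup_single when_def split: if_splits)
  moreover have "finite J" using J by (rule finite_subset) simp
  ultimately show "even (wordlen w - p)"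
    using assms(2) by (auto simp: par_def wordlen_def)
qed

text \<open>One direction holds because each vector changes the parity of coordinates, the other
  because \<open>canon\<close> produces words whose lengths are the cardinalities of the index
  sets.\<close>

lemma cpart_iff: "X \<in> cpart p \<longleftrightarrow> X \<in> carrier C \<and> par p (\<kappa> X)"
proof
  assume "X \<in> cpart p"
  then show "X \<in> carrier C \<and> par p (\<kappa> X)"
    by (auto simp: cpart_eq \<kappa>_cls Fpar_F cls_carrier par_ev)
next
  assume "X \<in> carrier C \<and> par p (\<kappa> X)"
  then have "X = cls (canon (\<kappa> X))" "canon (\<kappa> X) \<in> Fpar p"
    by (auto simp: canon_\<kappa> Fpar_canon \<kappa>_Mdl)
  then show "X \<in> cpart p" by (auto simp: cpart_eq)
qed

text \<open>The condition under the definite description in \<open>contraction\<close>, with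
  arbitrary values \<open>r i\<close> at the generators in place of -d_i P.\<close>

definition derivation :: "(nat \<Rightarrow> 'k) \<Rightarrow> (('m word \<Rightarrow>\<^sub>0 'k) set \<Rightarrow> ('m word \<Rightarrow>\<^sub>0 'k) set) \<Rightarrow> bool"
  where "derivation r d \<longleftrightarrow> d \<in> carrier C \<rightarrow>\<^sub>E carrier C \<and>
       (\<forall>x \<in> carrier C. \<forall>y \<in> carrier C. d (x \<oplus>\<^bsub>C\<^esub> y) = d x \<oplus>\<^bsub>C\<^esub> d y) \<and>
       (\<forall>c \<in> K. \<forall>x \<in> carrier C. d (cact c x) = cact c (d x)) \<and>
       (\<forall>p. \<forall>x \<in> cpart p. d x \<in> cpart (p + 1)) \<and>
       (\<forall>p. \<forall>x \<in> cpart p. \<forall>y \<in> carrier C.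
         d (x \<otimes>\<^bsub>C\<^esub> y) = (d x \<otimes>\<^bsub>C\<^esub> y) \<oplus>\<^bsub>C\<^esub> signed_in C p (x \<otimes>\<^bsub>C\<^esub> d y)) \<and>
       (\<forall>i<n. d (cls (mono_word [v i])) = cls (scalar (r i)))"

definition \<delta> :: "(nat \<Rightarrow> 'k) \<Rightarrow> ('m word \<Rightarrow>\<^sub>0 'k) set \<Rightarrow> ('m word \<Rightarrow>\<^sub>0 'k) set"
  where "\<delta> r = (\<lambda>X \<in> carrier C. cls (canon (contrs n r (\<kappa> X))))"

context
  fixes r :: "nat \<Rightarrow> 'k"
  assumes r_K: "\<And>i. i < n \<Longrightarrow> r i \<in> K"
begin

lemma \<delta>_carrier: "X \<in> carrier C \<Longrightarrow> \<delta> r X \<in> carrier C"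
  by (simp add: \<delta>_def cls_canon Mdl_contrs \<kappa>_Mdl r_K)

lemma \<kappa>_\<delta>: "X \<in> carrier C \<Longrightarrow> \<kappa> (\<delta> r X) = contrs n r (\<kappa> X)"
  by (simp add: \<delta>_def \<kappa>_canon Mdl_contrs \<kappa>_Mdl r_K)

lemma contrs_act: "contrs n r (act u f) = scl (\<Sum>i<n. co i u * r i) f - act u (contrs n r f)"
proof -
  have "contrs n r (act u f) = (\<Sum>i<n. scl (co i u) (scl (r i) f - lop \<beta> i (contrs n r f)))"
    by (simp add: act_def linop_sum[OF linop_contrs] linop_scl[OF linop_contrs] contrs_lop)
  also have "\<dots> = (\<Sum>i<n. scl (co i u * r i) f) - act u (contrs n r f)"
    by (simp add: act_def scl_simps sum_subtractf)
  also have "(\<Sum>i<n. scl (co i u * r i) f) = scl (\<Sum>i<n. co i u * r i) f"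
    by (simp add: fun_eq_iff sum_fun_apply sum_distrib_right)
  finally show ?thesis .
qed

text \<open>The Leibniz rule has to hold against every right factor. So the graded commutator of
  \<open>contrs\<close> with a word is needed as an operator on all \<open>g\<close>, and it must
  again be the action of an element of the free algebra.\<close>

lemma word_derivative:
  "set us \<subseteq> M \<Longrightarrow> \<exists>t'\<in>carrier F. \<forall>g. ev t' g =
    contrs n r (evw (Word us) g) - signed (int (length us)) (evw (Word us) (contrs n r g))"
proof (induction us)
  case Nil
  then show ?case by (intro bexI[of _ 0]) (auto simp: F_zero signed_def)
next
  case (Cons u us)
  then have "set us \<subseteq> M" by simp
  from Cons.IH[OF this] obtain t' where t': "t' \<in> carrier F" "\<And>g. ev t' g =
    contrs n r (evw (Word us) g) - signed (int (length us)) (evw (Word us) (contrs n r g))" by blast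
  \<comment> \<open>Contracting the first letter gives a scalar in front of the tail; passing the
    letter costs a sign and leaves the derivative of the tail.\<close>
  let ?t = "scalar (\<Sum>i<n. co i u * r i) * mono_word us - mono_word [u] * t'"
  have "?t \<in> carrier F"
    using Cons t' by (intro F_diff F_mult F_scalar F_mono_word K_sum K_mult co_K r_K) auto
  moreover have "ev ?t g = contrs n r (evw (Word (u # us)) g)
      - signed (int (length (u # us))) (evw (Word (u # us)) (contrs n r g))" for g
    by (simp add: ev_diff ev_mult t'(2) contrs_act linop_diff[OF linop_act] linop_signed[OF linop_act])
      (simp add: signed_def)
  ultimately show ?case by blast
qed

lemma F_derivative:
  assumes "t \<in> Fpar p"
  shows "\<exists>t'\<in>carrier F. \<forall>g. ev t' g = contrs n r (ev t g) - signed p (ev t (contrs n r g))"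
proof -
  have "\<exists>t'\<in>carrier F. \<forall>g. ev t' g = contrs n r (evw w g) - signed p (evw w (contrs n r g))"
    if "w \<in> Poly_Mapping.keys t" for w
  proof -
    have w: "set (letters w) \<subseteq> M" and len: "even (int (length (letters w)) - p)"
      using that assms by (auto simp: Fpar_def carrier_F wordlen_def)
    show ?thesis using word_derivative[OF w] by (simp add: signed_cong[OF len])
  qed
  then obtain t' where t': "\<And>w. w \<in> Poly_Mapping.keys t \<Longrightarrow> t' w \<in> carrier F"
    "\<And>w g. w \<in> Poly_Mapping.keys t \<Longrightarrow>
      ev (t' w) g = contrs n r (evw w g) - signed p (evw w (contrs n r g))"
    by metis
  let ?t = "\<Sum>w\<in>Poly_Mapping.keys t. scalar (Poly_Mapping.lookup t w) * t' w"
  have "?t \<in> carrier F"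
    using assms t' by (intro F_sum F_mult F_scalar) (auto simp: Fpar_def carrier_F)
  moreover have "ev ?t g = contrs n r (ev t g) - signed p (ev t (contrs n r g))" for g
    by (simp add: ev_sum ev_mult t' ev_def[of t] linop_sum[OF linop_contrs] linop_scl[OF linop_contrs]
        signed_sum scl_simps sum_subtractf signed_scl)
  ultimately show ?thesis by blast
qed

lemma derivation_\<delta>: "derivation r (\<delta> r)"
  unfolding derivation_def
proof (intro conjI allI ballI impI)
  show "\<delta> r \<in> carrier C \<rightarrow>\<^sub>E carrier C"
    using \<delta>_carrier by (auto simp: \<delta>_def)
  show "\<delta> r (x \<oplus>\<^bsub>C\<^esub> y) = \<delta> r x \<oplus>\<^bsub>C\<^esub> \<delta> r y" if "x \<in> carrier C" "y \<in> carrier C" for x y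
    using that by (intro \<kappa>_inj) (auto simp: \<kappa>_add \<kappa>_\<delta> \<delta>_carrier linop_add[OF linop_contrs])
  show "\<delta> r (cact c x) = cact c (\<delta> r x)" if "c \<in> K" "x \<in> carrier C" for c x
    using that by (intro \<kappa>_inj) (auto simp: \<kappa>_cact cact_carrier \<kappa>_\<delta> \<delta>_carrier linop_scl[OF linop_contrs])
  show "\<delta> r x \<in> cpart (p + 1)" if "x \<in> cpart p" for p x
    using that \<kappa>_Mdl[of x] by (auto simp: cpart_iff \<delta>_carrier \<kappa>_\<delta> par_contrs Mdl_def)
  show "\<delta> r (cls (mono_word [v i])) = cls (scalar (r i))" if "i < n" for i
    using that by (intro \<kappa>_inj)
      (auto simp: \<kappa>_\<delta> \<delta>_carrier cls_carrier F_v F_scalar r_K \<kappa>_cls act_v contrs_lop contrs_del_empty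
        linop_zero[OF linop_lop])
  show "\<delta> r (x \<otimes>\<^bsub>C\<^esub> y) = (\<delta> r x \<otimes>\<^bsub>C\<^esub> y) \<oplus>\<^bsub>C\<^esub> signed_in C p (x \<otimes>\<^bsub>C\<^esub> \<delta> r y)"
    if x: "x \<in> cpart p" and y: "y \<in> carrier C" for p x y
  proof -
    obtain t where t: "t \<in> Fpar p" "x = cls t" using x by (auto simp: cpart_eq)
    obtain t' where t': "t' \<in> carrier F"
      "\<And>g. ev t' g = contrs n r (ev t g) - signed p (ev t (contrs n r g))"
      using F_derivative[OF t(1)] by blast
    have tF: "t \<in> carrier F" using t(1) by (rule Fpar_F)
    \<comment> \<open>At \<open>g = del {}\<close> the second term of \<open>t'\<close> disappears,
      since contractions kill the coordinates of 1.\<close>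
    have "\<delta> r x = cls t'"
      by (rule \<kappa>_inj) (auto simp: t(2) tF t' cls_carrier \<delta>_carrier \<kappa>_\<delta> \<kappa>_cls contrs_del_empty
          linop_zero[OF linop_ev] signed_simps)
    then show ?thesis
      using y tF t' by (intro \<kappa>_inj)
        (auto simp: t(2) cls_carrier \<delta>_carrier signed_in_carrier \<kappa>_\<delta> \<kappa>_mult \<kappa>_add \<kappa>_signed)
  qed
qed

text \<open>The Leibniz rule fixes the values on ordered products, by stripping the smallest index,
  and linearity fixes the others. Outside the carrier both functions are extensional.\<close>

lemma derivation_unique:
  assumes "derivation r d"
  shows "d = \<delta> r"
proof -
  have d_car: "d X \<in> carrier C" if "X \<in> carrier C" for X
    using assms that by (auto simp: derivation_def)
  have d_add: "d (X \<oplus>\<^bsub>C\<^esub> Y) = d X \<oplus>\<^bsub>C\<^esub> d Y" if "X \<in> carrier C" "Y \<in> carrier C" for X Y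
    using assms that by (auto simp: derivation_def)
  have d_cact: "d (cact c X) = cact c (d X)" if "c \<in> K" "X \<in> carrier C" for c X
    using assms that by (auto simp: derivation_def)
  have d_mult: "d (X \<otimes>\<^bsub>C\<^esub> Y) = (d X \<otimes>\<^bsub>C\<^esub> Y) \<oplus>\<^bsub>C\<^esub> signed_in C p (X \<otimes>\<^bsub>C\<^esub> d Y)"
    if "X \<in> cpart p" "Y \<in> carrier C" for p X Y
    using assms that by (auto simp: derivation_def)
  have d_v: "d (cls (mono_word [v i])) = cls (scalar (r i))" if "i < n" for i
    using assms that by (auto simp: derivation_def)
  have del: "\<kappa> (d (cls (vw J))) = contrs n r (del J)" if "J \<subseteq> {..<n}" for J
  proof -
    have "finite J" using that by (rule finite_subset) simp
    from this that show ?thesis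
    proof (induction J rule: finite_linorder_min_induct)
      case empty
      have one: "cls 1 \<in> cpart 0"
        by (auto simp: cpart_iff cls_carrier F_one \<kappa>_cls par_def del_def)
      have "d (cls 1) = (d (cls 1) \<otimes>\<^bsub>C\<^esub> cls 1) \<oplus>\<^bsub>C\<^esub> (cls 1 \<otimes>\<^bsub>C\<^esub> d (cls 1))"
        using d_mult[OF one, of "cls 1"] by (simp add: cls_carrier F_one signed_in_def flip: cls_one)
      then have "\<kappa> (d (cls 1)) = \<kappa> (d (cls 1) \<oplus>\<^bsub>C\<^esub> d (cls 1))"
        using d_car[of "cls 1"] by (simp add: cls_carrier F_one flip: cls_one)
      then have "\<kappa> (d (cls 1)) = 0"
        using d_car[of "cls 1"] by (simp add: cls_carrier F_one \<kappa>_add)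
      then show ?case by (simp add: vw_empty contrs_del_empty)
    next
      case (insert j J)
      then have j: "j < n" and J: "J \<subseteq> {..<n}" and min: "\<And>k. k \<in> J \<Longrightarrow> j < k" by auto
      have vJ: "vw (insert j J) = mono_word [v j] * vw J" by (rule vw_insert[OF J min])
      have vj: "cls (mono_word [v j]) \<in> cpart 1"
        using j par_evw[of "[v j]"] by (auto simp: cpart_iff cls_carrier F_v \<kappa>_cls)
      have "cls (vw (insert j J)) = cls (mono_word [v j]) \<otimes>\<^bsub>C\<^esub> cls (vw J)"
        using j J by (simp add: vJ cls_mult F_v F_vw)
      then have "\<kappa> (d (cls (vw (insert j J)))) = scl (r j) (del J) - lop \<beta> j (contrs n r (del J))"
        using j J insert d_mult[OF vj, of "cls (vw J)"] d_car[of "cls (vw J)"]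
        by (simp add: d_v cls_carrier F_v F_vw F_scalar r_K \<kappa>_add \<kappa>_mult \<kappa>_signed signed_in_carrier
            signed_1 \<kappa>_cls ev_vw act_v)
      also have "\<dots> = contrs n r (lop \<beta> j (del J))"
        using j by (simp add: contrs_lop)
      finally show ?case using lop_del[of J j \<beta>, OF min] by simp
    qed
  qed
  have sums: "\<kappa> (d (cls (\<Sum>J\<in>S. scalar (f J) * vw J))) = contrs n r (\<Sum>J\<in>S. scl (f J) (del J))"
    if "S \<subseteq> Pow {..<n}" "f \<in> Mdl" for S f
  proof -
    have "finite S" using that(1) by (rule finite_subset) simp
    from this that show ?thesis
    proof (induction S)
      case empty
      have "d (\<zero>\<^bsub>C\<^esub> \<oplus>\<^bsub>C\<^esub> \<zero>\<^bsub>C\<^esub>) = d \<zero>\<^bsub>C\<^esub> \<oplus>\<^bsub>C\<^esub> d \<zero>\<^bsub>C\<^esub>" by (rule d_add) auto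
      then have "\<kappa> (d \<zero>\<^bsub>C\<^esub>) = \<kappa> (d \<zero>\<^bsub>C\<^esub>) + \<kappa> (d \<zero>\<^bsub>C\<^esub>)"
        using d_car[of "\<zero>\<^bsub>C\<^esub>"] by (simp flip: \<kappa>_add)
      then have "\<kappa> (d \<zero>\<^bsub>C\<^esub>) = 0" by (simp only: add_cancel_right_right)
      then show ?case unfolding sum.empty linop_zero[OF linop_contrs] cls_zero .
    next
      case (insert J S)
      have fK: "f L \<in> K" for L using insert.prems by (simp add: Mdl_def)
      have F: "vw J \<in> carrier F" "(\<Sum>J\<in>S. scalar (f J) * vw J) \<in> carrier F"
        using insert fK by (auto intro!: F_vw F_sum F_mult F_scalar)
      have eq: "(\<Sum>J\<in>insert J S. scalar (f J) * vw J) = scalar (f J) * vw J + (\<Sum>J\<in>S. scalar (f J) * vw J)"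
        "(\<Sum>J\<in>insert J S. scl (f J) (del J)) = scl (f J) (del J) + (\<Sum>J\<in>S. scl (f J) (del J))"
        using insert by (simp_all only: sum.insert simp_thms)
      have "cls (scalar (f J) * vw J + (\<Sum>J\<in>S. scalar (f J) * vw J)) =
          cact (f J) (cls (vw J)) \<oplus>\<^bsub>C\<^esub> cls (\<Sum>J\<in>S. scalar (f J) * vw J)"
        using F fK by (simp add: cact_cls cls_add F_mult F_scalar)
      then have "\<kappa> (d (cls (scalar (f J) * vw J + (\<Sum>J\<in>S. scalar (f J) * vw J)))) =
          scl (f J) (contrs n r (del J)) + contrs n r (\<Sum>J\<in>S. scl (f J) (del J))"
      proof -
        have "J \<subseteq> {..<n}" using insert.prems by simp
        then have dJ: "\<kappa> (d (cls (vw J))) = contrs n r (del J)" by (rule del)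
        have dS: "\<kappa> (d (cls (\<Sum>J\<in>S. scalar (f J) * vw J))) = contrs n r (\<Sum>J\<in>S. scl (f J) (del J))"
          using insert.prems by (intro insert.IH) auto
        show ?thesis if "cls (scalar (f J) * vw J + (\<Sum>J\<in>S. scalar (f J) * vw J)) =
          cact (f J) (cls (vw J)) \<oplus>\<^bsub>C\<^esub> cls (\<Sum>J\<in>S. scalar (f J) * vw J)"
          unfolding that using F fK d_car[of "cls (vw J)"] d_car[of "cls (\<Sum>J\<in>S. scalar (f J) * vw J)"]
          by (simp add: d_add d_cact cls_carrier cact_carrier \<kappa>_add \<kappa>_cact dJ dS)
      qed
      then show ?case unfolding eq by (simp only: linop_add[OF linop_contrs] linop_scl[OF linop_contrs])
    qed
  qed
  have "d X = \<delta> r X" if X: "X \<in> carrier C" for X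
  proof (rule \<kappa>_inj)
    have f: "\<kappa> X \<in> Mdl" using X by (rule \<kappa>_Mdl)
    then have "\<kappa> (d (cls (canon (\<kappa> X)))) = contrs n r (\<kappa> X)"
      using sums[of "Pow {..<n}" "\<kappa> X"] supp_in_expand[of "{..<n}" "\<kappa> X"]
      by (simp add: canon_def Mdl_def)
    then show "\<kappa> (d X) = \<kappa> (\<delta> r X)" using X by (simp add: canon_\<kappa> \<kappa>_\<delta>)
  qed (use X d_car \<delta>_carrier in auto)
  moreover have "d X = \<delta> r X" if X: "X \<notin> carrier C" for X
    using X assms by (auto simp: derivation_def \<delta>_def)
  ultimately show ?thesis by blast
qed

lemma The_derivation: "(THE d. derivation r d) = \<delta> r"
  using derivation_\<delta> derivation_unique by blast

end

end

section \<open>Reduction modulo the Jacobian ideal and graded centrality\<close>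

definition Jval :: "'k set \<Rightarrow> (nat set \<Rightarrow> 'k) \<Rightarrow> bool"
  where "Jval J f \<longleftrightarrow> (\<forall>L. f L \<in> J)"

lemma par_decompose:
  fixes f :: "nat set \<Rightarrow> 'k::comm_ring_1"
  obtains f0 f1 where "par 0 f0" "par 1 f1" "f = f0 + f1" "f0 = (\<lambda>L. if even (card L) then f L else 0)"
    "f1 = (\<lambda>L. if even (card L) then 0 else f L)"
  by (rule that[of "\<lambda>L. if even (card L) then f L else 0" "\<lambda>L. if even (card L) then 0 else f L"])
    (auto simp: par_def fun_eq_iff)

lemma par_add_eq_zero:
  fixes f :: "nat set \<Rightarrow> 'k::comm_ring_1"
  assumes "par p f" "par (p + 1) g" "f + g = 0"
  shows "f = 0" "g = 0"
proof -
  have "f L = 0 \<and> g L = 0" for L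
  proof -
    have "f L + g L = 0" using fun_cong[OF assms(3), of L] by simp
    moreover have "f L = 0 \<or> g L = 0"
      using assms(1,2) by (auto simp: par_def)
    ultimately show ?thesis by auto
  qed
  then show "f = 0" "g = 0" by (auto simp: fun_eq_iff)
qed

locale clifford_jacobi = clifford_setup K M s Q n v co q b
  for K :: "'k::comm_ring_1 set" and M :: "'m::ab_group_add set" and s Q n v co q b +
  fixes J :: "'k set"
  assumes J_K: "J \<subseteq> K" and J_zero: "0 \<in> J" and J_add: "\<And>r r'. r \<in> J \<Longrightarrow> r' \<in> J \<Longrightarrow> r + r' \<in> J"
    and J_mult: "\<And>c r. c \<in> K \<Longrightarrow> r \<in> J \<Longrightarrow> c * r \<in> J"
begin

lemma J_uminus: "r \<in> J \<Longrightarrow> - r \<in> J"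
  using J_mult[OF K_uminus[OF K_one]] by fastforce

lemma J_mult_right: "r \<in> J \<Longrightarrow> c \<in> K \<Longrightarrow> r * c \<in> J"
  using J_mult by (simp add: mult.commute)

lemma J_sum: "(\<And>i. i \<in> S \<Longrightarrow> f i \<in> J) \<Longrightarrow> (\<Sum>i\<in>S. f i) \<in> J"
  by (induction S rule: infinite_finite_induct) (auto intro: J_zero J_add)

lemma Jval_zero: "Jval J 0"
  by (simp add: Jval_def J_zero)

lemma Jval_add: "Jval J f \<Longrightarrow> Jval J g \<Longrightarrow> Jval J (f + g)"
  by (simp add: Jval_def J_add)

lemma Jval_uminus: "Jval J f \<Longrightarrow> Jval J (- f)"
  by (simp add: Jval_def J_uminus)

lemma Jval_signed: "Jval J f \<Longrightarrow> Jval J (signed p f)"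
  by (cases "even p") (simp_all add: signed_def Jval_uminus)

lemma Jval_sum: "(\<And>i. i \<in> S \<Longrightarrow> Jval J (f i)) \<Longrightarrow> Jval J (\<Sum>i\<in>S. f i)"
  by (induction S rule: infinite_finite_induct) (auto intro: Jval_add Jval_zero)

lemma Jval_scl: "c \<in> K \<Longrightarrow> Jval J f \<Longrightarrow> Jval J (scl c f)"
  by (simp add: Jval_def J_mult)

lemma Jval_scl_left: "c \<in> J \<Longrightarrow> f \<in> Mdl \<Longrightarrow> Jval J (scl c f)"
  by (simp add: Jval_def Mdl_def J_mult_right)

lemma Jval_contr: "Jval J f \<Longrightarrow> Jval J (contr i f)"
  by (simp add: Jval_def contr_def J_zero J_mult K_sg)

lemma Jval_wedge: "Jval J f \<Longrightarrow> Jval J (wedge i f)"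
  by (simp add: Jval_def wedge_def J_zero J_mult K_sg)

lemma Jval_contrs: "(\<And>i. i < m \<Longrightarrow> r i \<in> K) \<Longrightarrow> Jval J f \<Longrightarrow> Jval J (contrs m r f)"
  unfolding contrs_def by (intro Jval_sum Jval_scl Jval_contr) auto

lemma Jval_contrs_left: "(\<And>i. i < m \<Longrightarrow> r i \<in> J) \<Longrightarrow> f \<in> Mdl \<Longrightarrow> Jval J (contrs m r f)"
  unfolding contrs_def by (intro Jval_sum Jval_scl_left Mdl_contr) auto

lemma Jval_act: "u \<in> M \<Longrightarrow> Jval J f \<Longrightarrow> Jval J (act u f)"
  unfolding act_def lop_def
  by (intro Jval_sum Jval_scl Jval_add Jval_wedge Jval_contrs co_K \<beta>_K) auto

lemma Jval_evw: "set us \<subseteq> M \<Longrightarrow> Jval J f \<Longrightarrow> Jval J (evw (Word us) f)"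
  by (induction us) (auto intro: Jval_act)

lemma Jval_ev: "t \<in> carrier F \<Longrightarrow> Jval J f \<Longrightarrow> Jval J (ev t f)"
  unfolding ev_def
proof (intro Jval_sum Jval_scl)
  fix w assume "t \<in> carrier F" "Jval J f" "w \<in> Poly_Mapping.keys t"
  moreover from this have "set (letters w) \<subseteq> M" by (simp add: carrier_F)
  ultimately show "Jval J (evw w f)" by (cases w) (simp add: Jval_evw)
qed (auto simp: carrier_F)

text \<open>An element of the free algebra acts like the canonical element of its coordinates. The
  coefficients of the latter lie in \<open>J\<close> and come out in front.\<close>

lemma Jval_ev_left:
  assumes "t \<in> carrier F" "Jval J (ev t (del {}))" "f \<in> Mdl"
  shows "Jval J (ev t f)"
proof -
  let ?g = "ev t (del {})"
  have g: "?g \<in> Mdl" using assms(1) by (simp add: Mdl_ev Mdl_del)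
  have "t - canon ?g \<in> I"
    using assms(1) g by (subst in_I_iff) (auto simp: F_diff F_canon ev_diff ev_canon)
  then have "ev t f = ev (canon ?g) f" using ev_I[of "t - canon ?g" f] by (simp add: ev_diff)
  also have "\<dots> = (\<Sum>L\<in>Pow {..<n}. scl (?g L) (ev (vw L) f))"
    by (simp add: canon_def ev_sum ev_mult)
  finally have "ev t f = (\<Sum>L\<in>Pow {..<n}. scl (?g L) (ev (vw L) f))" .
  moreover have "Jval J (\<Sum>L\<in>Pow {..<n}. scl (?g L) (ev (vw L) f))"
    using assms by (intro Jval_sum Jval_scl_left Mdl_ev F_vw) (auto simp: Jval_def)
  ultimately show ?thesis by simp
qed

definition JC :: "('m word \<Rightarrow>\<^sub>0 'k) set set"
  where "JC = ideal_mult J cact C"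

text \<open>The ordered products are a basis. Classes with coordinates in \<open>J\<close> are
  closed under everything that generates the subgroup, and conversely such a class is a sum of
  generators, one for each basis product.\<close>

lemma JC_iff: "X \<in> JC \<longleftrightarrow> X \<in> carrier C \<and> Jval J (\<kappa> X)"
proof
  define S where "S = {X \<in> carrier C. Jval J (\<kappa> X)}"
  have S_iff: "X \<in> S \<longleftrightarrow> X \<in> carrier C \<and> Jval J (\<kappa> X)" for X by (simp add: S_def)
  have S_zero: "\<zero>\<^bsub>C\<^esub> \<in> S" by (simp add: S_iff \<kappa>_zero Jval_zero)
  have S_cact: "cact r x \<in> S" if "r \<in> J" "x \<in> carrier C" for r x
    using that J_K by (simp add: S_iff cact_carrier \<kappa>_cact Jval_scl_left \<kappa>_Mdl subsetD)
  have S_uminus: "\<ominus>\<^bsub>C\<^esub> x \<in> S" if "x \<in> S" for x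
    using that by (simp add: S_iff \<kappa>_uminus Jval_uminus)
  have S_add: "x \<oplus>\<^bsub>C\<^esub> y \<in> S" if "x \<in> S" "y \<in> S" for x y
    using that by (simp add: S_iff \<kappa>_add Jval_add)
  assume "X \<in> JC"
  then have "X \<in> S"
    unfolding JC_def ideal_mult_def
    by (induction rule: generate.induct)
      (use S_zero S_cact S_uminus S_add in \<open>auto simp: a_inv_def\<close>)
  then show "X \<in> carrier C \<and> Jval J (\<kappa> X)" by (simp add: S_iff)
next
  assume X: "X \<in> carrier C \<and> Jval J (\<kappa> X)"
  have "cls (\<Sum>L\<in>S. scalar (\<kappa> X L) * vw L) \<in> JC" if "S \<subseteq> Pow {..<n}" for S
  proof -
    have "finite S" using that by (rule finite_subset) simp
    from this that show ?thesis
    proof (induction S)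
      case empty
      have "\<zero>\<^bsub>C\<^esub> \<in> JC" unfolding JC_def ideal_mult_def using generate.one[of "add_monoid C"] by simp
      then show ?case by (simp add: cls_zero)
    next
      case (insert L S)
      have r: "\<kappa> X L' \<in> J" "\<kappa> X L' \<in> K" for L' using X J_K by (auto simp: Jval_def)
      have F: "vw L \<in> carrier F" "(\<Sum>L\<in>S. scalar (\<kappa> X L) * vw L) \<in> carrier F"
        using insert r by (auto intro!: F_vw F_sum F_mult F_scalar)
      have "cact (\<kappa> X L) (cls (vw L)) \<oplus>\<^bsub>C\<^esub> cls (\<Sum>L\<in>S. scalar (\<kappa> X L) * vw L) \<in> JC"
      proof -
        have "cact (\<kappa> X L) (cls (vw L)) \<in> JC"
          unfolding JC_def ideal_mult_def
          using F r by (intro generate.incl) (auto intro!: cls_carrier)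
        moreover have "cls (\<Sum>L\<in>S. scalar (\<kappa> X L) * vw L) \<in> JC"
          using insert by simp
        ultimately show ?thesis
          unfolding JC_def ideal_mult_def using generate.eng[of _ "add_monoid C"] by fastforce
      qed
      then have "cls (scalar (\<kappa> X L) * vw L + (\<Sum>L\<in>S. scalar (\<kappa> X L) * vw L)) \<in> JC"
        using F r by (simp add: cact_cls cls_add F_mult F_scalar)
      with insert.hyps show ?case by simp
    qed
  qed
  from this[of "Pow {..<n}"] have "cls (canon (\<kappa> X)) \<in> JC" by (simp add: canon_def)
  then show "X \<in> JC" using X by (simp add: canon_\<kappa>)
qed

lemma ideal_JC: "ideal JC C"
proof (rule idealI)
  show "ring C" by (rule C.ring_axioms)
  show "subgroup JC (add_monoid C)"
  proof (rule C.add.subgroupI)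
    have "\<zero>\<^bsub>C\<^esub> \<in> JC" by (simp add: JC_iff \<kappa>_zero Jval_zero)
    then show "JC \<noteq> {}" by blast
  next
    fix x assume "x \<in> JC"
    then show "\<ominus>\<^bsub>C\<^esub> x \<in> JC" by (simp add: JC_iff \<kappa>_uminus Jval_uminus)
  next
    fix x y assume "x \<in> JC" "y \<in> JC"
    then show "x \<oplus>\<^bsub>C\<^esub> y \<in> JC" by (simp add: JC_iff \<kappa>_add Jval_add)
  qed (simp_all add: JC_iff subset_iff)
next
  fix a x assume ax: "a \<in> JC" "x \<in> carrier C"
  then have a: "a \<in> carrier C" "Jval J (\<kappa> a)" by (simp_all add: JC_iff)
  obtain t where t: "t \<in> carrier F" "a = cls t" "\<kappa> a = ev t (del {})" using a(1) by (rule C_E)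
  obtain t' where t': "t' \<in> carrier F" "x = cls t'" "\<kappa> x = ev t' (del {})" using ax(2) by (rule C_E)
  have "\<kappa> (x \<otimes>\<^bsub>C\<^esub> a) = ev t' (\<kappa> a)"
    unfolding t'(2) by (rule \<kappa>_mult[OF t'(1) a(1)])
  moreover have "Jval J (ev t' (\<kappa> a))" by (rule Jval_ev[OF t'(1) a(2)])
  ultimately show "x \<otimes>\<^bsub>C\<^esub> a \<in> JC" by (simp add: JC_iff a(1) ax(2))
  have "\<kappa> (a \<otimes>\<^bsub>C\<^esub> x) = ev t (\<kappa> x)"
    unfolding t(2) by (rule \<kappa>_mult[OF t(1) ax(2)])
  moreover have "Jval J (ev t (\<kappa> x))"
    by (rule Jval_ev_left[OF t(1) a(2)[unfolded t(3)] \<kappa>_Mdl[OF ax(2)]])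
  ultimately show "a \<otimes>\<^bsub>C\<^esub> x \<in> JC" by (simp add: JC_iff a(1) ax(2))
qed

abbreviation jcl :: "('m word \<Rightarrow>\<^sub>0 'k) \<Rightarrow> ('m word \<Rightarrow>\<^sub>0 'k) set set"
  where "jcl t \<equiv> JC +>\<^bsub>C\<^esub> cls t"

abbreviation CJ :: "('m word \<Rightarrow>\<^sub>0 'k) set set ring" where "CJ \<equiv> C Quot JC"

lemma jcl_eq_iff:
  assumes "t \<in> carrier F" "t' \<in> carrier F"
  shows "jcl t = jcl t' \<longleftrightarrow> Jval J (ev (t - t') (del {}))"
proof -
  have "jcl t = jcl t' \<longleftrightarrow> cls t \<ominus>\<^bsub>C\<^esub> cls t' \<in> JC"
    using C.quotient_eq_iff_same_a_r_cos[OF ideal_JC] assms by (simp add: cls_carrier)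
  also have "cls t \<ominus>\<^bsub>C\<^esub> cls t' = cls (t - t')"
    using assms by (simp add: a_minus_def cls_uminus cls_add F_uminus)
  finally show ?thesis using assms by (simp add: JC_iff cls_carrier F_diff \<kappa>_cls)
qed

lemma CJ_ring: "ring CJ"
  by (rule ideal.quotient_is_ring[OF ideal_JC])

lemma jcl_hom: "(+>\<^bsub>C\<^esub>) JC \<in> ring_hom C CJ"
  by (rule ideal.rcos_ring_hom[OF ideal_JC])

lemma jcl_carrier: "t \<in> carrier F \<Longrightarrow> jcl t \<in> carrier CJ"
  using ring_hom_closed[OF jcl_hom cls_carrier] .

lemma jcl_add: "t \<in> carrier F \<Longrightarrow> t' \<in> carrier F \<Longrightarrow> jcl t \<oplus>\<^bsub>CJ\<^esub> jcl t' = jcl (t + t')"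
  using ring_hom_add[OF jcl_hom cls_carrier cls_carrier] by (simp add: cls_add)

lemma jcl_mult: "t \<in> carrier F \<Longrightarrow> t' \<in> carrier F \<Longrightarrow> jcl t \<otimes>\<^bsub>CJ\<^esub> jcl t' = jcl (t * t')"
  using ring_hom_mult[OF jcl_hom cls_carrier cls_carrier] by (simp add: cls_mult)

lemma jcl_zero: "\<zero>\<^bsub>CJ\<^esub> = jcl 0"
  using ring_hom_zero[OF jcl_hom C.ring_axioms CJ_ring] by (simp add: cls_zero)

lemma jcl_uminus: "t \<in> carrier F \<Longrightarrow> \<ominus>\<^bsub>CJ\<^esub> jcl t = jcl (- t)"
proof -
  assume t: "t \<in> carrier F"
  interpret CJ: ring CJ by (rule CJ_ring)
  show ?thesis
    by (rule CJ.minus_equality) (use t in \<open>auto simp: jcl_add jcl_zero F_uminus intro: jcl_carrier\<close>)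
qed

lemma jcl_signed: "t \<in> carrier F \<Longrightarrow> signed_in CJ p (jcl t) = jcl (signed p t)"
  by (simp add: signed_in_def signed_def jcl_uminus)

lemma F_signed: "t \<in> carrier F \<Longrightarrow> signed p t \<in> carrier F"
  by (simp add: signed_def F_uminus)

lemma ev_signed: "ev (signed p t) f = signed p (ev t f)"
  by (cases "even p") (simp_all add: signed_def ev_uminus)

text \<open>The polar form with its diagonal filled in: v_j v_i + v_i v_j = \<open>brac j i\<close>,
  which for i = j is twice the square of v_j.\<close>

definition brac :: "nat \<Rightarrow> nat \<Rightarrow> 'k"
  where "brac j i = (if i = j then q j + q j else b j i)"

text \<open>The operator \<open>contrs n (brac j) - lop \<beta> j\<close> anticommutes with left multiplication by every
  vector; as \<open>contrs\<close> kills \<open>del {}\<close>, applying it there computes graded commutators with \<open>v j\<close>.\<close>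

lemma bracket_lop:
  assumes "i < n" "j < n"
  shows "contrs n (brac j) (lop \<beta> i f) - lop \<beta> j (lop \<beta> i f) =
    - lop \<beta> i (contrs n (brac j) f - lop \<beta> j f)"
proof -
  have "lop \<beta> j (lop \<beta> i f) = scl (brac j i) f - lop \<beta> i (lop \<beta> j f)"
  proof (cases i j rule: linorder_cases)
    case less
    then show ?thesis using lop_lop[of i j \<beta> f] by (simp add: brac_def \<beta>_def)
  next
    case equal
    have "scl (q j + q j) f - scl (q j) f = scl (q j) f"
      by (simp only: scl_simps(8) add_diff_cancel)
    then show ?thesis using equal by (simp only: lop_lop_same brac_def \<beta>_def simp_thms if_True)
  next
    case greater
    then have "lop \<beta> i (lop \<beta> j f) = scl (b i j) f - lop \<beta> j (lop \<beta> i f)"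
      using lop_lop[of j i \<beta> f] by (simp add: \<beta>_def)
    then show ?thesis using greater by (simp add: brac_def b_sym[of i j])
  qed
  then show ?thesis using assms(1) by (simp add: contrs_lop linop_diff[OF linop_lop])
qed

lemma bracket_act:
  assumes "j < n"
  shows "contrs n (brac j) (act u f) - lop \<beta> j (act u f) =
    - act u (contrs n (brac j) f - lop \<beta> j f)"
proof -
  have "contrs n (brac j) (act u f) - lop \<beta> j (act u f) =
      (\<Sum>i<n. scl (co i u) (contrs n (brac j) (lop \<beta> i f) - lop \<beta> j (lop \<beta> i f)))"
    by (simp add: act_def linop_sum[OF linop_contrs] linop_scl[OF linop_contrs]
        linop_sum[OF linop_lop] linop_scl[OF linop_lop] scl_simps sum_subtractf)
  also have "\<dots> = (\<Sum>i<n. scl (co i u) (- lop \<beta> i (contrs n (brac j) f - lop \<beta> j f)))"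
    by (rule sum.cong) (use assms in \<open>simp_all add: bracket_lop\<close>)
  also have "\<dots> = - act u (contrs n (brac j) f - lop \<beta> j f)"
    by (simp add: act_def scl_simps sum_negf)
  finally show ?thesis .
qed

lemma bracket_evw:
  assumes "j < n"
  shows "contrs n (brac j) (evw (Word us) f) - lop \<beta> j (evw (Word us) f) =
    signed (int (length us)) (evw (Word us) (contrs n (brac j) f - lop \<beta> j f))"
proof (induction us)
  case Nil
  show ?case by (simp add: signed_def)
next
  case (Cons u us)
  have "signed (int (length us)) (x :: nat set \<Rightarrow> 'k) = - signed (int (length (u # us))) x" for x
    by (simp add: signed_def)
  then show ?case
    unfolding evw_Cons bracket_act[OF assms] Cons.IH linop_signed[OF linop_act]
    by (metis add.inverse_inverse)
qed

text \<open>At \<open>del {}\<close> the contraction vanishes and \<open>lop \<beta> j\<close> gives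
  \<open>del {j}\<close>, which stands for right multiplication by v_j; what remains is the graded
  commutator.\<close>

lemma bracket_ev:
  assumes "j < n" "t \<in> Fpar p"
  shows "ev (mono_word [v j] * t - signed p (t * mono_word [v j])) (del {}) =
    contrs n (brac j) (ev t (del {}))"
proof -
  have w: "contrs n (brac j) (evw w (del {})) - lop \<beta> j (evw w (del {})) = - signed p (evw w (del {j}))"
    if "w \<in> Poly_Mapping.keys t" for w
  proof -
    have "even (int (length (letters w)) - p)"
      using that assms(2) by (auto simp: Fpar_def wordlen_def)
    moreover have "contrs n (brac j) (del {}) - lop \<beta> j (del {}) = - del {j}"
      using lop_del[of "{}" j \<beta>] by (simp add: contrs_del_empty)
    ultimately show ?thesis
      using bracket_evw[OF assms(1), of "letters w" "del {}"]
      by (simp add: linop_uminus[OF linop_evw] signed_simps signed_cong[of "int (length (letters w))" p])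
  qed
  have "contrs n (brac j) (ev t (del {})) - lop \<beta> j (ev t (del {})) =
      (\<Sum>w\<in>Poly_Mapping.keys t. scl (Poly_Mapping.lookup t w)
        (contrs n (brac j) (evw w (del {})) - lop \<beta> j (evw w (del {}))))"
    by (simp add: ev_def linop_sum[OF linop_contrs] linop_scl[OF linop_contrs]
        linop_sum[OF linop_lop] linop_scl[OF linop_lop] scl_simps sum_subtractf)
  also have "\<dots> = (\<Sum>x\<in>Poly_Mapping.keys t. scl (Poly_Mapping.lookup t x) (- signed p (evw x (del {j}))))"
    by (rule sum.cong) (simp_all add: w)
  also have "\<dots> = - signed p (ev t (del {j}))"
    by (simp add: ev_def signed_sum signed_scl scl_simps sum_negf)
  finally have "contrs n (brac j) (ev t (del {})) = lop \<beta> j (ev t (del {})) - signed p (ev t (del {j}))"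
    by (simp add: algebra_simps)
  then show ?thesis
    using assms(1) lop_del[of "{}" j \<beta>] by (simp add: ev_diff ev_mult ev_signed act_v)
qed

text \<open>The preimage of \<open>JC\<close> in the free algebra. Commutators are computed there,
  with the operations of an ordinary ring type instead of those of a quotient record.\<close>

definition N :: "('m word \<Rightarrow>\<^sub>0 'k) set"
  where "N = {t \<in> carrier F. Jval J (ev t (del {}))}"

lemma N_left: "t \<in> N \<Longrightarrow> c \<in> carrier F \<Longrightarrow> c * t \<in> N"
  by (simp add: N_def F_mult ev_mult Jval_ev)

lemma N_right: "t \<in> N \<Longrightarrow> c \<in> carrier F \<Longrightarrow> t * c \<in> N"
  using Jval_ev_left[of t "ev c (del {})"] by (simp add: N_def F_mult ev_mult Mdl_ev Mdl_del)

lemma N_add: "t \<in> N \<Longrightarrow> t' \<in> N \<Longrightarrow> t + t' \<in> N"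
  by (simp add: N_def F_add ev_add Jval_add)

lemma N_signed: "t \<in> N \<Longrightarrow> signed p t \<in> N"
  by (simp add: N_def F_signed ev_signed Jval_signed)

lemma N_zero: "0 \<in> N"
  by (simp add: N_def F_zero Jval_zero)

lemma N_sum: "(\<And>i. i \<in> S \<Longrightarrow> t i \<in> N) \<Longrightarrow> (\<Sum>i\<in>S. t i) \<in> N"
  by (induction S rule: infinite_finite_induct) (auto simp: N_add N_zero)

lemma I_N: "t \<in> I \<Longrightarrow> t \<in> N"
  by (simp add: N_def I_carrier ev_I Jval_zero)

context
  fixes t p
  assumes t: "t \<in> Fpar p"
    and v_central: "\<And>j. j < n \<Longrightarrow> mono_word [v j] * t - signed p (t * mono_word [v j]) \<in> N"
begin

lemma t_F: "t \<in> carrier F"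
  using t by (rule Fpar_F)

text \<open>Modulo the Clifford ideal \<open>u\<close> is the combination of the v_i with its
  coordinates, and the graded commutator is linear in it.\<close>

lemma vector_central: "u \<in> M \<Longrightarrow> mono_word [u] * t - signed p (t * mono_word [u]) \<in> N"
proof -
  assume u: "u \<in> M"
  let ?l = "\<Sum>i<n. scalar (co i u) * mono_word [v i]"
  have "mono_word [u] - ?l \<in> I"
  proof (subst in_I_iff)
    show "mono_word [u] - ?l \<in> carrier F"
      using u by (intro F_diff F_mono_word F_sum F_mult F_scalar co_K) (auto intro: v_M)
    show "ev (mono_word [u] - ?l) (del {}) = 0"
      by (simp add: ev_diff ev_sum ev_mult act_v) (simp add: act_def)
  qed
  then have "(mono_word [u] - ?l) * t + signed (p + 1) (t * (mono_word [u] - ?l)) +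
      (\<Sum>i<n. scalar (co i u) * (mono_word [v i] * t - signed p (t * mono_word [v i]))) \<in> N"
    using u by (intro N_add N_right[OF I_N] N_signed N_left[OF I_N] N_sum N_left[OF v_central] t_F F_scalar co_K)
      auto
  moreover have "(\<Sum>i<n. scalar (co i u) * (mono_word [v i] * t - signed p (t * mono_word [v i]))) =
      ?l * t - signed p (t * ?l)"
    by (cases "even p") (simp_all add: signed_def right_diff_distrib distrib_left sum_subtractf sum.distrib
        sum_distrib_right sum_distrib_left scalar_left_commute mult.assoc sum_negf)
  moreover have "(mono_word [u] - ?l) * t + signed (p + 1) (t * (mono_word [u] - ?l)) +
      (?l * t - signed p (t * ?l)) = mono_word [u] * t - signed p (t * mono_word [u])"
    by (cases "even p") (simp_all add: signed_def algebra_simps)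
  ultimately show ?thesis by simp
qed

text \<open>Passing a word one letter at a time collects the sign of parity \<open>p\<close> once
  per letter.\<close>

lemma word_central:
  "set us \<subseteq> M \<Longrightarrow> mono_word us * t - signed (p * int (length us)) (t * mono_word us) \<in> N"
proof (induction us)
  case Nil
  show ?case by (simp add: mono_word_Nil signed_def N_def F_zero Jval_zero)
next
  case (Cons u us)
  let ?l = "p * int (length us)"
  have "mono_word [u] * (mono_word us * t - signed ?l (t * mono_word us)) +
      signed ?l ((mono_word [u] * t - signed p (t * mono_word [u])) * mono_word us) \<in> N"
    using Cons by (intro N_add N_left N_signed N_right vector_central F_mono_word) auto
  also have "mono_word [u] * (mono_word us * t - signed ?l (t * mono_word us)) +
      signed ?l ((mono_word [u] * t - signed p (t * mono_word [u])) * mono_word us) =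
      mono_word (u # us) * t - signed (p * int (length (u # us))) (t * mono_word (u # us))"
    unfolding mono_word_Cons[of u us]
    by (cases "even p"; cases "even (length us)") (simp_all add: signed_def algebra_simps)
  finally show ?case .
qed

lemma central:
  assumes "t' \<in> Fpar r"
  shows "t * t' - signed (p * r) (t' * t) \<in> N"
proof -
  let ?m = "\<lambda>w. mono_word (letters w) * t - signed (p * r) (t * mono_word (letters w))"
  have w: "?m w \<in> N" if "w \<in> Poly_Mapping.keys t'" for w
  proof -
    have "set (letters w) \<subseteq> M" "even (int (length (letters w)) - r)"
      using that assms by (auto simp: Fpar_def carrier_F wordlen_def)
    moreover from this have "even (p * int (length (letters w)) - p * r)"
      by (simp flip: right_diff_distrib)
    ultimately show ?thesis using word_central[of "letters w"] signed_cong by metis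
  qed
  have t': "t' = (\<Sum>w\<in>Poly_Mapping.keys t'. scalar (Poly_Mapping.lookup t' w) * mono_word (letters w))"
    using poly_mapping_sum_single[of t'] by (simp flip: single_mono)
  \<comment> \<open>The extra 1 in the sign exchanges the roles of the two products in the
    commutator.\<close>
  have "signed (p * r + 1) (\<Sum>w\<in>Poly_Mapping.keys t'. scalar (Poly_Mapping.lookup t' w) * ?m w) \<in> N"
    using assms by (intro N_signed N_sum N_left w F_scalar) (auto simp: Fpar_def carrier_F)
  moreover have "(\<Sum>w\<in>Poly_Mapping.keys t'. scalar (Poly_Mapping.lookup t' w) * ?m w) =
      t' * t - signed (p * r) (t * t')"
    by (subst (3 4) t', cases "even (p * r)")
      (simp_all add: signed_def right_diff_distrib distrib_left sum_subtractf sum.distrib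
        sum_distrib_right sum_distrib_left scalar_left_commute mult.assoc sum_negf)
  moreover have "signed (p * r + 1) (t' * t - signed (p * r) (t * t')) = t * t' - signed (p * r) (t' * t)"
    by (cases "even (p * r)") (simp_all add: signed_def)
  ultimately show ?thesis by simp
qed

end

text \<open>\<open>graded_centre\<close> asks for homogeneous components. Contraction reverses
  parity, so the even and the odd part of a cycle are cycles themselves, and the commutator
  condition \<open>H\<close> applies to each of them.\<close>

lemma cycle_graded_central:
  assumes r: "\<And>i. i < n \<Longrightarrow> r i \<in> J"
    and H: "\<And>f j. f \<in> Mdl \<Longrightarrow> contrs n r f = 0 \<Longrightarrow> j < n \<Longrightarrow> Jval J (contrs n (brac j) f)"
    and f: "f \<in> Mdl" "contrs n r f = 0"
  shows "jcl (canon f) \<in> graded_centre CJ (\<lambda>p. (\<lambda>x. JC +>\<^bsub>C\<^esub> x) ` cpart p)"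
proof -
  obtain f0 f1 where dec: "par 0 f0" "par 1 f1" "f = f0 + f1"
      "f0 = (\<lambda>L. if even (card L) then f L else 0)" "f1 = (\<lambda>L. if even (card L) then 0 else f L)"
    by (rule par_decompose)
  have f0: "f0 \<in> Mdl" and f1: "f1 \<in> Mdl"
    using f(1) by (auto simp: Mdl_def dec(4,5) K_zero supp_in_def)
  have supp: "supp_in {..<n} f0" "supp_in {..<n} f1" using f0 f1 by (simp_all add: Mdl_def)
  have "par (1 + 1) (contrs n r f1)" "par (0 + 1) (contrs n r f0)"
    by (rule par_contrs[OF dec(2) supp(2)], rule par_contrs[OF dec(1) supp(1)])
  moreover have "contrs n r f0 + contrs n r f1 = 0"
    using f(2) unfolding dec(3) linop_add[OF linop_contrs] .
  ultimately have c0: "contrs n r f0 = 0" and c1: "contrs n r f1 = 0"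
    using par_add_eq_zero[of "0 + 1" "contrs n r f0" "contrs n r f1"]
    by (simp_all only: add_0 one_add_one)
  define g where "g p = (if p = 0 then f0 else f1)" for p :: int
  have g: "g p \<in> Mdl" "contrs n r (g p) = 0" "par p (g p)" if "p \<in> {0, 1}" for p
    using that f0 f1 c0 c1 dec(1,2) by (auto simp: g_def)
  have gF: "canon (g p) \<in> Fpar p" "canon (g p) \<in> carrier F" if "p \<in> {0, 1}" for p
    using g[OF that] by (auto intro: Fpar_canon F_canon)
  have comm: "jcl (canon (g p)) \<otimes>\<^bsub>CJ\<^esub> B = signed_in CJ (p * a) (B \<otimes>\<^bsub>CJ\<^esub> jcl (canon (g p)))"
    if p: "p \<in> {0, 1}" and B: "B \<in> (\<lambda>x. JC +>\<^bsub>C\<^esub> x) ` cpart a" for p a B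
  proof -
    obtain t' where t': "t' \<in> Fpar a" "B = jcl t'" using B by (auto simp: cpart_eq)
    have t'F: "t' \<in> carrier F" using t'(1) by (rule Fpar_F)
    have "canon (g p) * t' - signed (p * a) (t' * canon (g p)) \<in> N"
    proof (rule central[OF gF(1)[OF p] _ t'(1)])
      fix j assume j: "j < n"
      have "Jval J (ev (mono_word [v j] * canon (g p) - signed p (canon (g p) * mono_word [v j])) (del {}))"
        using H[OF g(1,2)[OF p] j] by (simp add: bracket_ev[OF j gF(1)[OF p]] ev_canon g(1)[OF p])
      then show "mono_word [v j] * canon (g p) - signed p (canon (g p) * mono_word [v j]) \<in> N"
        using j gF(2)[OF p] by (simp add: N_def F_diff F_mult F_signed F_v)
    qed
    then show ?thesis
      using gF(2)[OF p] t'F by (simp add: t'(2) jcl_mult jcl_signed F_mult jcl_eq_iff F_signed N_def)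
  qed
  have "canon f = canon (g 0) + canon (g 1)" by (simp add: g_def dec(3) canon_add)
  then have "jcl (canon f) = jcl (canon (g 0)) \<oplus>\<^bsub>CJ\<^esub> jcl (canon (g 1))"
    using gF(2) by (simp add: jcl_add)
  moreover have "jcl (canon (g p)) \<in> (\<lambda>x. JC +>\<^bsub>C\<^esub> x) ` cpart p" if "p \<in> {0, 1}" for p
    using gF(1)[OF that] by (auto simp: cpart_eq)
  moreover have "jcl (canon f) \<in> carrier CJ" using f by (intro jcl_carrier F_canon)
  ultimately show ?thesis
    unfolding graded_centre_def using comm by (intro CollectI conjI exI[of _ "\<lambda>p. jcl (canon (g p))"]) auto
qed

text \<open>The values \<open>r i\<close> lie in \<open>J\<close>, so boundaries are multiples of
  \<open>J\<close> and the embedding sends the class of a cycle to its class modulo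
  \<open>J\<close>.\<close>

lemma embed_cohomology:
  assumes r: "\<And>i. i < n \<Longrightarrow> r i \<in> J"
  shows "(\<lambda>\<xi>. \<xi> <+>\<^bsub>C\<^esub> JC) ` cohomology C (\<delta> r) = {jcl (canon f) | f. f \<in> Mdl \<and> contrs n r f = 0}"
proof -
  have rK: "r i \<in> K" if "i < n" for i using r[OF that] J_K by blast
  have coset: "(\<delta> r ` carrier C +>\<^bsub>C\<^esub> z) <+>\<^bsub>C\<^esub> JC = JC +>\<^bsub>C\<^esub> z" if "z \<in> carrier C" for z
  proof (rule a_coset_set_add)
    show "\<delta> r ` carrier C \<subseteq> JC"
      using r by (auto simp: JC_iff \<delta>_carrier rK \<kappa>_\<delta> Jval_contrs_left \<kappa>_Mdl)
    have "\<delta> r \<zero>\<^bsub>C\<^esub> = \<zero>\<^bsub>C\<^esub>"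
      by (rule \<kappa>_inj) (auto simp: \<delta>_carrier rK \<kappa>_\<delta> \<kappa>_zero linop_zero[OF linop_contrs])
    then show "\<zero>\<^bsub>C\<^esub> \<in> \<delta> r ` carrier C" by (metis C.zero_closed image_eqI)
  qed (use that in \<open>auto simp: C.abelian_group_axioms JC_iff \<kappa>_add Jval_add\<close>)
  have cyc: "\<delta> r z = \<zero>\<^bsub>C\<^esub> \<longleftrightarrow> contrs n r (\<kappa> z) = 0" if "z \<in> carrier C" for z
    using that \<kappa>_inj[of "\<delta> r z" "\<zero>\<^bsub>C\<^esub>"] \<delta>_carrier[of r z] \<kappa>_\<delta>[of r z] rK
    by (auto simp: \<kappa>_zero)
  show ?thesis
  proof (intro equalityI subsetI)
    fix x assume "x \<in> (\<lambda>\<xi>. \<xi> <+>\<^bsub>C\<^esub> JC) ` cohomology C (\<delta> r)"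
    then obtain z where z: "z \<in> carrier C" "\<delta> r z = \<zero>\<^bsub>C\<^esub>" "x = JC +>\<^bsub>C\<^esub> z"
      by (auto simp: cohomology_def coset)
    then have "x = jcl (canon (\<kappa> z))" "\<kappa> z \<in> Mdl" "contrs n r (\<kappa> z) = 0"
      using cyc by (auto simp: canon_\<kappa> \<kappa>_Mdl)
    then show "x \<in> {jcl (canon f) | f. f \<in> Mdl \<and> contrs n r f = 0}" by blast
  next
    fix x assume "x \<in> {jcl (canon f) | f. f \<in> Mdl \<and> contrs n r f = 0}"
    then obtain f where f: "f \<in> Mdl" "contrs n r f = 0" "x = jcl (canon f)" by blast
    then have "\<delta> r (cls (canon f)) = \<zero>\<^bsub>C\<^esub>" by (simp add: cyc cls_canon \<kappa>_canon)
    moreover have "x = (\<delta> r ` carrier C +>\<^bsub>C\<^esub> cls (canon f)) <+>\<^bsub>C\<^esub> JC"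
      using f by (simp add: coset cls_canon)
    ultimately show "x \<in> (\<lambda>\<xi>. \<xi> <+>\<^bsub>C\<^esub> JC) ` cohomology C (\<delta> r)"
      unfolding cohomology_def using f(1) by (blast intro: cls_canon)
  qed
qed

end

section \<open>Shuffles\<close>

fun lefts :: "('a + 'b) list \<Rightarrow> 'a list" where
  "lefts [] = []"
| "lefts (Inl a # l) = a # lefts l"
| "lefts (Inr c # l) = lefts l"

fun rights :: "('a + 'b) list \<Rightarrow> 'b list" where
  "rights [] = []"
| "rights (Inl a # l) = rights l"
| "rights (Inr c # l) = c # rights l"

lemma lefts_append [simp]: "lefts (l @ l') = lefts l @ lefts l'"
  by (induction l rule: lefts.induct) auto

lemma rights_append [simp]: "rights (l @ l') = rights l @ rights l'"
  by (induction l rule: rights.induct) auto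

lemma length_lefts_rights: "length l = length (lefts l) + length (rights l)"
  by (induction l rule: lefts.induct) auto

lemma set_lefts_rights: "set l \<subseteq> Inl ` set (lefts l) \<union> Inr ` set (rights l)"
  by (induction l rule: lefts.induct) auto

lemma lefts_map_sum: "lefts (map (map_sum f g) l) = map f (lefts l)"
  by (induction l rule: lefts.induct) auto

lemma rights_map_sum: "rights (map (map_sum f g) l) = map g (rights l)"
  by (induction l rule: lefts.induct) auto

text \<open>A word in \<open>Inl j\<close> and \<open>Inr c\<close> records the operation with the inputs \<open>c\<close> between which,
  at each \<open>Inl j\<close>, the coefficient of \<open>x\<^sub>j\<close> in the bounding series is inserted. In these terms the insertions of a given
  monomial are compatible with splitting words, which turns the \<open>A\<^sub>\<infinity>\<close>-relations of the undeformed
  operations into those of the deformed ones.\<close>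

definition Sh :: "nat multiset \<Rightarrow> 'b list \<Rightarrow> (nat + 'b) list set"
  where "Sh e bs = {l. mset (lefts l) = e \<and> rights l = bs}"

lemma finite_Sh [simp]: "finite (Sh e bs)"
proof (rule finite_subset)
  show "Sh e bs \<subseteq> {l. set l \<subseteq> Inl ` set_mset e \<union> Inr ` set bs \<and> length l = size e + length bs}"
  proof
    fix l assume "l \<in> Sh e bs"
    then show "l \<in> {l. set l \<subseteq> Inl ` set_mset e \<union> Inr ` set bs \<and> length l = size e + length bs}"
      using set_lefts_rights[of l] length_lefts_rights[of l] by (auto simp: Sh_def)
  qed
  show "finite {l. set l \<subseteq> Inl ` set_mset e \<union> Inr ` set bs \<and> length l = size e + length bs}"
    by (rule finite_lists_length_eq) simp
qed

lemma map_sum_inj_shuffle: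
  "map (map_sum id h) l = map (map_sum id h) l' \<Longrightarrow> rights l = rights l' \<Longrightarrow> l = l'"
proof (induction l arbitrary: l')
  case (Cons x l)
  then obtain x' l'' where l': "l' = x' # l''" by (cases l') auto
  with Cons show ?case by (cases x; cases x') auto
qed simp

lemma map_sum_surj_shuffle:
  "rights l = map h bs \<Longrightarrow> \<exists>l'. rights l' = bs \<and> l = map (map_sum id h) l'"
proof (induction l arbitrary: bs rule: rights.induct)
  case 1
  then show ?case by (intro exI[of _ "[]"]) auto
next
  case (2 a l)
  from "2.prems" have "rights l = map h bs" by simp
  from "2.IH"[OF this] obtain l' where "rights l' = bs" "l = map (map_sum id h) l'" by blast
  then show ?case by (intro exI[of _ "Inl a # l'"]) (auto simp: id_def)
next
  case (3 c l)
  then obtain b bs' where bs: "bs = b # bs'" "c = h b" "rights l = map h bs'" by (cases bs) auto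
  from "3.IH"[OF bs(3)] obtain l' where "rights l' = bs'" "l = map (map_sum id h) l'" by blast
  with bs show ?case by (intro exI[of _ "Inr b # l'"]) (auto simp: id_def)
qed

lemma sum_Sh_map: "(\<Sum>l\<in>Sh e (map h bs). G l) = (\<Sum>l\<in>Sh e bs. G (map (map_sum id h) l))"
proof -
  have "inj_on (map (map_sum id h)) (Sh e bs)"
    by (rule inj_onI) (auto simp: Sh_def intro: map_sum_inj_shuffle)
  moreover have "Sh e (map h bs) = map (map_sum id h) ` Sh e bs"
    using map_sum_surj_shuffle
    by (fastforce simp: Sh_def lefts_map_sum rights_map_sum image_iff)
  ultimately show ?thesis by (simp add: sum.reindex)
qed

text \<open>With \<alpha> the coefficients of the bounding series, this is the coefficient of the
  monomial \<open>e\<close> in the deformed operation on the constant inputs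
  \<open>as\<close>.\<close>

definition shuffle_sum :: "(nat \<Rightarrow> 'x) \<Rightarrow> ('x list \<Rightarrow> 'x) \<Rightarrow> nat multiset \<Rightarrow> 'x list \<Rightarrow> 'x::comm_monoid_add"
  where "shuffle_sum \<alpha> m e as = (\<Sum>l\<in>Sh e as. m (map (case_sum \<alpha> id) l))"

lemma shuffle_sum_map:
  "shuffle_sum \<alpha> m e (map h bs) = (\<Sum>l\<in>Sh e bs. m (map (case_sum \<alpha> h) l))"
proof -
  have "case_sum \<alpha> id (map_sum id h x) = case_sum \<alpha> h x" for x by (cases x) auto
  then show ?thesis by (simp add: shuffle_sum_def sum_Sh_map o_def)
qed

lemma finite_splittings3 [simp]: "finite {(e1, e2, e3). e1 + e2 + e3 = (e :: 'a multiset)}"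
proof (rule finite_subset)
  let ?D = "{e'. e' \<subseteq># e}"
  have "?D \<subseteq> fst ` {(p, q). p + q = e}"
    by (force simp: subset_mset.le_iff_add)
  then have "finite ?D" by (rule finite_subset) simp
  then show "finite (?D \<times> ?D \<times> ?D)" by simp
  show "{(e1, e2, e3). e1 + e2 + e3 = e} \<subseteq> ?D \<times> ?D \<times> ?D"
  proof
    fix z assume "z \<in> {(e1, e2, e3). e1 + e2 + e3 = e}"
    then obtain e1 e2 e3 where z: "z = (e1, e2, e3)" "e = e1 + e2 + e3" by auto
    then have "e = e1 + (e2 + e3)" "e = e2 + (e1 + e3)" "e = e3 + (e1 + e2)"
      by (simp_all add: union_ac)
    then have "e1 \<subseteq># e" "e2 \<subseteq># e" "e3 \<subseteq># e"
      unfolding subset_mset.le_iff_add by blast+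
    then show "z \<in> ?D \<times> ?D \<times> ?D" by (simp add: z(1))
  qed
qed

lemma finite_append3 [simp]: "finite {(p, q, r). p @ q @ r = l}"
proof (rule finite_subset)
  let ?D = "{l'. set l' \<subseteq> set l \<and> length l' \<le> length l}"
  show "finite (?D \<times> ?D \<times> ?D)"
    by (intro finite_cartesian_product finite_lists_length_le) auto
qed auto

text \<open>Cutting a word in three amounts to cutting its input letters in three and distributing
  the inserted letters over the pieces. It separates the inner operation of an A-infinity term from
  the outer one.\<close>

lemma sum_Sh_split3:
  "(\<Sum>l\<in>Sh e bs. \<Sum>(p, q, r) | p @ q @ r = l. H p q r) =
   (\<Sum>(b1, b2, b3) | b1 @ b2 @ b3 = bs. \<Sum>(e1, e2, e3) | e1 + e2 + e3 = e.
      \<Sum>p\<in>Sh e1 b1. \<Sum>q\<in>Sh e2 b2. \<Sum>r\<in>Sh e3 b3. H p q r)"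
proof -
  have "(\<Sum>l\<in>Sh e bs. \<Sum>(p, q, r) | p @ q @ r = l. H p q r) =
      (\<Sum>(l, p, q, r) \<in> (SIGMA l:Sh e bs. {(p, q, r). p @ q @ r = l}). H p q r)"
    by (subst sum.Sigma[symmetric]) auto
  also have "\<dots> = (\<Sum>(b, e', p, q, r) \<in> (SIGMA b:{(b1, b2, b3). b1 @ b2 @ b3 = bs}.
      SIGMA e':{(e1, e2, e3). e1 + e2 + e3 = e}.
        Sh (fst e') (fst b) \<times> Sh (fst (snd e')) (fst (snd b)) \<times> Sh (snd (snd e')) (snd (snd b))). H p q r)"
    by (rule sum.reindex_bij_witness[of _ "\<lambda>(b, e', p, q, r). (p @ q @ r, p, q, r)"
        "\<lambda>(l, p, q, r). ((rights p, rights q, rights r),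
          (mset (lefts p), mset (lefts q), mset (lefts r)), p, q, r)"])
      (auto simp: Sh_def)
  also have "\<dots> = (\<Sum>(b1, b2, b3) | b1 @ b2 @ b3 = bs. \<Sum>(e1, e2, e3) | e1 + e2 + e3 = e.
      \<Sum>p\<in>Sh e1 b1. \<Sum>q\<in>Sh e2 b2. \<Sum>r\<in>Sh e3 b3. H p q r)"
    by (subst sum.Sigma[symmetric]; (subst sum.Sigma[symmetric])?)
      (auto simp: sum.cartesian_product case_prod_beta sum.Sigma[symmetric] intro!: sum.cong)
  finally show ?thesis .
qed

lemma shuffle_insert_inj:
  "p @ Inr c # r = p' @ Inr c # r' \<Longrightarrow> rights p = rights p' \<Longrightarrow> p = p' \<and> r = r'"
proof (induction p arbitrary: p')
  case Nil
  then show ?case by (cases p') auto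
next
  case (Cons x p)
  then obtain x' p'' where p': "p' = x' # p''" by (cases p'; cases x) auto
  with Cons show ?case by (cases x; cases x') auto
qed

lemma shuffle_insert_surj:
  "rights l = b1 @ c # b3 \<Longrightarrow> \<exists>p r. l = p @ Inr c # r \<and> rights p = b1 \<and> rights r = b3"
proof (induction l arbitrary: b1 rule: rights.induct)
  case (2 a l)
  then obtain p r where "l = p @ Inr c # r" "rights p = b1" "rights r = b3" by fastforce
  then show ?case by (intro exI[of _ "Inl a # p"] exI[of _ r]) auto
next
  case (3 c' l)
  show ?case
  proof (cases b1)
    case Nil
    with 3 show ?thesis by (intro exI[of _ "[]"] exI[of _ l]) auto
  next
    case (Cons b b1')
    with 3 obtain p r where "l = p @ Inr c # r" "rights p = b1'" "rights r = b3" by fastforce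
    with Cons 3 show ?thesis by (intro exI[of _ "Inr c' # p"] exI[of _ r]) auto
  qed
qed simp

text \<open>The marked letter has a definite place among the inputs, so a word is determined by its
  parts before and after that letter.\<close>

lemma sum_Sh_insert:
  "(\<Sum>l\<in>Sh e (b1 @ c # b3). G l) =
   (\<Sum>(e1, e3) | e1 + e3 = e. \<Sum>p\<in>Sh e1 b1. \<Sum>r\<in>Sh e3 b3. G (p @ Inr c # r))"
proof -
  let ?D = "SIGMA z:{(e1, e3). e1 + e3 = e}. Sh (fst z) b1 \<times> Sh (snd z) b3"
  let ?f = "\<lambda>(z :: nat multiset \<times> nat multiset, p, r). p @ Inr c # r"
  have inj: "inj_on ?f ?D"
    by (rule inj_onI) (auto simp: Sh_def dest!: shuffle_insert_inj)
  have eq: "Sh e (b1 @ c # b3) = ?f ` ?D"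
  proof (intro equalityI subsetI)
    fix l assume l: "l \<in> Sh e (b1 @ c # b3)"
    then obtain p r where pr: "l = p @ Inr c # r" "rights p = b1" "rights r = b3"
      using shuffle_insert_surj[of l b1 c b3] by (auto simp: Sh_def)
    with l have "((mset (lefts p), mset (lefts r)), p, r) \<in> ?D" by (auto simp: Sh_def)
    then show "l \<in> ?f ` ?D" by (rule rev_image_eqI) (simp add: pr)
  qed (auto simp: Sh_def)
  have "(\<Sum>l\<in>Sh e (b1 @ c # b3). G l) = sum (G \<circ> ?f) ?D"
    unfolding eq by (rule sum.reindex[OF inj])
  also have "\<dots> = (\<Sum>(z, p, r)\<in>?D. G (p @ Inr c # r))"
    by (simp add: case_prod_beta o_def)
  also have "\<dots> = (\<Sum>z \<in> {(e1, e3). e1 + e3 = e}. \<Sum>(p, r) \<in> Sh (fst z) b1 \<times> Sh (snd z) b3. G (p @ Inr c # r))"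
    by (subst sum.Sigma[symmetric]) (auto simp: case_prod_beta)
  finally show ?thesis by (simp add: case_prod_beta sum.cartesian_product)
qed

locale additive_ops =
  fixes m :: "'x::ab_group_add list \<Rightarrow> 'x" and \<alpha> :: "nat \<Rightarrow> 'x"
  assumes m_add: "\<And>as bs a b. m (as @ (a + b) # bs) = m (as @ a # bs) + m (as @ b # bs)"
    and m_Nil: "m [] = 0"
begin

abbreviation T :: "nat multiset \<Rightarrow> 'x list \<Rightarrow> 'x" where "T \<equiv> shuffle_sum \<alpha> m"

lemma m_zero: "m (as @ 0 # bs) = 0"
  using m_add[of as 0 0 bs] by simp

lemma m_zero_in: "0 \<in> set as \<Longrightarrow> m as = 0"
  using m_zero by (metis split_list)

lemma m_sum: "m (as @ (\<Sum>i\<in>I. f i) # bs) = (\<Sum>i\<in>I. m (as @ f i # bs))"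
  by (induction I rule: infinite_finite_induct) (auto simp: m_zero m_add)

lemma T_insert:
  "T e (as @ c # bs) = (\<Sum>(e1, e3) | e1 + e3 = e. \<Sum>p\<in>Sh e1 as. \<Sum>r\<in>Sh e3 bs.
    m (map (case_sum \<alpha> id) p @ c # map (case_sum \<alpha> id) r))"
  unfolding shuffle_sum_def sum_Sh_insert by simp

lemma T_insert_map:
  "T e (map h b1 @ c # map h b3) = (\<Sum>(e1, e3) | e1 + e3 = e. \<Sum>p\<in>Sh e1 b1. \<Sum>r\<in>Sh e3 b3.
    m (map (case_sum \<alpha> h) p @ c # map (case_sum \<alpha> h) r))"
proof -
  have "case_sum \<alpha> id (map_sum id h x) = case_sum \<alpha> h x" for x by (cases x) auto
  then show ?thesis by (simp add: T_insert sum_Sh_map o_def)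
qed

lemma T_add: "T e (as @ (a + b) # bs) = T e (as @ a # bs) + T e (as @ b # bs)"
  by (simp add: T_insert m_add sum.distrib case_prod_beta)

lemma T_zero: "T e (as @ 0 # bs) = 0"
  by (simp add: T_insert m_zero case_prod_beta)

lemma T_uminus: "T e (as @ (- a) # bs) = - T e (as @ a # bs)"
  using T_add[of e as a "- a" bs] T_zero[of e as bs] by (simp add: minus_unique)

end

lemma signed_sum_list: "signed d (\<Sum>i\<in>I. f i) = (\<Sum>i\<in>I. signed d (f i :: 'x::ab_group_add))"
  by (auto simp: signed_def sum_negf)

text \<open>In the A-infinity relations \<open>i\<close> counts the inputs to the right of the inner
  operation and \<open>j\<close> its own inputs. As \<open>j\<close> starts at 1, the empty inner
  word must be known to contribute 0.\<close>

lemma sum_take_drop: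
  fixes H :: "'a list \<Rightarrow> 'a list \<Rightarrow> 'a list \<Rightarrow> 'x::comm_monoid_add"
  assumes "\<And>p r. H p [] r = 0"
  shows "(\<Sum>i<length l. \<Sum>j=1..length l - i. H (take (length l - i - j) l)
      (take j (drop (length l - i - j) l)) (drop (length l - i) l)) =
    (\<Sum>(p, q, r) | p @ q @ r = l. H p q r)"
proof -
  let ?k = "length l"
  have "(\<Sum>i<?k. \<Sum>j=1..?k - i. H (take (?k - i - j) l) (take j (drop (?k - i - j) l)) (drop (?k - i) l)) =
      (\<Sum>(i, j) \<in> (SIGMA i:{..<?k}. {1..?k - i}).
        H (take (?k - i - j) l) (take j (drop (?k - i - j) l)) (drop (?k - i) l))"
    by (subst sum.Sigma) auto
  also have "\<dots> = (\<Sum>(p, q, r) \<in> {(p, q, r). p @ q @ r = l \<and> q \<noteq> []}. H p q r)"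
  proof (rule sum.reindex_bij_witness[of _ "\<lambda>(p, q, r). (length r, length q)"
        "\<lambda>(i, j). (take (?k - i - j) l, take j (drop (?k - i - j) l), drop (?k - i) l)"])
    fix z assume "z \<in> (SIGMA i:{..<?k}. {1..?k - i})"
    then obtain i j where z: "z = (i, j)" "i < ?k" "1 \<le> j" "j \<le> ?k - i" by auto
    have "take j (drop (?k - i - j) l) @ drop (?k - i) l = drop (?k - i - j) l"
      using z by (metis append_take_drop_id drop_drop le_add_diff_inverse2 add.commute)
    then show "(case z of (i, j) \<Rightarrow> (take (?k - i - j) l, take j (drop (?k - i - j) l), drop (?k - i) l))
        \<in> {(p, q, r). p @ q @ r = l \<and> q \<noteq> []}"
      using z by auto
    show "(case case z of (i, j) \<Rightarrow> (take (?k - i - j) l, take j (drop (?k - i - j) l), drop (?k - i) l)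
        of (p, q, r) \<Rightarrow> (length r, length q)) = z"
      using z by auto
  next
    fix z assume "z \<in> {(p, q, r). p @ q @ r = l \<and> q \<noteq> []}"
    then obtain p q r where z: "z = (p, q, r)" "l = p @ q @ r" "q \<noteq> []" by auto
    then show "(case z of (p, q, r) \<Rightarrow> (length r, length q)) \<in> (SIGMA i:{..<?k}. {1..?k - i})"
      by (auto simp: Suc_le_eq)
    show "(case case z of (p, q, r) \<Rightarrow> (length r, length q) of
        (i, j) \<Rightarrow> (take (?k - i - j) l, take j (drop (?k - i - j) l), drop (?k - i) l)) = z"
      using z by auto
  qed auto
  also have "\<dots> = (\<Sum>(p, q, r) \<in> {(p, q, r). p @ q @ r = l}. H p q r)"
    by (rule sum.mono_neutral_left) (use assms in auto)
  finally show ?thesis .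
qed

lemma append3_pair:
  "{(b1, b2, b3). b1 @ b2 @ b3 = [x, y]} =
    {([], [], [x, y]), ([x], [], [y]), ([x, y], [], []), ([], [x], [y]), ([x], [y], []), ([], [x, y], [])}"
  by (auto simp: append_eq_Cons_conv Cons_eq_append_conv)

section \<open>The deformed A-infinity relation with two inputs\<close>

locale ainf_ops = additive_ops m \<alpha> for m :: "'x::ab_group_add list \<Rightarrow> 'x" and \<alpha> +
  fixes X :: "int \<Rightarrow> 'x set"
  assumes ainf: "ainf_relations X m" and \<alpha>_part: "\<And>j. \<alpha> j \<in> X 1"
begin

lemma ainf_split:
  assumes "list_all2 (\<lambda>a d. a \<in> X d) as ds" "as \<noteq> []"
  shows "(\<Sum>(p, q, r) | p @ q @ r = as.
    signed (sum_list (drop (length as - length r) ds) - int (length r)) (m (p @ [m q] @ r))) = 0"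
proof -
  let ?H = "\<lambda>p q r. signed (sum_list (drop (length as - length r) ds) - int (length r)) (m (p @ [m q] @ r))"
  have "(\<Sum>(p, q, r) | p @ q @ r = as. ?H p q r) =
      (\<Sum>i<length as. \<Sum>j=1..length as - i. ?H (take (length as - i - j) as)
      (take j (drop (length as - i - j) as)) (drop (length as - i) as))"
    by (rule sum_take_drop[symmetric]) (simp add: m_Nil m_zero signed_simps)
  also have "\<dots> = (\<Sum>i<length as. \<Sum>j=1..length as - i. signed (sum_list (drop (length as - i) ds) - int i)
      (m (take (length as - i - j) as @ [m (take j (drop (length as - i - j) as))] @ drop (length as - i) as)))"
    by (intro sum.cong) auto
  also have "\<dots> = 0"
    using ainf assms unfolding ainf_relations_def Let_def by blast
  finally show ?thesis .
qed

text \<open>The inserted letters and \<open>b\<close> have degree 1, hence reduced degree 0; a sign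
  can only come from \<open>a\<close>, and only in the term where \<open>a\<close> stands to the
  right of the inner operation. The relation of A is summed over all shuffles of the two inputs with
  the inserted letters.\<close>

lemma ainf_pair:
  assumes a: "a \<in> X d" and b: "b \<in> X 1"
  shows "(\<Sum>(e1, e2) | e1 + e2 = e.
    signed (d - 1) (T e1 [T e2 [], a, b]) + T e1 [a, T e2 [], b] + T e1 [a, b, T e2 []] +
    T e1 [T e2 [a], b] + T e1 [a, T e2 [b]] + T e1 [T e2 [a, b]]) = 0"
proof -
  \<comment> \<open>Booleans label the two inputs by position, so that degrees can be read off from
    a shuffle even when \<open>a\<close> and \<open>b\<close> coincide.\<close>
  define h where "h x = (if x then a else b)" for x
  define deg where "deg = case_sum (\<lambda>_ :: nat. 1) (\<lambda>x. if x then d else 1 :: int)"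
  define \<sigma> where "\<sigma> bs = (\<Sum>x\<leftarrow>bs. (if x then d else 1) - 1)" for bs :: "bool list"
  let ?val = "map (case_sum \<alpha> h)"
  have deg_val: "case_sum \<alpha> h x \<in> X (deg x)" for x
    using a b \<alpha>_part by (cases x) (auto simp: h_def deg_def)
  have \<sigma>: "sum_list (map deg r) - int (length r) = \<sigma> (rights r)" for r
    by (induction r rule: rights.induct) (auto simp: deg_def \<sigma>_def)
  have rel: "(\<Sum>(p, q, r) | p @ q @ r = l. signed (\<sigma> (rights r)) (m (?val p @ [m (?val q)] @ ?val r))) = 0"
    if "l \<noteq> []" for l
  proof -
    let ?G = "\<lambda>p q r. signed (sum_list (drop (length l - length r) (map deg l)) - int (length r))
      (m (p @ [m q] @ r))"
    have "list_all2 (\<lambda>a d. a \<in> X d) (?val l) (map deg l)"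
      using deg_val by (simp add: list_all2_conv_all_nth)
    then have "(\<Sum>(p, q, r) | p @ q @ r = ?val l. ?G p q r) = 0"
      using ainf_split[of "?val l" "map deg l"] that by simp
    also have "(\<Sum>(p, q, r) | p @ q @ r = ?val l. ?G p q r) =
        (\<Sum>(p, q, r) | p @ q @ r = l. signed (\<sigma> (rights r)) (m (?val p @ [m (?val q)] @ ?val r)))"
    proof (rule sum.reindex_bij_witness[of _ "\<lambda>(p, q, r). (?val p, ?val q, ?val r)"
          "\<lambda>(p, q, r). (take (length p) l, take (length q) (drop (length p) l), drop (length p + length q) l)"])
      fix z assume "z \<in> {(p, q, r). p @ q @ r = ?val l}"
      then obtain p q r where z: "z = (p, q, r)" "?val l = p @ q @ r" by auto
      then have len: "length l = length p + length q + length r"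
        by (metis length_append length_map add.assoc)
      have v: "?val (take (length p) l) = p" "?val (take (length q) (drop (length p) l)) = q"
        "?val (drop (length p + length q) l) = r"
        by (simp_all add: take_map[symmetric] drop_map[symmetric] z(2))
      show "(case case z of (p, q, r) \<Rightarrow>
          (take (length p) l, take (length q) (drop (length p) l), drop (length p + length q) l)
          of (p, q, r) \<Rightarrow> (?val p, ?val q, ?val r)) = z"
        using v by (simp add: z(1))
      show "(case z of (p, q, r) \<Rightarrow>
          (take (length p) l, take (length q) (drop (length p) l), drop (length p + length q) l))
          \<in> {(p, q, r). p @ q @ r = l}"
        using append_take_drop_id[of "length q" "drop (length p) l"] append_take_drop_id[of "length p" l]
        by (simp add: z(1) add.commute)
      have "drop (length l - length r) (map deg l) = map deg (drop (length p + length q) l)"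
        by (simp add: len drop_map)
      moreover have "length (drop (length p + length q) l) = length r" by (simp add: len)
      ultimately show "(case case z of (p, q, r) \<Rightarrow>
          (take (length p) l, take (length q) (drop (length p) l), drop (length p + length q) l)
          of (p, q, r) \<Rightarrow> signed (\<sigma> (rights r)) (m (?val p @ [m (?val q)] @ ?val r))) =
          (case z of (p, q, r) \<Rightarrow> ?G p q r)"
        using v \<sigma>[of "drop (length p + length q) l"] by (simp add: z(1))
    next
      fix z assume "z \<in> {(p, q, r). p @ q @ r = l}"
      then show "(case z of (p, q, r) \<Rightarrow> (?val p, ?val q, ?val r)) \<in> {(p, q, r). p @ q @ r = ?val l}"
        by auto
    qed auto
    finally show ?thesis .
  qed
  have "0 = (\<Sum>l\<in>Sh e [True, False]. \<Sum>(p, q, r) | p @ q @ r = l.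
      signed (\<sigma> (rights r)) (m (?val p @ [m (?val q)] @ ?val r)))"
  proof (rule sum.neutral[symmetric], rule ballI)
    fix l assume "l \<in> Sh e [True, False]"
    then have "l \<noteq> []" by (auto simp: Sh_def)
    then show "(\<Sum>(p, q, r) | p @ q @ r = l. signed (\<sigma> (rights r)) (m (?val p @ [m (?val q)] @ ?val r))) = 0"
      by (rule rel)
  qed
  also have "\<dots> = (\<Sum>(b1, b2, b3) | b1 @ b2 @ b3 = [True, False]. \<Sum>(e1, e2, e3) | e1 + e2 + e3 = e.
      \<Sum>p\<in>Sh e1 b1. \<Sum>q\<in>Sh e2 b2. \<Sum>r\<in>Sh e3 b3. signed (\<sigma> (rights r)) (m (?val p @ [m (?val q)] @ ?val r)))"
    by (rule sum_Sh_split3)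
  also have "\<dots> = (\<Sum>(b1, b2, b3) | b1 @ b2 @ b3 = [True, False]. \<Sum>(e', e2) | e' + e2 = e.
      signed (\<sigma> b3) (T e' (map h b1 @ T e2 (map h b2) # map h b3)))"
  proof (rule sum.cong[OF refl], clarify)
    fix b1 b2 b3 :: "bool list"
    have "(\<Sum>(e1, e2, e3) | e1 + e2 + e3 = e. \<Sum>p\<in>Sh e1 b1. \<Sum>q\<in>Sh e2 b2. \<Sum>r\<in>Sh e3 b3.
        signed (\<sigma> (rights r)) (m (?val p @ [m (?val q)] @ ?val r))) =
      (\<Sum>(e1, e2, e3) | e1 + e2 + e3 = e. \<Sum>p\<in>Sh e1 b1. \<Sum>r\<in>Sh e3 b3.
        signed (\<sigma> b3) (m (?val p @ T e2 (map h b2) # ?val r)))"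
    proof (rule sum.cong[OF refl], clarify, rule sum.cong[OF refl])
      fix e1 e2 e3 p
      have "(\<Sum>q\<in>Sh e2 b2. \<Sum>r\<in>Sh e3 b3. signed (\<sigma> (rights r)) (m (?val p @ [m (?val q)] @ ?val r))) =
          (\<Sum>r\<in>Sh e3 b3. \<Sum>q\<in>Sh e2 b2. signed (\<sigma> b3) (m (?val p @ m (?val q) # ?val r)))"
        by (subst sum.swap) (simp add: Sh_def)
      also have "\<dots> = (\<Sum>r\<in>Sh e3 b3. signed (\<sigma> b3) (m (?val p @ T e2 (map h b2) # ?val r)))"
        by (simp add: shuffle_sum_map m_sum signed_sum_list)
      finally show "(\<Sum>q\<in>Sh e2 b2. \<Sum>r\<in>Sh e3 b3. signed (\<sigma> (rights r)) (m (?val p @ [m (?val q)] @ ?val r))) =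
          (\<Sum>r\<in>Sh e3 b3. signed (\<sigma> b3) (m (?val p @ T e2 (map h b2) # ?val r)))" .
    qed
    also have "\<dots> = (\<Sum>(e', e2) | e' + e2 = e. \<Sum>(e1, e3) | e1 + e3 = e'. \<Sum>p\<in>Sh e1 b1. \<Sum>r\<in>Sh e3 b3.
        signed (\<sigma> b3) (m (?val p @ T e2 (map h b2) # ?val r)))"
    proof -
      let ?G = "\<lambda>e1 e2 e3. \<Sum>p\<in>Sh e1 b1. \<Sum>r\<in>Sh e3 b3.
        signed (\<sigma> b3) (m (?val p @ T e2 (map h b2) # ?val r))"
      have "(\<Sum>(e1, e2, e3) | e1 + e2 + e3 = e. ?G e1 e2 e3) =
          (\<Sum>(z, w) \<in> (SIGMA z:{(e', e2). e' + e2 = e}. {(e1, e3). e1 + e3 = fst z}). ?G (fst w) (snd z) (snd w))"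
        by (rule sum.reindex_bij_witness[of _ "\<lambda>(z, w). (fst w, snd z, snd w)"
              "\<lambda>(e1, e2, e3). ((e1 + e3, e2), (e1, e3))"]) (auto simp: union_ac)
      also have "\<dots> = (\<Sum>(e', e2) | e' + e2 = e. \<Sum>(e1, e3) | e1 + e3 = e'. ?G e1 e2 e3)"
        by (subst sum.Sigma[symmetric]) (auto simp: case_prod_beta)
      finally show ?thesis .
    qed
    also have "\<dots> = (\<Sum>(e', e2) | e' + e2 = e. signed (\<sigma> b3) (T e' (map h b1 @ T e2 (map h b2) # map h b3)))"
      by (simp add: T_insert_map signed_sum_list case_prod_beta)
    finally show "(\<Sum>(e1, e2, e3) | e1 + e2 + e3 = e. \<Sum>p\<in>Sh e1 b1. \<Sum>q\<in>Sh e2 b2. \<Sum>r\<in>Sh e3 b3.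
        signed (\<sigma> (rights r)) (m (?val p @ [m (?val q)] @ ?val r))) =
      (\<Sum>(e', e2) | e' + e2 = e. signed (\<sigma> b3) (T e' (map h b1 @ T e2 (map h b2) # map h b3)))" .
  qed
  also have "\<dots> = (\<Sum>(e1, e2) | e1 + e2 = e.
    signed (d - 1) (T e1 [T e2 [], a, b]) + T e1 [a, T e2 [], b] + T e1 [a, b, T e2 []] +
    T e1 [T e2 [a], b] + T e1 [a, T e2 [b]] + T e1 [T e2 [a, b]])"
  proof -
    have s0: "signed 0 x = x" for x :: 'x by (simp add: signed_def)
    show ?thesis unfolding append3_pair
      by (simp add: h_def \<sigma>_def s0 case_prod_beta sum.distrib add.assoc)
  qed
  finally show ?thesis by simp
qed

end

text \<open>In the expansion of \<open>bounded_ops\<close>, the exponents \<open>i\<^sub>k, \<dots>, i\<^sub>0\<close> are the \<open>gaps\<close> of the word, and a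
  letter \<open>Inr (f, e)\<close> stands for the coefficient of the monomial \<open>e\<close> in the input \<open>f\<close>.\<close>

fun gaps :: "('a + 'b) list \<Rightarrow> nat list" where
  "gaps [] = [0]"
| "gaps (Inl a # l) = Suc (hd (gaps l)) # tl (gaps l)"
| "gaps (Inr c # l) = 0 # gaps l"

abbreviation total :: "nat + 'b \<times> nat multiset \<Rightarrow> nat multiset"
  where "total \<equiv> case_sum (\<lambda>j. {#j#}) snd"

lemma gaps_not_Nil: "gaps l \<noteq> []"
  by (cases l rule: gaps.cases) auto

lemma length_gaps: "length (gaps l) = length (rights l) + 1"
proof (induction l rule: gaps.induct)
  case (2 a l)
  then show ?case using gaps_not_Nil[of l] by (cases "gaps l") auto
qed auto

lemma sum_list_gaps: "sum_list (gaps l) = length (lefts l)"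
proof (induction l rule: gaps.induct)
  case (2 a l)
  then show ?case using gaps_not_Nil[of l] by (cases "gaps l") auto
qed auto

lemma sum_list_total:
  "sum_list (map total l) = mset (lefts l) + sum_list (map snd (rights l))"
  by (induction l rule: lefts.induct) (auto simp: union_ac)

lemma weave_Suc: "weave b (Suc i # is) fs = b # weave b (i # is) fs"
  by (cases fs) auto

lemma weave_gaps: "weave b (gaps l) (map fst (rights l)) = map (case_sum (\<lambda>_. b) fst) l"
proof (induction l rule: gaps.induct)
  case (2 a l)
  have "weave b (gaps (Inl a # l)) (map fst (rights l)) = b # weave b (gaps l) (map fst (rights l))"
    using gaps_not_Nil[of l] by (cases "gaps l") (auto simp: weave_Suc)
  with 2 show ?case by simp
qed auto

lemma gaps_inj:
  "gaps l = gaps l' \<Longrightarrow> map total l = map total l' \<Longrightarrow> map fst (rights l) = map fst (rights l') \<Longrightarrow> l = l'"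
proof (induction l arbitrary: l' rule: gaps.induct)
  case (2 a l)
  then obtain x l'' where l': "l' = x # l''" by (cases l') auto
  from 2 l' obtain a' where x: "x = Inl a'" by (cases x) auto
  from 2 l' x have "gaps l = gaps l''"
    using gaps_not_Nil[of l] gaps_not_Nil[of l''] by (cases "gaps l"; cases "gaps l''") auto
  with 2 l' x show ?case by auto
next
  case (3 c l)
  then obtain x l'' where l': "l' = x # l''" by (cases l') auto
  from 3 l' obtain c' where x: "x = Inr c'" by (cases x) auto
  with 3 l' show ?case by (auto simp: prod_eq_iff)
qed auto

lemma finite_submultisets [simp]: "finite {e'. e' \<subseteq># (e :: 'a multiset)}"
proof -
  have "{e'. e' \<subseteq># e} \<subseteq> fst ` {(p, q). p + q = e}"
    by (force simp: subset_mset.le_iff_add)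
  then show ?thesis by (rule finite_subset) simp
qed

lemma in_sum_list_subset: "x \<in> set es \<Longrightarrow> x \<subseteq># sum_list es" for es :: "'a multiset list"
  by (induction es) (auto simp: subset_mset.add_increasing subset_mset.add_increasing2)

lemma finite_multiset_lists: "finite {es. length es = k \<and> sum_list es \<subseteq># (e :: 'a multiset)}"
proof (rule finite_subset)
  show "{es. length es = k \<and> sum_list es \<subseteq># e} \<subseteq> {es. set es \<subseteq> {e'. e' \<subseteq># e} \<and> length es = k}"
    using in_sum_list_subset subset_mset.order_trans by blast
  show "finite {es. set es \<subseteq> {e'. e' \<subseteq># e} \<and> length es = k}"
    by (rule finite_lists_length_eq) simp
qed

lemma finite_nat_lists: "finite {is. length is = k \<and> sum_list is \<le> (N :: nat)}"
proof (rule finite_subset)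
  show "{is. length is = k \<and> sum_list is \<le> N} \<subseteq> {is. set is \<subseteq> {..N} \<and> length is = k}"
    using member_le_sum_list order_trans by fastforce
  show "finite {is. set is \<subseteq> {..N} \<and> length is = k}"
    by (rule finite_lists_length_eq) simp
qed

lemma coeff_extend_ops:
  "coeff (extend_ops m fs) e = (\<Sum>es | length es = length fs \<and> sum_list es = e. m (map2 coeff fs es))"
  by (simp add: extend_ops_def)

lemma extend_ops_cong:
  assumes "fs \<noteq> []" "\<And>as. as \<noteq> [] \<Longrightarrow> m as = m' as"
  shows "extend_ops m fs = extend_ops m' fs"
proof (rule series_eqI)
  fix e
  have "m (map2 coeff fs es) = m' (map2 coeff fs es)" if "length es = length fs" for es
    using assms that by (cases fs; cases es) auto
  then show "coeff (extend_ops m fs) e = coeff (extend_ops m' fs) e"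
    unfolding coeff_extend_ops by (intro sum.cong) auto
qed

lemma bounded_ops_cong:
  assumes "fs \<noteq> []" "\<And>as. as \<noteq> [] \<Longrightarrow> m as = m' as"
  shows "bounded_ops m b fs = bounded_ops m' b fs"
proof -
  have "extend_ops m (weave b is fs) = extend_ops m' (weave b is fs)" for "is"
    using assms(1) by (intro extend_ops_cong assms(2), cases fs; cases "is") auto
  then show ?thesis by (simp add: bounded_ops_def)
qed

lemma card_append_Cons:
  "finite {(p, r). p @ x # r = l} \<and> card {(p, r). p @ x # r = l} = count (mset l) x"
proof (induction l)
  case (Cons y l)
  have eq: "{(p, r). p @ x # r = y # l} =
      (if x = y then {([], l)} else {}) \<union> (\<lambda>(p, r). (y # p, r)) ` {(p, r). p @ x # r = l}"
    by (auto simp: append_eq_Cons_conv image_iff)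
  have inj: "inj_on (\<lambda>(p, r). (y # p, r)) {(p, r). p @ x # r = l}"
    by (rule inj_onI) auto
  have "([], l) \<notin> (\<lambda>(p, r). (y # p, r)) ` {(p, r). p @ x # r = l}" by auto
  moreover have "finite ((\<lambda>(p, r). (y # p, r)) ` {(p, r). p @ x # r = l})"
    by (rule finite_imageI[OF conjunct1[OF Cons.IH]])
  moreover have "card ((\<lambda>(p, r). (y # p, r)) ` {(p, r). p @ x # r = l}) = count (mset l) x"
    unfolding card_image[OF inj] by (rule conjunct2[OF Cons.IH])
  ultimately show ?case unfolding eq by auto
qed simp

lemma sum_const_card: "finite S \<Longrightarrow> (\<Sum>x\<in>S. c) = (\<Sum>i<card S. c)" for c :: "'x::comm_monoid_add"
  by (induction S rule: finite_induct) (auto simp: add.commute)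

section \<open>Coefficients of the deformed operations\<close>

locale bounded_additive_ops = additive_ops m \<alpha> for m :: "'x::ab_group_add list \<Rightarrow> 'x" and \<alpha> +
  fixes b :: "'x series"
  assumes b_single: "\<And>j. coeff b {#j#} = \<alpha> j"
    and b_other: "\<And>e. (\<And>j. e \<noteq> {#j#}) \<Longrightarrow> coeff b e = 0"
begin

abbreviation letter_value :: "nat + 'x series \<times> nat multiset \<Rightarrow> 'x"
  where "letter_value \<equiv> case_sum \<alpha> (\<lambda>(f, e). coeff f e)"

lemma map2_gaps:
  "map2 coeff (weave b (gaps l) (map fst (rights l))) (map total l) = map letter_value l"
proof -
  have "map2 coeff (map (case_sum (\<lambda>_. b) fst) l) (map total l) = map letter_value l"
    by (induction l rule: lefts.induct) (auto simp: b_single)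
  then show ?thesis by (simp add: weave_gaps)
qed

text \<open>A coefficient of \<open>b\<close> outside degree 1 is 0. So a term of the expansion
  either has a zero input or takes a single variable from each copy of \<open>b\<close>, and is then
  encoded by a word.\<close>

lemma weave_exhaust:
  "length is = length fs + 1 \<Longrightarrow> length es = length (weave b is fs) \<Longrightarrow>
    0 \<in> set (map2 coeff (weave b is fs) es) \<or>
    (\<exists>l. gaps l = is \<and> map total l = es \<and> map fst (rights l) = fs)"
proof (induction es arbitrary: "is" fs)
  case Nil
  then obtain i "is'" where "is": "is = i # is'" by (cases "is") auto
  with Nil have "fs = []" "i = 0" "is' = []" by (cases fs; auto)+
  with "is" show ?case by (intro disjI2 exI[of _ "[]"]) auto
next
  case (Cons e1 es)
  then obtain i "is'" where "is": "is = i # is'" by (cases "is") auto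
  show ?case
  proof (cases i)
    case 0
    with Cons.prems "is" obtain f fs' where fs: "fs = f # fs'" by (cases fs) auto
    have "0 \<in> set (map2 coeff (weave b is' fs') es) \<or>
        (\<exists>l. gaps l = is' \<and> map total l = es \<and> map fst (rights l) = fs')"
      using Cons.prems "is" 0 fs by (intro Cons.IH) auto
    then show ?thesis
    proof
      assume "\<exists>l. gaps l = is' \<and> map total l = es \<and> map fst (rights l) = fs'"
      then obtain l where "gaps l = is'" "map total l = es" "map fst (rights l) = fs'" by blast
      then have "gaps (Inr (f, e1) # l) = is \<and> map total (Inr (f, e1) # l) = e1 # es \<and>
          map fst (rights (Inr (f, e1) # l)) = fs"
        using "is" 0 fs by simp
      then show ?thesis by (rule disjI2[OF exI])
    qed (use "is" 0 fs in auto)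
  next
    case (Suc i')
    have w: "weave b is fs = b # weave b (i' # is') fs" using "is" Suc by (simp add: weave_Suc)
    have "0 \<in> set (map2 coeff (weave b (i' # is') fs) es) \<or>
        (\<exists>l. gaps l = i' # is' \<and> map total l = es \<and> map fst (rights l) = fs)"
      using Cons.prems "is" w by (intro Cons.IH) auto
    then show ?thesis
    proof
      assume "\<exists>l. gaps l = i' # is' \<and> map total l = es \<and> map fst (rights l) = fs"
      then obtain l where l: "gaps l = i' # is'" "map total l = es" "map fst (rights l) = fs" by blast
      show ?thesis
      proof (cases "\<exists>j. e1 = {#j#}")
        case True
        then obtain j where "e1 = {#j#}" by blast
        with l have "gaps (Inl j # l) = is \<and> map total (Inl j # l) = e1 # es \<and>
            map fst (rights (Inl j # l)) = fs"
          using "is" Suc by simp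
        then show ?thesis by (rule disjI2[OF exI])
      next
        case False
        then show ?thesis using b_other[of e1] w by simp
      qed
    qed (use w in auto)
  qed
qed

text \<open>The terms without a zero forced by \<open>b\<close> correspond to words through
  \<open>gaps\<close> and \<open>total\<close>; the words are then grouped by the monomials taken
  from the inputs. The bound on the exponents loses no word, because each inserted letter uses up
  one degree of \<open>e\<close>.\<close>

lemma coeff_bounded_ops:
  "coeff (bounded_ops m b fs) e =
    (\<Sum>(e0, es) | length es = length fs \<and> e0 + sum_list es = e. T e0 (map2 coeff fs es))"
proof -
  let ?A = "{is. length is = length fs + 1 \<and> sum_list is \<le> size e}"
  let ?B = "\<lambda>is. {es. length es = length (weave b is fs) \<and> sum_list es = e}"
  let ?L = "{l. map fst (rights l) = fs \<and> sum_list (map total l) = e}"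
  let ?h = "\<lambda>l :: (nat + 'x series \<times> nat multiset) list. (gaps l, map total l)"
  let ?G = "\<lambda>(is, es). m (map2 coeff (weave b is fs) es)"
  let ?D = "{(e0, es). length es = length fs \<and> e0 + sum_list es = e}"
  have finB: "finite (?B is)" for "is"
    by (rule finite_subset[OF _ finite_multiset_lists[of "length (weave b is fs)" e]]) auto
  have "coeff (bounded_ops m b fs) e = (\<Sum>is\<in>?A. \<Sum>es\<in>?B is. m (map2 coeff (weave b is fs) es))"
    by (simp add: bounded_ops_def coeff_extend_ops)
  also have "\<dots> = sum ?G (Sigma ?A ?B)"
    using finite_nat_lists finB by (subst sum.Sigma) auto
  also have "\<dots> = sum ?G (?h ` ?L)"
  proof (rule sum.mono_neutral_right)
    show "finite (Sigma ?A ?B)" using finite_nat_lists finB by (intro finite_SigmaI) auto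
    show "?h ` ?L \<subseteq> Sigma ?A ?B"
    proof clarify
      fix l assume l: "fs = map fst (rights l)" "e = sum_list (map total l)"
      have "length (weave b (gaps l) (map fst (rights l))) = length l" by (simp add: weave_gaps)
      moreover have "length (lefts l) \<le> size (sum_list (map total l))"
        by (simp add: sum_list_total)
      ultimately show "gaps l \<in> {is. length is = length (map fst (rights l)) + 1 \<and>
            sum_list is \<le> size (sum_list (map total l))} \<and>
          map total l \<in> {es. length es = length (weave b (gaps l) (map fst (rights l))) \<and>
            sum_list es = sum_list (map total l)}"
        by (simp add: length_gaps sum_list_gaps)
    qed
    show "\<forall>z\<in>Sigma ?A ?B - ?h ` ?L. ?G z = 0"
    proof
      fix z assume z: "z \<in> Sigma ?A ?B - ?h ` ?L"
      then obtain "is" es where ies: "z = (is, es)" "length is = length fs + 1"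
        "length es = length (weave b is fs)" "sum_list es = e" by auto
      have "\<not> (\<exists>l. gaps l = is \<and> map total l = es \<and> map fst (rights l) = fs)"
      proof
        assume "\<exists>l. gaps l = is \<and> map total l = es \<and> map fst (rights l) = fs"
        then obtain l where l: "gaps l = is" "map total l = es" "map fst (rights l) = fs" by blast
        then have "l \<in> ?L" using ies by simp
        then have "?h l \<in> ?h ` ?L" by (rule imageI)
        with z ies l show False by simp
      qed
      then have "0 \<in> set (map2 coeff (weave b is fs) es)" using weave_exhaust[OF ies(2,3)] by blast
      then show "?G z = 0" using m_zero_in by (simp add: ies(1))
    qed
  qed
  also have "\<dots> = sum (?G \<circ> ?h) ?L"
  proof (rule sum.reindex, rule inj_onI)
    fix l l' assume "l \<in> ?L" "l' \<in> ?L" "?h l = ?h l'"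
    then have "gaps l = gaps l'" "map total l = map total l'"
      "map fst (rights l) = map fst (rights l')" by simp_all
    then show "l = l'" by (rule gaps_inj)
  qed
  also have "\<dots> = (\<Sum>l\<in>?L. m (map letter_value l))"
  proof (rule sum.cong[OF refl])
    fix l assume "l \<in> ?L"
    then have "fs = map fst (rights l)" by simp
    then show "(?G \<circ> ?h) l = m (map letter_value l)" using map2_gaps[of l] by simp
  qed
  also have "\<dots> = (\<Sum>(d, l)\<in>(SIGMA d:?D. Sh (fst d) (zip fs (snd d))). m (map letter_value l))"
  proof (rule sum.reindex_bij_witness[of _ snd "\<lambda>l. ((mset (lefts l), map snd (rights l)), l)"])
    fix l assume "l \<in> ?L"
    then have "fs = map fst (rights l)" "e = mset (lefts l) + sum_list (map snd (rights l))"
      by (auto simp: sum_list_total)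
    then show "((mset (lefts l), map snd (rights l)), l) \<in> (SIGMA d:?D. Sh (fst d) (zip fs (snd d)))"
      by (simp add: Sh_def zip_map_fst_snd)
  next
    fix z assume "z \<in> (SIGMA d:?D. Sh (fst d) (zip fs (snd d)))"
    then obtain e0 es l where z: "z = ((e0, es), l)" "length es = length fs" "e0 + sum_list es = e"
      "mset (lefts l) = e0" "rights l = zip fs es" by (auto simp: Sh_def)
    then show "((mset (lefts (snd z)), map snd (rights (snd z))), snd z) = z"
      by simp
    show "snd z \<in> ?L" using z by (simp add: sum_list_total)
  qed auto
  also have "\<dots> = (\<Sum>d\<in>?D. \<Sum>l\<in>Sh (fst d) (zip fs (snd d)). m (map letter_value l))"
  proof (subst sum.Sigma)
    show "finite ?D"
    proof (rule finite_subset)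
      show "?D \<subseteq> {e'. e' \<subseteq># e} \<times> {es. length es = length fs \<and> sum_list es \<subseteq># e}"
        by auto
    qed (simp add: finite_multiset_lists)
  qed auto
  also have "\<dots> = (\<Sum>(e0, es)\<in>?D. T e0 (map2 coeff fs es))"
    by (rule sum.cong[OF refl]) (auto simp: shuffle_sum_map)
  finally show ?thesis .
qed

lemma coeff_bounded_ops_0: "coeff (bounded_ops m b []) e = T e []"
proof -
  have "{(e0, es :: nat multiset list). length es = length ([] :: 'x series list) \<and> e0 + sum_list es = e} = {(e, [])}"
    by auto
  then show ?thesis by (simp add: coeff_bounded_ops del: length_0_conv)
qed

lemma coeff_bounded_ops_1:
  "coeff (bounded_ops m b [f]) e = (\<Sum>(e0, e1) | e0 + e1 = e. T e0 [coeff f e1])"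
  unfolding coeff_bounded_ops
  by (rule sum.reindex_bij_witness[of _ "\<lambda>(e0, e1). (e0, [e1])" "\<lambda>(e0, es). (e0, hd es)"])
    (auto simp: length_Suc_conv)

lemma coeff_bounded_ops_2:
  "coeff (bounded_ops m b [f, sconst c]) e = (\<Sum>(e0, e1) | e0 + e1 = e. T e0 [coeff f e1, c])"
proof -
  have "(\<Sum>(e0, es) | length es = length [f, sconst c] \<and> e0 + sum_list es = e.
        T e0 (map2 coeff [f, sconst c] es)) =
      (\<Sum>(e0, e1, e2) | e0 + e1 + e2 = e. T e0 [coeff f e1, coeff (sconst c) e2])"
    by (rule sum.reindex_bij_witness[of _ "\<lambda>(e0, e1, e2). (e0, [e1, e2])"
          "\<lambda>(e0, es). (e0, es ! 0, es ! 1)"])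
      (auto simp: length_Suc_conv numeral_2_eq_2 add.assoc)
  also have "\<dots> = (\<Sum>(e0, e1, e2) \<in> (\<lambda>(e0, e1). (e0, e1, {#})) ` {(e0, e1). e0 + e1 = e}.
      T e0 [coeff f e1, coeff (sconst c) e2])"
  proof (rule sum.mono_neutral_right)
    show "\<forall>z\<in>{(e0, e1, e2). e0 + e1 + e2 = e} - (\<lambda>(e0, e1). (e0, e1, {#})) ` {(e0, e1). e0 + e1 = e}.
        (case z of (e0, e1, e2) \<Rightarrow> T e0 [coeff f e1, coeff (sconst c) e2]) = 0"
    proof
      fix z assume z: "z \<in> {(e0, e1, e2). e0 + e1 + e2 = e} - (\<lambda>(e0, e1). (e0, e1, {#})) ` {(e0, e1). e0 + e1 = e}"
      obtain e0 e1 e2 where z': "z = (e0, e1, e2)" by (cases z)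
      with z have "e2 \<noteq> {#}" by auto
      then show "(case z of (e0, e1, e2) \<Rightarrow> T e0 [coeff f e1, coeff (sconst c) e2]) = 0"
        using T_zero[of e0 "[coeff f e1]" "[]"] by (simp add: z' coeff_sconst)
    qed
  qed auto
  also have "\<dots> = (\<Sum>(e0, e1) | e0 + e1 = e. T e0 [coeff f e1, c])"
    by (subst sum.reindex) (auto simp: inj_on_def coeff_sconst intro!: sum.cong)
  finally show ?thesis unfolding coeff_bounded_ops .
qed

text \<open>The potential starts at k = 2, while the shuffle sum has every length; lengths 0 and 1
  contribute nothing by \<open>m_Nil\<close> and minimality.\<close>

lemma sum_replicate_ops:
  assumes "\<And>a. m [a] = 0"
  shows "(\<Sum>k=2..size e. coeff (extend_ops m (replicate k b)) e) = T e []"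
proof -
  have k0: "coeff (extend_ops m (replicate 0 b)) e = 0"
    by (auto simp: coeff_extend_ops m_Nil intro!: sum.neutral)
  have k1: "coeff (extend_ops m (replicate 1 b)) e = 0"
    by (auto simp: coeff_extend_ops assms length_Suc_conv intro!: sum.neutral)
  have "T e [] = (\<Sum>is | length is = length ([] :: 'x series list) + 1 \<and> sum_list is \<le> size e.
      coeff (extend_ops m (weave b is [])) e)"
    by (simp only: coeff_bounded_ops_0[symmetric] bounded_ops_def coeff_Series)
  also have "\<dots> = (\<Sum>k\<in>{..size e}. coeff (extend_ops m (replicate k b)) e)"
    by (rule sum.reindex_bij_witness[of _ "\<lambda>k. [k]" hd]) (auto simp: length_Suc_conv)
  also have "\<dots> = (\<Sum>k=2..size e. coeff (extend_ops m (replicate k b)) e)"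
  proof (rule sum.mono_neutral_right)
    show "\<forall>k\<in>{..size e} - {2..size e}. coeff (extend_ops m (replicate k b)) e = 0"
    proof
      fix k assume "k \<in> {..size e} - {2..size e}"
      then have "k = 0 \<or> k = 1" by auto
      then show "coeff (extend_ops m (replicate k b)) e = 0" using k0 k1 by blast
    qed
  qed auto
  finally show ?thesis by simp
qed

end

context additive_ops
begin

text \<open>Marking one of the inserted letters j turns a word for \<open>add_mset j e\<close> into
  one for \<open>e\<close> with the input \<open>\<alpha> j\<close>, and there are
  \<open>Suc (count e j)\<close> letters to mark. The multiple is written as a constant sum because
  the values only form a group here.\<close>

lemma T_derivative: "T e [\<alpha> j] = (\<Sum>i<Suc (count e j). T (add_mset j e) [])"
proof -
  let ?S = "Sh (add_mset j e) ([] :: 'x list)" and ?v = "map (case_sum \<alpha> id)"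
  have "(\<Sum>i<Suc (count e j). T (add_mset j e) []) =
      (\<Sum>l\<in>?S. \<Sum>(p, r) | p @ Inl j # r = l. m (?v l))"
  proof -
    have "card {(p, r). p @ Inl j # r = l} = Suc (count e j)" if "l \<in> ?S" for l
    proof -
      have "count (mset l) (Inl j) = count (mset (lefts l)) j"
        by (induction l rule: lefts.induct) auto
      then show ?thesis using card_append_Cons[of "Inl j" l] that by (auto simp: Sh_def)
    qed
    then have "(\<Sum>(p, r) | p @ Inl j # r = l. m (?v l)) = (\<Sum>i<Suc (count e j). m (?v l))"
      if "l \<in> ?S" for l
      using that sum_const_card[OF conjunct1[OF card_append_Cons[of "Inl j" l]], of "m (?v l)"]
      by (simp add: case_prod_beta)
    then show ?thesis by (simp only: shuffle_sum_def sum.swap[of _ ?S "{..<_}"] cong: sum.cong)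
  qed
  also have "\<dots> = (\<Sum>(l, p, r) \<in> (SIGMA l:?S. {(p, r). p @ Inl j # r = l}). m (?v l))"
    by (subst sum.Sigma) (auto simp: conjunct1[OF card_append_Cons])
  also have "\<dots> = (\<Sum>(z, p, r) \<in> (SIGMA z:{(e1, e3). e1 + e3 = e}. Sh (fst z) ([] :: 'x list) \<times> Sh (snd z) ([] :: 'x list)).
      m (?v p @ \<alpha> j # ?v r))"
    by (rule sum.reindex_bij_witness[of _ "\<lambda>(z, p, r). (p @ Inl j # r, p, r)"
          "\<lambda>(l, p, r). ((mset (lefts p), mset (lefts r)), p, r)"])
      (auto simp: Sh_def)
  also have "\<dots> = (\<Sum>z \<in> {(e1, e3). e1 + e3 = e}. \<Sum>p\<in>Sh (fst z) ([] :: 'x list). \<Sum>r\<in>Sh (snd z) ([] :: 'x list).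
      m (?v p @ \<alpha> j # ?v r))"
    by (subst sum.Sigma[symmetric]) (auto simp: sum.cartesian_product case_prod_beta)
  also have "\<dots> = T e ([] @ \<alpha> j # [])"
    unfolding T_insert by (simp add: case_prod_beta)
  finally show ?thesis by simp
qed

end

section \<open>Series with coefficients in a module\<close>

text \<open>An operator on module-valued series by its monomial components: \<open>D p\<close>
  raises the monomial by \<open>p\<close>. Scaling by a scalar series, the deformed differential and
  right multiplication by v_j are all of this kind.\<close>

definition cv :: "(nat multiset \<Rightarrow> 'x \<Rightarrow> 'y) \<Rightarrow> 'x series \<Rightarrow> ('y::comm_monoid_add) series"
  where "cv D f = Series (\<lambda>e. \<Sum>(p, q) | p + q = e. D p (coeff f q))"

lemma coeff_cv: "coeff (cv D f) e = (\<Sum>(p, q) | p + q = e. D p (coeff f q))"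
  by (simp add: cv_def)

lemma sscale_cv: "sscale t c f = cv (\<lambda>p. t (coeff c p)) f"
  by (rule series_eqI) (simp add: coeff_cv coeff_sscale)

lemma additive_sum:
  fixes D :: "'x::ab_group_add \<Rightarrow> 'y::ab_group_add"
  assumes "\<And>a b. D (a + b) = D a + D b"
  shows "D (\<Sum>i\<in>I. g i) = (\<Sum>i\<in>I. D (g i))"
proof -
  have "D 0 = 0" using assms[of 0 0] by simp
  then show ?thesis using sum_comp_morphism[of D g I] assms by (simp add: o_def)
qed

text \<open>Grouping by the total \<open>s\<close> of the two monomials isolates an identity between
  components, which can then be proved for a single coefficient of \<open>f\<close>.\<close>

lemma cv_cv:
  fixes D :: "nat multiset \<Rightarrow> 'y::ab_group_add \<Rightarrow> 'z::ab_group_add"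
  assumes "\<And>p a b. D p (a + b) = D p a + D p b"
  shows "coeff (cv D (cv D' f)) e =
    (\<Sum>(s, q) | s + q = e. \<Sum>(p, p') | p + p' = s. D p (D' p' (coeff f q)))"
proof -
  have D: "D p (\<Sum>i\<in>I. g i) = (\<Sum>i\<in>I. D p (g i))" for p I and g :: "nat multiset \<times> nat multiset \<Rightarrow> 'y"
    by (rule additive_sum) (rule assms)
  have "coeff (cv D (cv D' f)) e = (\<Sum>(p, r) | p + r = e. \<Sum>(p', q) | p' + q = r. D p (D' p' (coeff f q)))"
    by (simp add: coeff_cv D case_prod_beta)
  then show ?thesis by (simp only: sum_splits_assoc)
qed

lemma cv_commute:
  fixes D :: "nat multiset \<Rightarrow> 'y::ab_group_add \<Rightarrow> 'y"
  assumes "\<And>p a b. D p (a + b) = D p a + D p b" "\<And>p a b. D' p (a + b) = D' p a + D' p b"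
    and "\<And>p p' a. D p (D' p' a) = D' p' (D p a)"
  shows "cv D (cv D' f) = cv D' (cv D f)"
proof (rule series_eqI)
  fix e
  have "(\<Sum>(p, p') | p + p' = s. D p (D' p' a)) = (\<Sum>(p, p') | p + p' = s. D' p (D p' a))" for s a
    by (subst sum_splits_commute) (simp add: assms(3))
  then show "coeff (cv D (cv D' f)) e = coeff (cv D' (cv D f)) e"
    using assms(1,2) by (simp add: cv_cv)
qed

lemma cv_add:
  fixes D :: "nat multiset \<Rightarrow> 'x::ab_group_add \<Rightarrow> 'y::ab_group_add"
  assumes "\<And>p a b. D p (a + b) = D p a + D p b"
  shows "cv D (f + g) = cv D f + cv D g"
  by (rule series_eqI) (simp add: coeff_cv assms case_prod_beta sum.distrib)

lemma cv_series_over: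
  fixes D :: "nat multiset \<Rightarrow> 'x::ab_group_add \<Rightarrow> 'y::ab_group_add"
  assumes "\<And>p a b. D p (a + b) = D p a + D p b" "\<And>p a. \<not> set_mset p \<subseteq> {..<n} \<Longrightarrow> D p a = 0"
    and "f \<in> series_over n"
  shows "cv D f \<in> series_over n"
proof (rule series_overI, rule ccontr)
  fix e assume "coeff (cv D f) e \<noteq> 0" and e: "\<not> set_mset e \<subseteq> {..<n}"
  moreover have "(\<Sum>(p, q) | p + q = e. D p (coeff f q)) = 0"
  proof (rule sum.neutral, clarify)
    fix p q assume "e = p + q"
    with e consider "\<not> set_mset p \<subseteq> {..<n}" | "\<not> set_mset q \<subseteq> {..<n}" by auto
    then show "D p (coeff f q) = 0"
    proof cases
      case 2
      then have "coeff f q = 0" using assms(3) by (simp add: series_overD)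
      then show ?thesis using assms(1)[of p 0 0] by simp
    qed (rule assms(2))
  qed
  ultimately show False by (simp add: coeff_cv)
qed

locale series_module =
  fixes t :: "'r::comm_ring_1 \<Rightarrow> 'x::ab_group_add \<Rightarrow> 'x"
  assumes mod: "Modules.module t"
begin

lemma t_add: "t c (a + b) = t c a + t c b" and t_add_left: "t (c + d) a = t c a + t d a"
  and t_mult: "t c (t d a) = t (c * d) a" and t_one: "t 1 a = a"
  using mod by (simp_all add: Modules.module_def)

lemma t_zero_left: "t 0 a = 0"
  using t_add_left[of 0 0 a] by simp

lemma t_zero: "t c 0 = 0"
  using t_add[of c 0 0] by simp

lemma t_uminus: "t c (- a) = - t c a"
  using t_add[of c a "- a"] by (simp add: t_zero minus_unique)

lemma t_sum: "t c (\<Sum>i\<in>I. g i) = (\<Sum>i\<in>I. t c (g i))"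
  by (rule additive_sum) (rule t_add)

lemma t_sum_left: "t (\<Sum>i\<in>I. c i) a = (\<Sum>i\<in>I. t (c i) a)"
  by (rule additive_sum[of "\<lambda>c. t c a"]) (rule t_add_left)

lemma sscale_add: "sscale t c (f + g) = sscale t c f + sscale t c g"
  by (simp add: sscale_cv cv_add t_add)

lemma sscale_add_left: "sscale t (c + d) f = sscale t c f + sscale t d f"
  by (rule series_eqI) (simp add: coeff_sscale t_add_left case_prod_beta sum.distrib)

lemma sscale_zero: "sscale t c 0 = 0"
  by (rule series_eqI) (simp add: coeff_sscale t_zero case_prod_beta)

lemma sscale_zero_left: "sscale t 0 f = 0"
  by (rule series_eqI) (simp add: coeff_sscale t_zero_left case_prod_beta)

lemma sscale_uminus_left: "sscale t (- c) f = - sscale t c f"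
  using sscale_add_left[of c "- c" f] by (simp add: sscale_zero_left minus_unique)

lemma sscale_sum: "sscale t c (\<Sum>i\<in>I. g i) = (\<Sum>i\<in>I. sscale t c (g i))"
  by (rule additive_sum) (rule sscale_add)

lemma sscale_mult: "sscale t (c * d) f = sscale t c (sscale t d f)"
proof (rule series_eqI)
  fix e
  show "coeff (sscale t (c * d) f) e = coeff (sscale t c (sscale t d f)) e"
    unfolding sscale_cv[of t c] sscale_cv[of t d] cv_cv[OF t_add]
    by (simp add: coeff_sscale coeff_times t_sum_left t_mult case_prod_beta)
qed

lemma coeff_sscale_sconst: "coeff (sscale t c (sconst a)) e = t (coeff c e) a"
proof -
  have "coeff (sscale t c (sconst a)) e = t (coeff c e) (coeff (sconst a) {#})"
    unfolding coeff_sscale by (rule sum_splits_empty_right) (simp add: coeff_sconst t_zero)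
  then show ?thesis by (simp add: coeff_sconst)
qed

lemma series_over_sscale: "c \<in> series_over n \<Longrightarrow> f \<in> series_over n \<Longrightarrow> sscale t c f \<in> series_over n"
  unfolding sscale_cv by (rule cv_series_over) (auto simp: t_add series_overD t_zero_left)

lemma cv_sscale:
  assumes "\<And>p a b. D p (a + b) = D p a + D p b" "\<And>p c a. D p (t c a) = t c (D p a)"
  shows "cv D (sscale t c f) = sscale t c (cv D f)"
  unfolding sscale_cv by (rule cv_commute) (simp_all add: assms t_add)

end

section \<open>The exterior and the Hessian Clifford algebra\<close>

locale free_module =
  fixes s :: "'r::comm_ring_1 \<Rightarrow> 'v::ab_group_add \<Rightarrow> 'v" and n :: nat and v :: "nat \<Rightarrow> 'v"
  assumes fb: "free_basis s n v"
begin

lemma mod_s: "Modules.module s" and inj_v: "inj_on v {..<n}"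
  using fb by (simp_all add: free_basis_def)

sublocale S: series_module s
  by (rule series_module.intro, rule mod_s)

definition co :: "nat \<Rightarrow> 'v \<Rightarrow> 'r"
  where "co i u = module.representation s (v ` {..<n}) u (v i)"

lemma indep: "\<not> module.dependent s (v ` {..<n})" and spans: "u \<in> module.span s (v ` {..<n})"
  using fb by (simp_all add: free_basis_def)

lemma co_add: "co i (u + w) = co i u + co i w"
  unfolding co_def by (simp add: Modules.module.representation_add[OF mod_s indep spans spans])

lemma co_scale: "co i (s c u) = c * co i u"
  unfolding co_def by (simp add: Modules.module.representation_scale[OF mod_s indep spans])

lemma co_v: "i < n \<Longrightarrow> j < n \<Longrightarrow> co i (v j) = (if i = j then 1 else 0)"
  unfolding co_def using inj_v
  by (subst Modules.module.representation_basis[OF mod_s indep]) (auto simp: inj_on_eq_iff)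

lemma co_expand: "u = (\<Sum>i<n. s (co i u) (v i))"
proof -
  have "(\<Sum>x\<in>v ` {..<n}. s (module.representation s (v ` {..<n}) u x) x) = u"
    by (rule Modules.module.sum_representation_eq[OF mod_s indep spans]) auto
  then show ?thesis by (simp add: sum.reindex[OF inj_v] co_def)
qed

lemma co_sum: "co i (\<Sum>j\<in>J. u j) = (\<Sum>j\<in>J. co i (u j))"
  by (rule additive_sum) (rule co_add)

lemma co_zero: "co i 0 = 0"
  using co_add[of i 0 0] by simp

text \<open>The exterior algebra is the Clifford algebra of the zero form, so the same coordinates
  serve for the associated graded of A.\<close>

sublocale E: clifford_setup UNIV UNIV s "\<lambda>_. 0" n v co "\<lambda>_. 0" "\<lambda>_ _. 0"
  by unfold_locales (auto simp: co_add co_scale co_v intro: co_expand)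

lemma E_lop: "lop E.\<beta> i f = wedge i f"
  by (simp add: lop_def contrs_def E.\<beta>_def scl_simps)

lemma exterior_eq: "exterior s = E.C" "exterior_class s = E.cls"
  by (simp_all add: exterior_def exterior_class_def)

text \<open>The coordinates of the exterior power of degree \<open>p\<close>, as
  \<open>exterior_power_iff\<close> shows.\<close>

definition Hom :: "int \<Rightarrow> (nat set \<Rightarrow> 'r) set"
  where "Hom p = {f. supp_in {..<n} f \<and> (\<forall>J. f J \<noteq> 0 \<longrightarrow> int (card J) = p)}"

lemma E_Mdl: "f \<in> E.Mdl \<longleftrightarrow> supp_in {..<n} f"
  by (simp add: E.Mdl_def)

lemma Hom_Mdl: "f \<in> Hom p \<Longrightarrow> f \<in> E.Mdl"
  by (simp add: E_Mdl Hom_def)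

lemma Hom_zero: "0 \<in> Hom p"
  by (simp add: Hom_def supp_in_zero)

lemma Hom_add: "f \<in> Hom p \<Longrightarrow> g \<in> Hom p \<Longrightarrow> f + g \<in> Hom p"
  unfolding Hom_def by (auto simp: supp_in_add) (metis add.right_neutral)

lemma Hom_scl: "f \<in> Hom p \<Longrightarrow> scl c f \<in> Hom p"
  unfolding Hom_def by (auto simp: supp_in_scl) (metis mult_zero_right)

lemma Hom_sum: "(\<And>i. i \<in> I \<Longrightarrow> f i \<in> Hom p) \<Longrightarrow> (\<Sum>i\<in>I. f i) \<in> Hom p"
  by (induction I rule: infinite_finite_induct) (auto intro: Hom_add Hom_zero)

lemma Hom_wedge: "f \<in> Hom p \<Longrightarrow> i < n \<Longrightarrow> wedge i f \<in> Hom (p + 1)"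
  unfolding Hom_def
proof (intro CollectI conjI allI impI)
  fix J assume f: "f \<in> {f. supp_in {..<n} f \<and> (\<forall>J. f J \<noteq> 0 \<longrightarrow> int (card J) = p)}" and "wedge i f J \<noteq> 0"
  then have J: "i \<in> J" "f (J - {i}) \<noteq> 0" by (auto simp: wedge_def split: if_splits)
  then have "J - {i} \<subseteq> {..<n}" using f by (simp add: supp_in_def)
  then have "finite (J - {i})" by (rule finite_subset) simp
  with J have "card J = card (J - {i}) + 1" by (simp add: card_Suc_Diff1 del: card_Diff_insert)
  moreover have "int (card (J - {i})) = p" using f J by blast
  ultimately show "int (card J) = p + 1" by simp
qed (auto simp: supp_in_wedge)

lemma Hom_evw: "E.evw (Word us) (del {}) \<in> Hom (int (length us))"
proof (induction us)
  case Nil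
  have "(del {} :: nat set \<Rightarrow> 'r) \<in> Hom 0" by (auto simp: Hom_def supp_in_def del_def)
  then show ?case by simp
next
  case (Cons u us)
  have "E.act u (E.evw (Word us) (del {})) \<in> Hom (int (length us) + 1)"
    unfolding E.act_def E_lop using Cons.IH by (intro Hom_sum Hom_scl Hom_wedge) auto
  then show ?case by (simp add: add.commute)
qed

lemma exterior_power_iff: "x \<in> exterior_power s p \<longleftrightarrow> x \<in> carrier E.C \<and> E.\<kappa> x \<in> Hom p"
proof
  assume "x \<in> exterior_power s p"
  then obtain t where t: "x = E.cls t" "\<forall>w \<in> Poly_Mapping.keys t. wordlen w = p"
    by (auto simp: exterior_power_def exterior_eq)
  have F: "t \<in> carrier E.F" by (simp add: E.carrier_F)
  have "E.ev t (del {}) \<in> Hom p"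
    unfolding E.ev_def
  proof (intro Hom_sum Hom_scl)
    fix w assume "w \<in> Poly_Mapping.keys t"
    then have "int (length (letters w)) = p" using t(2) by (simp add: wordlen_def)
    then show "E.evw w (del {}) \<in> Hom p" using Hom_evw[of "letters w"] by simp
  qed
  then show "x \<in> carrier E.C \<and> E.\<kappa> x \<in> Hom p" using F by (simp add: t(1) E.cls_carrier E.\<kappa>_cls)
next
  assume x: "x \<in> carrier E.C \<and> E.\<kappa> x \<in> Hom p"
  let ?f = "E.\<kappa> x"
  have "wordlen w = p" if "w \<in> Poly_Mapping.keys (E.canon ?f)" for w
  proof -
    have "w \<in> (\<Union>J\<in>Pow {..<n}. Poly_Mapping.keys (scalar (?f J) * E.vw J))"
      using that unfolding E.canon_def by (rule subsetD[OF keys_sum_subset])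
    then obtain J where J: "J \<subseteq> {..<n}" "w \<in> Poly_Mapping.keys (scalar (?f J) * E.vw J)"
      by auto
    then have "w \<in> Poly_Mapping.keys (Poly_Mapping.single (Word (map v (sorted_list_of_set J))) (?f J))"
      by (simp add: E.vw_def flip: single_mono)
    then have "?f J \<noteq> 0" "w = Word (map v (sorted_list_of_set J))"
      by (auto simp: in_keys_iff lookup_single when_def split: if_splits)
    moreover have "finite J" using J(1) by (rule finite_subset) simp
    ultimately show ?thesis using x by (auto simp: Hom_def wordlen_def)
  qed
  then have "E.cls (E.canon ?f) \<in> exterior_power s p"
    by (auto simp: exterior_power_def exterior_eq)
  then show "x \<in> exterior_power s p" using x by (simp add: E.canon_\<kappa>)
qed

lemma coeff_coordinate: "coeff (coordinate n s v i u) e = co i (coeff u e)"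
  by (simp add: coordinate_def co_def)

lemma half_hess_clifford:
  assumes P: "P \<in> series_over n"
  shows "clifford_setup (series_over n) (series_over n) (sscale s) (\<lambda>u. - half_hess n s v P u) n
    (\<lambda>i. sconst (v i)) (coordinate n s v) (\<lambda>i. - half_pderiv2 i P)
    (\<lambda>i j. - pderiv_series i (pderiv_series j P))"
proof unfold_locales
  fix c d :: "'r series" and u w :: "'v series" and i j :: nat
  show "(1 :: 'r series) \<in> series_over n" "(0 :: 'v series) \<in> series_over n" by simp_all
  show "c - d \<in> series_over n" "c * d \<in> series_over n" if "c \<in> series_over n" "d \<in> series_over n"
    using that by auto
  show "u + w \<in> series_over n" if "u \<in> series_over n" "w \<in> series_over n" using that by auto
  show "sscale s c u \<in> series_over n" if "c \<in> series_over n" "u \<in> series_over n"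
    using that by (rule S.series_over_sscale)
  show "sconst (v i) \<in> series_over n" by simp
  show "coordinate n s v i u \<in> series_over n" if "u \<in> series_over n"
    using that by (auto intro!: series_overI simp: coeff_coordinate series_overD dest: series_overD)
      (metis co_zero lessThan_iff series_overD subset_eq)
  show "coordinate n s v i (u + w) = coordinate n s v i u + coordinate n s v i w"
    by (rule series_eqI) (simp add: coeff_coordinate co_add)
  show "coordinate n s v i (sscale s c u) = c * coordinate n s v i u"
    by (rule series_eqI) (simp add: coeff_coordinate coeff_sscale coeff_times co_sum co_scale case_prod_beta)
  show "coordinate n s v i (sconst (v j)) = (if i = j then 1 else 0)" if "i < n" "j < n"
    using co_v[OF that] by (auto intro!: series_eqI simp: coeff_coordinate coeff_sconst coeff_one co_zero)
  show "u = (\<Sum>i<n. sscale s (coordinate n s v i u) (sconst (v i)))"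
  proof (rule series_eqI)
    fix e
    have "coeff (\<Sum>i<n. sscale s (coordinate n s v i u) (sconst (v i))) e = (\<Sum>i<n. s (co i (coeff u e)) (v i))"
      by (simp add: coeff_sum S.coeff_sscale_sconst coeff_coordinate)
    then show "coeff u e = coeff (\<Sum>i<n. sscale s (coordinate n s v i u) (sconst (v i))) e"
      using co_expand[of "coeff u e"] by simp
  qed
  show "- half_hess n s v P u = (\<Sum>i<n. (coordinate n s v i u)\<^sup>2 * - half_pderiv2 i P) +
      (\<Sum>j<n. \<Sum>i<j. coordinate n s v i u * coordinate n s v j u * - pderiv_series i (pderiv_series j P))"
    by (simp add: half_hess_def sum_negf)
  show "- half_pderiv2 i P \<in> series_over n" using P by auto
  show "- pderiv_series i (pderiv_series j P) \<in> series_over n" using P by auto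
  show "- pderiv_series i (pderiv_series j P) = - pderiv_series j (pderiv_series i P)"
    by (simp add: pderiv_series_commute)
qed

lemma half_hess_jacobi:
  assumes P: "P \<in> series_over n"
  shows "clifford_jacobi (series_over n) (series_over n) (sscale s) (\<lambda>u. - half_hess n s v P u) n
    (\<lambda>i. sconst (v i)) (coordinate n s v) (\<lambda>i. - half_pderiv2 i P)
    (\<lambda>i j. - pderiv_series i (pderiv_series j P)) (jac_ideal n P)"
proof (rule clifford_jacobi.intro[OF half_hess_clifford[OF P]])
  interpret R: cring "series_ring n :: 'r series ring" by (rule series_ring_cring)
  have sub: "(\<lambda>i. pderiv_series i P) ` {..<n} \<subseteq> carrier (series_ring n)"
    using P by (auto simp: series_ring_def)
  interpret J: ideal "jac_ideal n P" "series_ring n"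
    unfolding jac_ideal_def by (rule R.genideal_ideal[OF sub])
  show "clifford_jacobi_axioms (series_over n) (jac_ideal n P)"
  proof
    show "jac_ideal n P \<subseteq> series_over n" using J.a_subset by (simp add: series_ring_def)
    show "0 \<in> jac_ideal n P" using J.zero_closed by (simp add: series_ring_def)
    show "r + r' \<in> jac_ideal n P" if "r \<in> jac_ideal n P" "r' \<in> jac_ideal n P" for r r'
      using J.a_closed[OF that] by (simp add: series_ring_def)
    show "c * r \<in> jac_ideal n P" if "c \<in> series_over n" "r \<in> jac_ideal n P" for c r
      using J.I_l_closed[OF that(2), of c] that(1) by (simp add: series_ring_def)
  qed
qed

lemma pderiv_jac_ideal:
  "P \<in> series_over n \<Longrightarrow> i < n \<Longrightarrow> pderiv_series i P \<in> jac_ideal n P" for P :: "'r series"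
proof -
  assume P: "P \<in> series_over n" and i: "i < n"
  interpret R: cring "series_ring n :: 'r series ring" by (rule series_ring_cring)
  have "(\<lambda>i. pderiv_series i P) ` {..<n} \<subseteq> carrier (series_ring n)"
    using P by (auto simp: series_ring_def)
  from R.genideal_self[OF this] show ?thesis using i by (auto simp: jac_ideal_def)
qed

end

lemma ops_degree_shifted:
  assumes "ops_degree (shifted Y) 1 m" "list_all2 (\<lambda>a p. a \<in> Y p) as ps" "as \<noteq> []"
  shows "m as \<in> Y (sum_list ps - int (length as) + 2)"
proof -
  have "list_all2 (\<lambda>a p. a \<in> shifted Y p) as (map (\<lambda>p. p - 1) ps)"
    using assms(2) by (simp add: list_all2_map2 shifted_def)
  then have "m as \<in> shifted Y (sum_list (map (\<lambda>p. p - 1) ps) + 1)"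
    using assms(1,3) by (auto simp: ops_degree_def)
  moreover have "sum_list (map (\<lambda>p. p - 1) ps) = sum_list ps - int (length ps)"
    by (induction ps) auto
  ultimately show ?thesis using list_all2_lengthD[OF assms(2)] by (simp add: shifted_def algebra_simps)
qed

text \<open>Inserted letters have degree 1 and so do not change the sum of the reduced degrees.
  Inputs are represented by their positions, at which \<open>ps\<close> records a degree.\<close>

lemma shuffle_degrees:
  fixes \<alpha> :: "nat \<Rightarrow> 'x" and deg :: "nat + nat \<Rightarrow> int"
  assumes as: "list_all2 (\<lambda>a p. a \<in> Y p) as ps" and \<alpha>: "\<And>j. \<alpha> j \<in> Y 1"
    and l: "l \<in> Sh e [0..<length as]"
  defines "deg \<equiv> case_sum (\<lambda>_. 1) ((!) ps)"
  shows "list_all2 (\<lambda>a p. a \<in> Y p) (map (case_sum \<alpha> ((!) as)) l) (map deg l)"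
    and "sum_list (map deg l) - int (length l) = sum_list ps - int (length as)"
    and "length l = size e + length as"
proof -
  have len: "length ps = length as" using as by (simp add: list_all2_lengthD)
  have r: "rights l = [0..<length as]" "mset (lefts l) = e" using l by (auto simp: Sh_def)
  have "set l \<subseteq> Inl ` set (lefts l) \<union> Inr ` {..<length as}"
    using set_lefts_rights[of l] r by (auto simp: atLeast0LessThan)
  then have "case_sum \<alpha> ((!) as) x \<in> Y (deg x)" if "x \<in> set l" for x
    using that as \<alpha> by (auto simp: deg_def list_all2_conv_all_nth)
  then show "list_all2 (\<lambda>a p. a \<in> Y p) (map (case_sum \<alpha> ((!) as)) l) (map deg l)"
    by (simp add: list_all2_map1 list_all2_map2 list_all2_same)
  have "sum_list (map deg l) = int (length (lefts l)) + sum_list (map ((!) ps) (rights l))"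
    by (induction l rule: lefts.induct) (auto simp: deg_def)
  also have "map ((!) ps) (rights l) = ps" unfolding r(1) len[symmetric] by (rule map_nth)
  finally show "sum_list (map deg l) - int (length l) = sum_list ps - int (length as)"
    using length_lefts_rights[of l] by (simp add: r(1))
  show "length l = size e + length as"
    using length_lefts_rights[of l] r by auto
qed

lemma shuffle_sum_nth:
  "shuffle_sum \<alpha> m e as = (\<Sum>l\<in>Sh e [0..<length as]. m (map (case_sum \<alpha> ((!) as)) l))"
  using shuffle_sum_map[of \<alpha> m e "(!) as" "[0..<length as]"] by (simp add: map_nth)

section \<open>The deformation as a graded and filtered module\<close>

locale deformation = free_module s n v
  for s :: "'r::comm_ring_1 \<Rightarrow> 'v::ab_group_add \<Rightarrow> 'v" and n v +
  fixes A :: "('r, 'x::ab_group_add) filtered_ainf"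
    and \<phi> :: "int \<Rightarrow> 'x set \<Rightarrow> ('v word \<Rightarrow>\<^sub>0 'r) set"
  assumes sd: "superfiltered_deformation s A \<phi>"
begin

abbreviation t where "t \<equiv> smul A"
abbreviation X where "X \<equiv> part A"
abbreviation Fl where "Fl \<equiv> filt A"
abbreviation un where "un \<equiv> unity A"

text \<open>Shuffle sums also meet the empty word, where \<open>ops\<close> is unconstrained; the
  value 0 says that A itself has no curvature.\<close>

definition \<mu> :: "'x list \<Rightarrow> 'x"
  where "\<mu> as = (if as = [] then 0 else ops A as)"

lemma sm: "superfiltered_module t X Fl"
  and ml: "multilinear t (ops A)"
  and deg_X: "ops_degree (shifted X) 1 (ops A)"
  and deg_Fl: "ops_degree (shifted Fl) 1 (ops A)"
  and ainf_A: "ainf_relations X (ops A)"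
  and minimal: "ops A [a] = 0"
  and unit_A: "strict_unit X (ops A) un"
  and gi: "gr_iso s t Fl \<phi>"
  and lead: "standard_leading_terms s Fl (ops A) \<phi>"
  using sd by (auto simp: superfiltered_deformation_def)

lemma sm_facts:
  "Modules.module t" "\<forall>p. module.subspace t (X p)" "\<forall>p. X (p + 2) = X p" "X 0 \<inter> X 1 = {0}"
  "\<forall>a. \<exists>b \<in> X 0. \<exists>c \<in> X 1. a = b + c" "\<forall>p. module.subspace t (Fl p)" "mono Fl"
  "(\<Inter>p. Fl p) = {0}" "(\<Union>p. Fl p) = UNIV"
  "\<forall>p. \<forall>a \<in> Fl p. \<exists>b \<in> Fl p \<inter> X 0. \<exists>c \<in> Fl p \<inter> X 1. a = b + c"
  "\<forall>p. Fl (p + 1) \<inter> X p = Fl p \<inter> X p"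
  by (insert sm[unfolded superfiltered_module_def]) (elim conjE, assumption)+

lemma mod_t: "Modules.module t"
  by (rule sm_facts(1))

sublocale series_module t
  by (rule series_module.intro, rule mod_t)

lemma X_subspace: "module.subspace t (X p)" and Fl_subspace: "module.subspace t (Fl p)"
  using sm_facts(2,6) by simp_all

lemma X_zero: "0 \<in> X p" and Fl_zero: "0 \<in> Fl p"
  using Modules.module.subspace_0[OF mod_t] X_subspace Fl_subspace by blast+

lemma X_add: "a \<in> X p \<Longrightarrow> b \<in> X p \<Longrightarrow> a + b \<in> X p"
  and Fl_add: "a \<in> Fl p \<Longrightarrow> b \<in> Fl p \<Longrightarrow> a + b \<in> Fl p"
  using Modules.module.subspace_add[OF mod_t] X_subspace Fl_subspace by blast+

lemma X_diff: "a \<in> X p \<Longrightarrow> b \<in> X p \<Longrightarrow> a - b \<in> X p"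
  and Fl_diff: "a \<in> Fl p \<Longrightarrow> b \<in> Fl p \<Longrightarrow> a - b \<in> Fl p"
  using Modules.module.subspace_diff[OF mod_t] X_subspace Fl_subspace by blast+

lemma X_scale: "a \<in> X p \<Longrightarrow> t c a \<in> X p" and Fl_scale: "a \<in> Fl p \<Longrightarrow> t c a \<in> Fl p"
  using Modules.module.subspace_scale[OF mod_t] X_subspace Fl_subspace by blast+

lemma X_uminus: "a \<in> X p \<Longrightarrow> - a \<in> X p" and Fl_uminus: "a \<in> Fl p \<Longrightarrow> - a \<in> Fl p"
  using X_diff[OF X_zero] Fl_diff[OF Fl_zero] by fastforce+

lemma X_sum: "(\<And>i. i \<in> I \<Longrightarrow> f i \<in> X p) \<Longrightarrow> (\<Sum>i\<in>I. f i) \<in> X p"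
  and Fl_sum: "(\<And>i. i \<in> I \<Longrightarrow> f i \<in> Fl p) \<Longrightarrow> (\<Sum>i\<in>I. f i) \<in> Fl p"
  using Modules.module.subspace_sum[OF mod_t] X_subspace Fl_subspace by blast+

lemma X_period: "X (p + 2 * k) = X p"
proof -
  have nat: "X (q + 2 * int m) = X q" for q m
  proof (induction m)
    case (Suc m)
    have "X (q + 2 * int (Suc m)) = X (q + 2 * int m + 2)" by (simp add: algebra_simps)
    also have "\<dots> = X (q + 2 * int m)" by (rule spec[OF sm_facts(3)])
    finally show ?case using Suc by simp
  qed simp
  show ?thesis
  proof (cases "0 \<le> k")
    case True
    then show ?thesis using nat[of p "nat k"] by simp
  next
    case False
    then show ?thesis using nat[of "p + 2 * k" "nat (- k)"] by simp
  qed
qed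

lemma X_even: "even (p - q) \<Longrightarrow> X p = X q"
proof -
  assume "even (p - q)"
  then obtain k where "p - q = 2 * k" by (rule evenE)
  then have "p = q + 2 * k" by simp
  then show ?thesis by (simp add: X_period)
qed

lemma X_disjoint: "a \<in> X 0 \<Longrightarrow> a \<in> X 1 \<Longrightarrow> a = 0"
  using sm_facts(4) by blast

lemma X_split: obtains b c where "b \<in> X 0" "c \<in> X 1" "a = b + c"
  using sm_facts(5) by blast

lemma Fl_split: assumes "a \<in> Fl p" obtains b c where "b \<in> Fl p" "b \<in> X 0" "c \<in> Fl p" "c \<in> X 1" "a = b + c"
  using sm_facts(10) assms by blast

lemma Fl_mono: "p \<le> q \<Longrightarrow> Fl p \<subseteq> Fl q"
  by (rule monoD[OF sm_facts(7)])

lemma Fl_Inter: "(\<Inter>p. Fl p) = {0}" and Fl_Union: "(\<Union>p. Fl p) = UNIV"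
  by (rule sm_facts(8), rule sm_facts(9))

lemma Fl_super: "a \<in> Fl (p + 1) \<Longrightarrow> a \<in> X p \<Longrightarrow> a \<in> Fl p"
  using spec[OF sm_facts(11), of p] by blast

subsection \<open>Leading terms\<close>

text \<open>The leading term of \<open>a\<close> at level \<open>p\<close>, as a coordinate vector.
  For \<open>a\<close> in that level it vanishes exactly when \<open>a\<close> lies one level lower,
  see \<open>lam_eq_zero\<close>.\<close>

definition lam :: "int \<Rightarrow> 'x \<Rightarrow> nat set \<Rightarrow> 'r"
  where "lam p a = E.\<kappa> (\<phi> p (gr_class Fl p a))"

lemma gr_in: "a \<in> Fl p \<Longrightarrow> gr_class Fl p a \<in> gr Fl p"
  by (simp add: gr_def)

lemma \<phi>_bij: "bij_betw (\<phi> p) (gr Fl p) (exterior_power s p)"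
  using gi by (simp add: gr_iso_def)

lemma \<phi>_power: "a \<in> Fl p \<Longrightarrow> \<phi> p (gr_class Fl p a) \<in> exterior_power s p"
  using bij_betwE[OF \<phi>_bij] gr_in by blast

lemma \<phi>_carrier: "a \<in> Fl p \<Longrightarrow> \<phi> p (gr_class Fl p a) \<in> carrier E.C"
  using \<phi>_power exterior_power_iff by blast

lemma lam_Hom: "a \<in> Fl p \<Longrightarrow> lam p a \<in> Hom p"
  using \<phi>_power exterior_power_iff by (simp add: lam_def)

lemma lam_add: "a \<in> Fl p \<Longrightarrow> b \<in> Fl p \<Longrightarrow> lam p (a + b) = lam p a + lam p b"
  using gi by (simp add: gr_iso_def lam_def exterior_eq E.\<kappa>_add \<phi>_carrier)

lemma lam_scale: "a \<in> Fl p \<Longrightarrow> lam p (t c a) = scl c (lam p a)"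
  using gi by (simp add: gr_iso_def lam_def E.\<kappa>_cact \<phi>_carrier)

lemma lam_zero: "lam p 0 = 0"
  using lam_add[OF Fl_zero Fl_zero, of p] by simp

lemma lam_uminus: "a \<in> Fl p \<Longrightarrow> lam p (- a) = - lam p a"
  using lam_add[OF _ Fl_uminus, of a p a] by (simp add: lam_zero minus_unique)

lemma lam_sum:
  assumes "\<And>i. i \<in> I \<Longrightarrow> f i \<in> Fl p"
  shows "lam p (\<Sum>i\<in>I. f i) = (\<Sum>i\<in>I. lam p (f i))"
proof (cases "finite I")
  case True
  then show ?thesis using assms
  proof (induction I)
    case empty
    show ?case unfolding sum.empty by (rule lam_zero)
  next
    case (insert i I)
    have "lam p (\<Sum>i\<in>I. f i) = (\<Sum>i\<in>I. lam p (f i))" using insert.prems by (intro insert.IH) auto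
    moreover have "lam p (f i + (\<Sum>i\<in>I. f i)) = lam p (f i) + lam p (\<Sum>i\<in>I. f i)"
      using insert.prems by (intro lam_add Fl_sum) auto
    ultimately show ?case unfolding sum.insert[OF insert.hyps] by (simp only:)
  qed
next
  case False
  then show ?thesis unfolding sum.infinite[OF False] by (simp only: lam_zero)
qed

lemma lam_cong:
  assumes "a \<in> Fl p" "b \<in> Fl p"
  shows "lam p a = lam p b \<longleftrightarrow> a - b \<in> Fl (p - 1)"
proof
  assume "lam p a = lam p b"
  then have "\<phi> p (gr_class Fl p a) = \<phi> p (gr_class Fl p b)"
    unfolding lam_def by (intro E.\<kappa>_inj \<phi>_carrier assms)
  then have "gr_class Fl p a = gr_class Fl p b"
    using bij_betw_imp_inj_on[OF \<phi>_bij] gr_in assms by (meson inj_onD)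
  moreover have "a \<in> gr_class Fl p a" by (simp add: gr_class_def Fl_zero)
  ultimately show "a - b \<in> Fl (p - 1)" by (auto simp: gr_class_def)
next
  assume d: "a - b \<in> Fl (p - 1)"
  have "x - a \<in> Fl (p - 1) \<longleftrightarrow> x - b \<in> Fl (p - 1)" for x
    using Fl_add[OF _ d, of "x - a"] Fl_diff[OF _ d, of "x - b"] by auto
  then have "gr_class Fl p a = gr_class Fl p b" by (simp add: gr_class_def)
  then show "lam p a = lam p b" by (simp add: lam_def)
qed

lemma lam_eq_zero: "a \<in> Fl p \<Longrightarrow> lam p a = 0 \<longleftrightarrow> a \<in> Fl (p - 1)"
  using lam_cong[OF _ Fl_zero, of a p] by (simp add: lam_zero)

lemma lam_surj:
  assumes "f \<in> Hom p"
  obtains a where "a \<in> Fl p" "lam p a = f"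
proof -
  have f: "f \<in> E.Mdl" using assms by (rule Hom_Mdl)
  have "E.cls (E.canon f) \<in> exterior_power s p"
    using assms f by (simp add: exterior_power_iff E.cls_canon E.\<kappa>_canon)
  then have "E.cls (E.canon f) \<in> \<phi> p ` gr_class Fl p ` Fl p"
    using bij_betw_imp_surj_on[OF \<phi>_bij[of p]] by (simp only: gr_def)
  then obtain a where "a \<in> Fl p" "\<phi> p (gr_class Fl p a) = E.cls (E.canon f)"
    by (elim imageE) simp
  then show ?thesis using that f by (simp add: lam_def E.\<kappa>_canon)
qed

lemmas ops_Fl = ops_degree_shifted[OF deg_Fl] and ops_X = ops_degree_shifted[OF deg_X]

text \<open>Only the binary operation has a nonzero leading term, so the others drop one filtration
  level further.\<close>

lemma ops_Fl_lower:
  assumes "list_all2 (\<lambda>a p. a \<in> Fl p) as ps" "as \<noteq> []" "length as \<noteq> 2"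
  shows "ops A as \<in> Fl (sum_list ps - int (length as) + 1)"
proof -
  let ?r = "sum_list ps - int (length as) + 2"
  have "\<phi> ?r (gr_class Fl ?r (ops A as)) = \<zero>\<^bsub>exterior s\<^esub>"
    using lead assms by (auto simp: standard_leading_terms_def Let_def)
  then have "lam ?r (ops A as) = 0" by (simp add: lam_def exterior_eq E.\<kappa>_zero)
  then show ?thesis using lam_eq_zero[OF ops_Fl[OF assms(1,2)]] by (simp add: algebra_simps)
qed

lemma lam_ops2:
  assumes "a \<in> Fl p" "b \<in> Fl q"
  shows "lam (p + q) (ops A [a, b]) = signed q (E.ev (E.canon (lam p a)) (lam q b))"
proof -
  have "\<phi> (p + q) (gr_class Fl (p + q) (ops A [a, b])) =
      signed_in E.C q (\<phi> p (gr_class Fl p a) \<otimes>\<^bsub>E.C\<^esub> \<phi> q (gr_class Fl q b))"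
    using lead assms unfolding standard_leading_terms_def exterior_eq by blast
  moreover have "\<phi> p (gr_class Fl p a) = E.cls (E.canon (lam p a))"
    using assms by (simp add: lam_def E.canon_\<kappa> \<phi>_carrier)
  moreover have "lam p a \<in> E.Mdl" using lam_Hom[OF assms(1)] by (rule Hom_Mdl)
  ultimately have eq: "\<phi> (p + q) (gr_class Fl (p + q) (ops A [a, b])) =
      signed_in E.C q (E.cls (E.canon (lam p a)) \<otimes>\<^bsub>E.C\<^esub> \<phi> q (gr_class Fl q b))"
    and F: "E.canon (lam p a) \<in> carrier E.F" by (simp_all add: E.F_canon)
  have Y: "\<phi> q (gr_class Fl q b) \<in> carrier E.C" by (rule \<phi>_carrier[OF assms(2)])
  have "lam (p + q) (ops A [a, b]) =
      signed q (E.\<kappa> (E.cls (E.canon (lam p a)) \<otimes>\<^bsub>E.C\<^esub> \<phi> q (gr_class Fl q b)))"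
    unfolding lam_def[of "p + q"] eq
    by (rule E.\<kappa>_signed) (rule E.C.m_closed[OF E.cls_carrier[OF F] Y])
  then show ?thesis unfolding E.\<kappa>_mult[OF F Y] lam_def[of q] .
qed

lemma Hom_empty: "p < 0 \<or> int n < p \<Longrightarrow> f \<in> Hom p \<Longrightarrow> f = 0"
proof
  fix J assume p: "p < 0 \<or> int n < p" and f: "f \<in> Hom p"
  show "f J = 0 J"
  proof (rule ccontr)
    assume "f J \<noteq> 0 J"
    then have "J \<subseteq> {..<n}" "int (card J) = p" using f by (auto simp: Hom_def supp_in_def)
    moreover from this have "card J \<le> n" using card_mono[of "{..<n}" J] by simp
    ultimately show False using p by simp
  qed
qed

text \<open>The exterior powers of negative degree vanish, so all negative levels coincide, and the
  filtration is Hausdorff.\<close>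

lemma Fl_negative: "p < 0 \<Longrightarrow> Fl p = {0}"
proof -
  assume p: "p < 0"
  have step: "Fl q \<subseteq> Fl (q - 1)" if "q < 0" for q
    using that lam_Hom lam_eq_zero Hom_empty by blast
  have down: "Fl p \<subseteq> Fl (p - int k)" for k
  proof (induction k)
    case (Suc k)
    have "Fl (p - int k) \<subseteq> Fl (p - int k - 1)" using p by (intro step) simp
    moreover have eq: "p - int (Suc k) = p - int k - 1" by simp
    ultimately show ?case unfolding eq using Suc.IH by blast
  qed simp
  have "a \<in> Fl q" if "a \<in> Fl p" for a q
  proof (cases "p \<le> q")
    case True
    then show ?thesis using Fl_mono that by blast
  next
    case False
    then have "q = p - int (nat (p - q))" by simp
    then show ?thesis using down[of "nat (p - q)"] that by auto
  qed
  then have "Fl p \<subseteq> (\<Inter>q. Fl q)" by blast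
  then have "Fl p \<subseteq> {0}" by (simp only: Fl_Inter)
  moreover have "{0} \<subseteq> Fl p" using Fl_zero by simp
  ultimately show ?thesis by (rule equalityI)
qed

text \<open>Above n the exterior powers vanish, so the exhaustive filtration is already everything
  at level n. With \<open>Fl_negative\<close> this makes inductions over levels finite.\<close>

lemma Fl_top: "a \<in> Fl (int n)"
proof -
  obtain q where q: "a \<in> Fl q" using Fl_Union by blast
  have "a \<in> Fl (int n + int k) \<Longrightarrow> a \<in> Fl (int n)" for k
  proof (induction k)
    case (Suc k)
    let ?p = "int n + int (Suc k)"
    have "lam ?p a = 0" by (rule Hom_empty[OF _ lam_Hom[OF Suc.prems]]) simp
    then have "a \<in> Fl (?p - 1)" using lam_eq_zero[OF Suc.prems] by simp
    moreover have "?p - 1 = int n + int k" by simp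
    ultimately show ?case using Suc.IH by metis
  qed simp
  moreover have "a \<in> Fl (int n + int (nat q))"
    using q Fl_mono[of q "int n + int (nat q)"] by auto
  ultimately show ?thesis by blast
qed

lemma canon_del_ev: "E.ev (E.canon (del {})) f = f"
  by (simp add: E.canon_del E.vw_empty)

lemma Hom_del: "J \<subseteq> {..<n} \<Longrightarrow> int (card J) = p \<Longrightarrow> del J \<in> Hom p"
  by (auto simp: Hom_def supp_in_del) (auto simp: del_def split: if_splits)

lemma unit_right: "ops A [a, un] = a" and unit_left: "a \<in> X d \<Longrightarrow> signed d (ops A [un, a]) = a"
  and unit_X: "un \<in> X 0"
  and unit_other: "as \<noteq> [] \<Longrightarrow> length as \<noteq> 2 \<Longrightarrow> un \<in> set as \<Longrightarrow> ops A as = 0"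
  using unit_A by (auto simp: strict_unit_def)

text \<open>A strict unit is only required to be even, so its level must be derived. An element
  \<open>a\<close> of level 0 with leading term 1 satisfies a * un = a up to sign; comparing leading
  terms at a positive level, where \<open>a\<close> has none, lowers \<open>un\<close> step by
  step.\<close>

lemma unit_Fl: "un \<in> Fl 0" and lam_unit: "lam 0 un = del {}"
proof -
  obtain a where a: "a \<in> Fl 0" "lam 0 a = del {}"
    by (rule lam_surj[of "del {}" 0]) (auto simp: Hom_del)
  have prod: "lam q a = signed q (lam q un)" if "un \<in> Fl q" for q
    using lam_ops2[OF a(1) that] by (simp add: unit_right a(2) canon_del_ev)
  have "un \<in> Fl (int k) \<Longrightarrow> un \<in> Fl 0" for k
  proof (induction k)
    case (Suc k)
    have "a \<in> Fl (int (Suc k) - 1)" using a(1) Fl_mono[of 0 "int (Suc k) - 1"] by auto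
    then have "lam (int (Suc k)) a = 0"
      using lam_eq_zero[of a "int (Suc k)"] Fl_mono[of "int (Suc k) - 1" "int (Suc k)"] by auto
    then have "signed (int (Suc k)) (lam (int (Suc k)) un) = 0" using prod[OF Suc.prems] by simp
    then have "lam (int (Suc k)) un = 0" by (auto simp: signed_def split: if_splits)
    then have "un \<in> Fl (int (Suc k) - 1)" using lam_eq_zero[OF Suc.prems] by simp
    then show ?case using Suc.IH by simp
  qed simp
  then show "un \<in> Fl 0" using Fl_top by blast
  then show "lam 0 un = del {}" using prod[of 0] a(2) by (simp add: signed_def)
qed

lemma Fl_0_unit: "a \<in> Fl 0 \<Longrightarrow> \<exists>c. a = t c un"
proof -
  assume a: "a \<in> Fl 0"
  have "lam 0 a J = scl (lam 0 a {}) (del {}) J" for J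
  proof (cases "J = {}")
    case False
    have "lam 0 a J = 0"
    proof (rule ccontr)
      assume "lam 0 a J \<noteq> 0"
      then have "J \<subseteq> {..<n}" "int (card J) = 0"
        using lam_Hom[OF a] by (auto simp: Hom_def supp_in_def)
      moreover from this have "finite J" using finite_subset by blast
      ultimately show False using False by simp
    qed
    then show ?thesis using False by (simp add: del_def)
  qed (simp add: del_def)
  then have "lam 0 a = scl (lam 0 a {}) (del {})" by (rule ext)
  also have "\<dots> = lam 0 (t (lam 0 a {}) un)"
    unfolding lam_scale[OF unit_Fl] lam_unit ..
  finally have "a - t (lam 0 a {}) un \<in> Fl (0 - 1)"
    using lam_cong[OF a Fl_scale[OF unit_Fl]] by simp
  then have "a = t (lam 0 a {}) un" using Fl_negative[of "- 1"] by simp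
  then show ?thesis by blast
qed

lemma unit_inj: "t c un = t d un \<Longrightarrow> c = d"
proof -
  assume "t c un = t d un"
  then have "scl c (del {}) {} = scl d (del {}) {}"
    using lam_scale[OF unit_Fl] lam_unit by metis
  then show ?thesis by (simp add: del_def)
qed

text \<open>Existence: the even part of a lift lies in F^0 by the superfiltered condition and does
  not affect the leading term, so the odd part is a lift too. Uniqueness: the difference of two odd
  lifts is odd and in F^0, hence in F^(-1) = 0.\<close>

lemma lift_basis:
  assumes "i < n"
  shows "lift_basis s v A \<phi> i \<in> Fl 1" "lift_basis s v A \<phi> i \<in> X 1" "lam 1 (lift_basis s v A \<phi> i) = del {i}"
proof -
  have F: "mono_word [v i] \<in> carrier E.F" by (simp add: E.carrier_F)
  have ev: "E.\<kappa> (E.cls (mono_word [v i])) = del {i}"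
    using assms lop_del[of "{}" i E.\<beta>] by (simp add: E.\<kappa>_cls F E.act_v)
  have iff: "\<phi> 1 (gr_class Fl 1 a) = exterior_class s (mono_word [v i]) \<longleftrightarrow> lam 1 a = del {i}"
    if "a \<in> Fl 1" for a
    using E.\<kappa>_inj[OF \<phi>_carrier[OF that] E.cls_carrier[OF F]] ev by (auto simp: lam_def exterior_eq)
  obtain a where a: "a \<in> Fl 1" "lam 1 a = del {i}"
    by (rule lam_surj[of "del {i}" 1]) (use assms in \<open>auto simp: Hom_del\<close>)
  obtain b c where bc: "b \<in> Fl 1" "b \<in> X 0" "c \<in> Fl 1" "c \<in> X 1" "a = b + c"
    using a(1) by (rule Fl_split)
  have "b \<in> Fl 0" using bc Fl_super[of b 0] by simp
  then have "lam 1 b = 0" using lam_eq_zero[OF bc(1)] by simp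
  then have c: "lam 1 c = del {i}" using a(2) bc by (simp add: lam_add)
  have unique: "x = y" if "x \<in> Fl 1 \<inter> X 1" "y \<in> Fl 1 \<inter> X 1" "lam 1 x = del {i}" "lam 1 y = del {i}" for x y
  proof -
    have "x - y \<in> Fl 0" using that lam_cong[of x 1 y] by simp
    moreover have "x - y \<in> X (- 1)" using that X_even[of "- 1" 1] by (simp add: X_diff)
    ultimately have "x - y \<in> Fl (- 1)" using Fl_super[of "x - y" "- 1"] by simp
    then show "x = y" using Fl_negative[of "- 1"] by simp
  qed
  have "lift_basis s v A \<phi> i \<in> Fl 1 \<inter> X 1 \<and>
      \<phi> 1 (gr_class Fl 1 (lift_basis s v A \<phi> i)) = exterior_class s (mono_word [v i])"
    unfolding lift_basis_def
    by (rule theI[of _ c]) (use bc c iff unique in \<open>auto\<close>)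
  then show "lift_basis s v A \<phi> i \<in> Fl 1" "lift_basis s v A \<phi> i \<in> X 1"
    "lam 1 (lift_basis s v A \<phi> i) = del {i}"
    using iff by auto
qed

text \<open>Extended by 0 because insertions are indexed by all natural numbers; see
  \<open>T_outside\<close>.\<close>

definition \<alpha> :: "nat \<Rightarrow> 'x"
  where "\<alpha> j = (if j < n then lift_basis s v A \<phi> j else 0)"

lemma \<alpha>_Fl: "\<alpha> j \<in> Fl 1" and \<alpha>_X: "\<alpha> j \<in> X 1"
  by (simp_all add: \<alpha>_def lift_basis Fl_zero X_zero)

abbreviation bd where "bd \<equiv> bounding n s v A \<phi>"

lemma coeff_bd: "coeff bd e = (\<Sum>i<n. if e = {#i#} then \<alpha> i else 0)"
  by (simp add: bounding_def coeff_sum coeff_sscale_sconst coeff_svar)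
    (intro sum.cong, auto simp: \<alpha>_def t_one t_zero_left)

lemma \<mu>_ops: "as \<noteq> [] \<Longrightarrow> \<mu> as = ops A as" and \<mu>_Nil: "\<mu> [] = 0"
  by (simp_all add: \<mu>_def)

sublocale B: bounded_additive_ops \<mu> \<alpha> bd
proof
  show "\<mu> (as @ (a + b) # bs) = \<mu> (as @ a # bs) + \<mu> (as @ b # bs)" for as a b bs
    using ml by (simp add: \<mu>_def multilinear_def)
  show "\<mu> [] = 0" by (rule \<mu>_Nil)
  show "coeff bd {#j#} = \<alpha> j" for j
    by (cases "j < n") (auto simp: coeff_bd \<alpha>_def)
  show "coeff bd e = 0" if "\<And>j. e \<noteq> {#j#}" for e
    using that by (simp add: coeff_bd)
qed

sublocale B: ainf_ops \<mu> \<alpha> X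
proof
  show "ainf_relations X \<mu>"
    using ainf_A unfolding ainf_relations_def Let_def
  proof (intro allI impI)
    fix as ds
    assume rel: "\<forall>as ds. as \<noteq> [] \<and> list_all2 (\<lambda>a d. a \<in> X d) as ds \<longrightarrow>
      (\<Sum>i<length as. \<Sum>j = 1..length as - i. signed (sum_list (drop (length as - i) ds) - int i)
         (ops A (take (length as - i - j) as @ [ops A (take j (drop (length as - i - j) as))] @ drop (length as - i) as))) = 0"
      and as: "as \<noteq> [] \<and> list_all2 (\<lambda>a d. a \<in> X d) as ds"
    have "(\<Sum>i<length as. \<Sum>j = 1..length as - i. signed (sum_list (drop (length as - i) ds) - int i)
         (\<mu> (take (length as - i - j) as @ [\<mu> (take j (drop (length as - i - j) as))] @ drop (length as - i) as))) =
      (\<Sum>i<length as. \<Sum>j = 1..length as - i. signed (sum_list (drop (length as - i) ds) - int i)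
         (ops A (take (length as - i - j) as @ [ops A (take j (drop (length as - i - j) as))] @ drop (length as - i) as)))"
      by (intro sum.cong) (auto simp: \<mu>_def)
    also have "\<dots> = 0" using rel as by blast
    finally show "(\<Sum>i<length as. \<Sum>j = 1..length as - i. signed (sum_list (drop (length as - i) ds) - int i)
         (\<mu> (take (length as - i - j) as @ [\<mu> (take j (drop (length as - i - j) as))] @ drop (length as - i) as))) = 0" .
  qed
  show "\<alpha> j \<in> X 1" for j by (rule \<alpha>_X)
qed

subsection \<open>The disc potential\<close>

text \<open>Inserted letters have level 1 and so leave the level unchanged. The additional drop
  depends on the total number of arguments, insertions included, being different from 2.\<close>

lemma T_Fl:
  assumes as: "list_all2 (\<lambda>a p. a \<in> Fl p) as ps"
  shows "B.T e as \<in> Fl (sum_list ps - int (length as) + 2)"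
    "size e + length as \<noteq> 2 \<Longrightarrow> B.T e as \<in> Fl (sum_list ps - int (length as) + 1)"
proof -
  show "B.T e as \<in> Fl (sum_list ps - int (length as) + 2)"
    unfolding shuffle_sum_nth
  proof (rule Fl_sum)
    fix l assume "l \<in> Sh e [0..<length as]"
    note l = shuffle_degrees[OF as \<alpha>_Fl this]
    show "\<mu> (map (case_sum \<alpha> ((!) as)) l) \<in> Fl (sum_list ps - int (length as) + 2)"
      using ops_Fl[OF l(1), unfolded length_map l(2)]
      by (cases "l = []") (simp_all add: \<mu>_def Fl_zero)
  qed
  assume e: "size e + length as \<noteq> 2"
  show "B.T e as \<in> Fl (sum_list ps - int (length as) + 1)"
    unfolding shuffle_sum_nth
  proof (rule Fl_sum)
    fix l assume "l \<in> Sh e [0..<length as]"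
    note l = shuffle_degrees[OF as \<alpha>_Fl this]
    show "\<mu> (map (case_sum \<alpha> ((!) as)) l) \<in> Fl (sum_list ps - int (length as) + 1)"
      using ops_Fl_lower[OF l(1), unfolded length_map l(2)] l(3) e
      by (cases "l = []") (simp_all add: \<mu>_def Fl_zero)
  qed
qed

lemma T_X:
  assumes as: "list_all2 (\<lambda>a p. a \<in> X p) as ps"
  shows "B.T e as \<in> X (sum_list ps - int (length as) + 2)"
  unfolding shuffle_sum_nth
proof (rule X_sum)
  fix l assume "l \<in> Sh e [0..<length as]"
  note l = shuffle_degrees[OF as \<alpha>_X this]
  show "\<mu> (map (case_sum \<alpha> ((!) as)) l) \<in> X (sum_list ps - int (length as) + 2)"
    using ops_X[OF l(1), unfolded length_map l(2)]
    by (cases "l = []") (simp_all add: \<mu>_def X_zero)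
qed

lemma lam_\<alpha>: "i < n \<Longrightarrow> lam 1 (\<alpha> i) = del {i}"
  by (simp add: \<alpha>_def lift_basis)

lemma lam_ops_\<alpha>: "i < n \<Longrightarrow> j < n \<Longrightarrow> lam 2 (ops A [\<alpha> i, \<alpha> j]) = - wedge i (wedge j (del {}))"
proof -
  assume ij: "i < n" "j < n"
  have w: "wedge k (del {}) = (del {k} :: nat set \<Rightarrow> 'r)" for k
    using lop_del[of "{}" k E.\<beta>] by (simp add: E_lop)
  have "E.vw {i} = mono_word [v i]"
    by (simp add: E.vw_def)
  then have "E.ev (E.canon (del {i})) (del {j}) = wedge i (del {j})"
    using ij by (simp add: E.canon_del E.act_v E_lop)
  then show ?thesis
    using lam_ops2[OF \<alpha>_Fl \<alpha>_Fl, of i j] ij by (simp add: lam_\<alpha> signed_def w)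
qed

text \<open>In degree 2 the leading terms cancel because the exterior product is alternating.\<close>

lemma T_Nil_Fl: "B.T e [] \<in> Fl 1"
proof (cases "size e = 2")
  case False
  then show ?thesis using T_Fl(2)[of "[]" "[]" e] by simp
next
  case True
  then have "size e = Suc 1" by simp
  then obtain i e' where e': "e = add_mset i e'" using size_eq_Suc_imp_eq_union by blast
  with True have "size e' = 1" by simp
  then obtain j where "e' = {#j#}" using size_1_singleton_mset by blast
  with e' have e: "e = {#i, j#}" by simp
  have T: "B.T e [] = (\<Sum>l\<in>Sh e ([] :: 'x list). \<mu> (map (case_sum \<alpha> id) l))"
    by (simp add: shuffle_sum_def)
  have Sh: "Sh e ([] :: 'x list) = {[Inl i, Inl j], [Inl j, Inl i]}"
  proof (intro equalityI subsetI)
    fix l :: "(nat + 'x) list" assume l: "l \<in> Sh e []"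
    then have "mset (lefts l) = e" "rights l = []" by (simp_all add: Sh_def)
    then have "length l = size e"
      using length_lefts_rights[of l] by (metis add_0_right list.size(3) size_mset)
    then have "length l = 2" by (simp add: True)
    then obtain x y where xy: "l = [x, y]" by (auto simp: length_Suc_conv numeral_2_eq_2)
    with l obtain x' y' where "x = Inl x'" "y = Inl y'" by (cases x; cases y) (auto simp: Sh_def)
    with l xy show "l \<in> {[Inl i, Inl j], [Inl j, Inl i]}"
      by (auto simp: Sh_def e add_eq_conv_ex)
  qed (auto simp: Sh_def e)
  have Fl2: "ops A [\<alpha> i, \<alpha> j] \<in> Fl 2" for i j
    using ops_Fl[of "[\<alpha> i, \<alpha> j]" "[1, 1]"] by (simp add: \<alpha>_Fl)
  have zero: "\<alpha> k = 0" if "\<not> k < n" for k using that by (simp add: \<alpha>_def)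
  show ?thesis
  proof (cases "i < n \<and> j < n")
    case False
    then have "0 \<in> set [\<alpha> i, \<alpha> j]" "0 \<in> set [\<alpha> j, \<alpha> i]" using zero by auto
    then have "\<mu> [\<alpha> i, \<alpha> j] = 0" "\<mu> [\<alpha> j, \<alpha> i] = 0" using B.m_zero_in by blast+
    then show ?thesis unfolding T Sh by (cases "i = j") (simp_all add: Fl_zero)
  next
    case ij: True
    have "lam 2 (B.T e []) = 0"
    proof (cases "i = j")
      case True
      then show ?thesis unfolding T Sh using ij by (simp add: \<mu>_def lam_ops_\<alpha> wedge_wedge_same)
    next
      case False
      then have "lam 2 (B.T e []) = lam 2 (ops A [\<alpha> i, \<alpha> j]) + lam 2 (ops A [\<alpha> j, \<alpha> i])"
        unfolding T Sh by (simp add: \<mu>_def lam_add Fl2)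
      then show ?thesis using ij by (simp add: lam_ops_\<alpha> wedge_wedge[of j i])
    qed
    moreover have "B.T e [] \<in> Fl 2" using T_Fl(1)[of "[]" "[]" e] by simp
    ultimately show ?thesis using lam_eq_zero[of "B.T e []" 2] by simp
  qed
qed

definition P :: "'r series"
  where "P = disc_potential n s v A \<phi>"

text \<open>The sum is even and in F^1 by \<open>T_Nil_Fl\<close>, hence in F^0, which is spanned by
  the unit. So the definite description in \<open>disc_potential\<close> has a unique
  solution.\<close>

lemma coeff_P: "t (coeff P e) un = B.T e []"
proof -
  have "B.T e [] \<in> X 0" using T_X[of "[]" "[]" e] X_even[of 2 0] by simp
  then have "B.T e [] \<in> Fl 0" using T_Nil_Fl Fl_super[of "B.T e []" 0] by simp
  then obtain c where c: "t c un = B.T e []" using Fl_0_unit by metis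
  have "\<mu> [a] = 0" for a by (simp add: \<mu>_def minimal)
  then have "(\<Sum>k=2..size e. coeff (extend_ops \<mu> (replicate k bd)) e) = B.T e []"
    by (rule B.sum_replicate_ops)
  moreover have "extend_ops (ops A) (replicate k bd) = extend_ops \<mu> (replicate k bd)" if "2 \<le> k" for k
    using that by (intro extend_ops_cong) (auto simp: \<mu>_ops)
  ultimately have "(\<Sum>k=2..size e. coeff (extend_ops (ops A) (replicate k bd)) e) = B.T e []" by simp
  then have "coeff P e = (THE c. t c un = B.T e [])" by (simp add: P_def disc_potential_def)
  also have "t (THE c. t c un = B.T e []) un = B.T e []"
    by (rule theI[of "\<lambda>c. t c un = B.T e []" c]) (use c unit_inj in metis)+
  finally show ?thesis by simp
qed

lemma T_outside: "\<not> set_mset e \<subseteq> {..<n} \<Longrightarrow> B.T e as = 0"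
proof -
  assume "\<not> set_mset e \<subseteq> {..<n}"
  then obtain j where j: "j \<in># e" "\<not> j < n" by auto
  have "\<mu> (map (case_sum \<alpha> id) l) = 0" if "l \<in> Sh e as" for l
  proof (rule B.m_zero_in)
    have "j \<in> set (lefts l)" using j(1) that by (auto simp: Sh_def)
    then have "Inl j \<in> set l" by (induction l rule: lefts.induct) auto
    then have "case_sum \<alpha> id (Inl j) \<in> set (map (case_sum \<alpha> id) l)"
      unfolding set_map by (rule imageI)
    then show "0 \<in> set (map (case_sum \<alpha> id) l)" using j(2) by (simp add: \<alpha>_def)
  qed
  then show ?thesis by (simp add: shuffle_sum_def)
qed

lemma P_series_over: "P \<in> series_over n"
proof (rule series_overI, rule ccontr)
  fix e assume "coeff P e \<noteq> 0" "\<not> set_mset e \<subseteq> {..<n}"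
  then have "t (coeff P e) un = t 0 un" by (simp add: coeff_P T_outside t_zero_left)
  then show False using unit_inj \<open>coeff P e \<noteq> 0\<close> by blast
qed

text \<open>Marking an inserted letter differentiates the potential. Up to the sign convention for
  the differential this is d_v v_j = -d_j P.\<close>

lemma T_\<alpha>: "B.T e [\<alpha> j] = t (coeff (pderiv_series j P) e) un"
proof -
  have "B.T e [\<alpha> j] = (\<Sum>i<Suc (count e j). t (coeff P (add_mset j e)) un)"
    by (simp only: B.T_derivative coeff_P)
  also have "\<dots> = t (\<Sum>i<Suc (count e j). coeff P (add_mset j e)) un"
    by (simp only: t_sum_left)
  also have "(\<Sum>i<Suc (count e j). coeff P (add_mset j e)) = coeff (pderiv_series j P) e"
    by (simp only: coeff_pderiv sum_constant card_lessThan Suc_eq_plus1)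
  finally show ?thesis .
qed

end

lemma sorted_list_of_set_insert_max:
  assumes "finite I" "\<And>k. k \<in> I \<Longrightarrow> k < j"
  shows "sorted_list_of_set (insert j I) = sorted_list_of_set I @ [j]"
proof -
  have "sorted (sorted_list_of_set I @ [j])" "distinct (sorted_list_of_set I @ [j])"
    using assms by (auto simp: sorted_append less_imp_le)
  then have "sorted_list_of_set (set (sorted_list_of_set I @ [j])) = sorted_list_of_set I @ [j]"
    by (rule sorted_list_of_set.idem_if_sorted_distinct)
  then show ?thesis using assms(1) by simp
qed

section \<open>The deformed differential and right multiplication by generators\<close>

context deformation
begin

sublocale H: clifford_jacobi "series_over n" "series_over n" "sscale s" "\<lambda>u. - half_hess n s v P u" n
    "\<lambda>i. sconst (v i)" "coordinate n s v" "\<lambda>i. - half_pderiv2 i P"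
    "\<lambda>i j. - pderiv_series i (pderiv_series j P)" "jac_ideal n P"
  by (rule half_hess_jacobi[OF P_series_over])

abbreviation ps where "ps \<equiv> parity_sign X"

lemma ps_eq:
  assumes "b \<in> X 0" "c \<in> X 1"
  shows "ps (b + c) = b - c"
  unfolding parity_sign_def
proof (rule the_equality)
  show "\<exists>c'\<in>X 0. \<exists>d\<in>X 1. b + c = c' + d \<and> b - c = c' - d" using assms by blast
  fix z assume "\<exists>c'\<in>X 0. \<exists>d\<in>X 1. b + c = c' + d \<and> z = c' - d"
  then obtain c' d where cd: "c' \<in> X 0" "d \<in> X 1" "b + c = c' + d" "z = c' - d" by blast
  have "b - c' = d - c" using cd(3) by (simp add: algebra_simps)
  then have "b - c' = 0" using X_diff[OF assms(1) cd(1)] X_diff[OF cd(2) assms(2)] X_disjoint by metis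
  then show "z = b - c" using cd \<open>b - c' = d - c\<close> by simp
qed

lemma ps_homogeneous: "a \<in> X d \<Longrightarrow> ps a = signed d a"
proof (cases "even d")
  case True
  assume "a \<in> X d"
  with True have "a \<in> X 0" using X_even[of d 0] by simp
  then show ?thesis using ps_eq[of a 0] True by (simp add: X_zero signed_def)
next
  case False
  assume "a \<in> X d"
  with False have "a \<in> X 1" using X_even[of d 1] by simp
  then show ?thesis using ps_eq[of 0 a] False by (simp add: X_zero signed_def)
qed

lemma ps_add: "ps (a + b) = ps a + ps b"
proof -
  obtain a0 a1 where a: "a0 \<in> X 0" "a1 \<in> X 1" "a = a0 + a1" by (rule X_split)
  obtain b0 b1 where b: "b0 \<in> X 0" "b1 \<in> X 1" "b = b0 + b1" by (rule X_split)
  have eq: "a + b = (a0 + b0) + (a1 + b1)" by (simp add: a b algebra_simps)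
  have "ps (a + b) = (a0 + b0) - (a1 + b1)" unfolding eq by (intro ps_eq X_add a b)
  moreover have "ps a = a0 - a1" "ps b = b0 - b1" unfolding a(3) b(3) by (intro ps_eq a b)+
  ultimately show ?thesis by simp
qed

lemma ps_scale: "ps (t c a) = t c (ps a)"
proof -
  obtain a0 a1 where a: "a0 \<in> X 0" "a1 \<in> X 1" "a = a0 + a1" by (rule X_split)
  have "ps (t c a) = t c a0 - t c a1" unfolding a(3) t_add by (intro ps_eq X_scale a)
  moreover have "ps a = a0 - a1" unfolding a(3) by (intro ps_eq a)
  ultimately show ?thesis using t_add[of c a0 "- a1"] by (simp add: t_uminus)
qed

lemma ps_zero: "ps 0 = 0"
  using ps_homogeneous[OF X_zero, of 0] by (simp add: signed_def)

lemma \<mu>_scale: "\<mu> (as @ t c a # bs) = t c (\<mu> (as @ a # bs))"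
  using ml by (simp add: \<mu>_def multilinear_def)

lemma T_scale: "B.T e (as @ t c a # bs) = t c (B.T e (as @ a # bs))"
  by (simp add: B.T_insert \<mu>_scale t_sum case_prod_beta)

lemma T_signed: "B.T e (as @ signed k a # bs) = signed k (B.T e (as @ a # bs))"
  by (simp add: signed_def B.T_uminus)

lemma T_empty: "B.T {#} as = \<mu> as"
proof -
  have l: "l = map Inr (rights l)" if "lefts l = []" for l :: "(nat + 'x) list"
    using that by (induction l rule: lefts.induct) simp_all
  have "lefts (map Inr bs) = ([] :: nat list)" "rights (map Inr bs :: (nat + 'x) list) = bs" for bs :: "'x list"
    by (induction bs) simp_all
  then have "Sh {#} as = {map Inr as}" using l by (auto simp: Sh_def)
  then show ?thesis by (simp add: shuffle_sum_def o_def)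
qed

lemma T_unit_long:
  assumes "un \<in> set as" "3 \<le> size e + length as"
  shows "B.T e as = 0"
proof -
  have "\<mu> (map (case_sum \<alpha> id) l) = 0" if "l \<in> Sh e as" for l
  proof -
    have r: "rights l = as" "mset (lefts l) = e" using that by (auto simp: Sh_def)
    have "Inr un \<in> set l" using assms(1) unfolding r(1)[symmetric]
      by (induction l rule: lefts.induct) auto
    then have "case_sum \<alpha> id (Inr un) \<in> set (map (case_sum \<alpha> id) l)"
      unfolding set_map by (rule imageI)
    moreover have "3 \<le> length l" using assms(2) length_lefts_rights[of l] r by auto
    ultimately show ?thesis using unit_other[of "map (case_sum \<alpha> id) l"]
      by (auto simp: \<mu>_def)
  qed
  then show ?thesis by (simp add: shuffle_sum_def)
qed

lemma size_mset_ge_1: "e \<noteq> {#} \<Longrightarrow> 1 \<le> size e"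
  by (simp add: Suc_le_eq nonempty_has_size)

lemma T_unit_right: "B.T e [a, un] = (if e = {#} then a else 0)"
  using T_unit_long[of "[a, un]" e] size_mset_ge_1[of e] by (auto simp: T_empty \<mu>_def unit_right)

lemma unit_left_odd: "a \<in> X 1 \<Longrightarrow> ops A [un, a] = - a"
  using unit_left[of a 1] by (simp add: signed_def minus_equation_iff)

lemma T_unit_left: "a \<in> X 1 \<Longrightarrow> B.T e [un, a] = (if e = {#} then - a else 0)"
  using T_unit_long[of "[un, a]" e] size_mset_ge_1[of e] unit_left_odd[of a]
  by (auto simp: T_empty \<mu>_def)

text \<open>With a single insertion both orders occur and cancel, as \<open>\<alpha> j\<close> is
  odd. Without insertions minimality applies, and with more the strict unit kills the
  operation.\<close>

lemma T_unit: "B.T e [un] = 0"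
proof -
  consider "e = {#}" | "size e = 1" | "2 \<le> size e" using size_mset_ge_1[of e] by fastforce
  then show ?thesis
  proof cases
    case 1
    then show ?thesis by (simp add: T_empty \<mu>_def minimal)
  next
    case 2
    then obtain j where e: "e = {#j#}" using size_1_singleton_mset by blast
    have "Sh e [un] = {[Inl j, Inr un], [Inr un, Inl j]}"
    proof (intro equalityI subsetI)
      fix l :: "(nat + 'x) list" assume l: "l \<in> Sh e [un]"
      then have r: "rights l = [un]" and "mset (lefts l) = {#j#}" by (simp_all add: Sh_def e)
      then have lf: "lefts l = [j]" by simp
      have "length l = 2" using length_lefts_rights[of l] by (simp add: r lf)
      then obtain x y where xy: "l = [x, y]" by (auto simp: length_Suc_conv numeral_2_eq_2)
      show "l \<in> {[Inl j, Inr un], [Inr un, Inl j]}"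
        using r lf unfolding xy by (cases x; cases y) auto
    qed (auto simp: Sh_def e)
    then show ?thesis
      by (simp add: shuffle_sum_def \<mu>_def unit_right unit_left_odd[OF \<alpha>_X])
  next
    case 3
    then show ?thesis by (intro T_unit_long) auto
  qed
qed

text \<open>The curvature \<open>P \<cdot> un\<close> drops out of the \<open>A\<^sub>\<infinity>\<close>-relation because the unit is strict.\<close>

lemma ainf_generator:
  assumes a: "a \<in> X k"
  shows "(\<Sum>(p, q) | p + q = e. B.T p [B.T q [a], \<alpha> j] + B.T p [B.T q [a, \<alpha> j]]) =
    - t (coeff (pderiv_series j P) e) a"
proof -
  have z: "B.T p [B.T q [], a, \<alpha> j] = 0" "B.T p [a, B.T q [], \<alpha> j] = 0" "B.T p [a, \<alpha> j, B.T q []] = 0" for p q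
    using T_scale[of p "[]" "coeff P q" un "[a, \<alpha> j]"] T_scale[of p "[a]" "coeff P q" un "[\<alpha> j]"]
      T_scale[of p "[a, \<alpha> j]" "coeff P q" un "[]"]
    by (simp_all add: coeff_P T_unit_long t_zero)
  \<comment> \<open>The inner operation returns a multiple of the unit given by d_j P, and the outer
    one then survives only without insertions.\<close>
  have u: "B.T p [a, B.T q [\<alpha> j]] = (if p = {#} then t (coeff (pderiv_series j P) q) a else 0)" for p q
    using T_scale[of p "[a]" "coeff (pderiv_series j P) q" un "[]"] by (simp add: T_\<alpha> T_unit_right t_zero)
  have "(\<Sum>(p, q) | p + q = e. B.T p [a, B.T q [\<alpha> j]]) = B.T {#} [a, B.T e [\<alpha> j]]"
    by (rule sum_splits_empty_left) (simp add: u)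
  then have "(\<Sum>(p, q) | p + q = e. B.T p [a, B.T q [\<alpha> j]]) = t (coeff (pderiv_series j P) e) a"
    by (simp add: u)
  moreover have "(\<Sum>(p, q) | p + q = e. (B.T p [B.T q [a], \<alpha> j] + B.T p [B.T q [a, \<alpha> j]]) +
      B.T p [a, B.T q [\<alpha> j]]) = 0"
    using B.ainf_pair[OF a \<alpha>_X[of j], of e] by (simp add: z signed_simps algebra_simps)
  ultimately show ?thesis
    by (simp add: sum.distrib case_prod_beta eq_neg_iff_add_eq_0 add.assoc)
qed

abbreviation d where "d \<equiv> def_diff A bd"
abbreviation R where "R j f \<equiv> def_prod A bd f (sconst (\<alpha> j))"

definition D1 where "D1 p a = B.T p [ps a]"
text \<open>The minus sign is (-1)^|v_j| from the product convention of A_v.\<close>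

definition D2 where "D2 j p a = - B.T p [a, \<alpha> j]"

lemma D1_add: "D1 p (a + b) = D1 p a + D1 p b" and D1_scale: "D1 p (t c a) = t c (D1 p a)"
  using B.T_add[of p "[]" _ _ "[]"] T_scale[of p "[]" _ _ "[]"] by (simp_all add: D1_def ps_add ps_scale)

lemma D2_add: "D2 j p (a + b) = D2 j p a + D2 j p b" and D2_scale: "D2 j p (t c a) = t c (D2 j p a)"
  using B.T_add[of p "[]" _ _ "[\<alpha> j]"] T_scale[of p "[]" _ _ "[\<alpha> j]"] by (simp_all add: D2_def t_uminus)

lemma d_cv: "d f = cv D1 f"
proof (rule series_eqI)
  fix e
  have "bounded_ops (ops A) bd [parity_sign_series X f] = bounded_ops \<mu> bd [parity_sign_series X f]"
    by (rule bounded_ops_cong) (simp_all add: \<mu>_ops)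
  then show "coeff (d f) e = coeff (cv D1 f) e"
    by (simp add: def_diff_def B.coeff_bounded_ops_1 coeff_cv D1_def parity_sign_series_def)
qed

lemma R_cv: "R j f = cv (D2 j) f"
proof (rule series_eqI)
  fix e
  have "parity_sign_series X (sconst (\<alpha> j)) = sconst (- \<alpha> j)"
    by (rule series_eqI)
      (simp add: parity_sign_series_def coeff_sconst ps_zero ps_homogeneous[OF \<alpha>_X] signed_def)
  moreover have "bounded_ops (ops A) bd [f, sconst (- \<alpha> j)] = bounded_ops \<mu> bd [f, sconst (- \<alpha> j)]"
    by (rule bounded_ops_cong) (simp_all add: \<mu>_ops)
  ultimately show "coeff (R j f) e = coeff (cv (D2 j) f) e"
    using B.T_uminus[of _ "[_]" "\<alpha> j" "[]"]
    by (simp add: def_prod_def B.coeff_bounded_ops_2 coeff_cv D2_def)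
qed

lemma d_add: "d (f + g) = d f + d g" and d_sscale: "d (sscale t c f) = sscale t c (d f)"
  unfolding d_cv by (rule cv_add[OF D1_add], rule cv_sscale[OF D1_add D1_scale])

lemma R_add: "R j (f + g) = R j f + R j g" and R_sscale: "R j (sscale t c f) = sscale t c (R j f)"
  unfolding R_cv by (rule cv_add[OF D2_add], rule cv_sscale[OF D2_add D2_scale])

lemma d_sum: "d (\<Sum>i\<in>I. f i) = (\<Sum>i\<in>I. d (f i))"
  by (rule additive_sum) (rule d_add)

lemma R_sum: "R j (\<Sum>i\<in>I. f i) = (\<Sum>i\<in>I. R j (f i))"
  by (rule additive_sum[of "R j"]) (rule R_add)

lemma R_series_over: "f \<in> series_over n \<Longrightarrow> R j f \<in> series_over n"
  unfolding R_cv by (rule cv_series_over[OF D2_add]) (simp_all add: D2_def T_outside)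

lemma coeff_signed: "coeff (signed k f) e = signed k (coeff f e)"
  by (simp add: signed_def)

text \<open>The differential of v_j is a multiple of the unit, so the second Leibniz term is a
  scalar multiple of \<open>f\<close>. The identity is proved for a single coefficient of degree
  \<open>k\<close> by \<open>ainf_generator\<close> and then convolved with those of
  \<open>f\<close>.\<close>

lemma d_R:
  assumes f: "\<And>e. coeff f e \<in> X k"
  shows "d (R j f) = R j (d f) - signed k (sscale t (pderiv_series j P) f)"
proof (rule series_eqI)
  fix e
  have D12: "D1 p (D2 j q a) = signed k (B.T p [B.T q [a, \<alpha> j]])" if "a \<in> X k" for p q a
  proof -
    have "B.T q [a, \<alpha> j] \<in> X (k + 1)"
      using T_X[of "[a, \<alpha> j]" "[k, 1]" q] that \<alpha>_X by (simp add: add.commute)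
    then have "ps (- B.T q [a, \<alpha> j]) = signed k (B.T q [a, \<alpha> j])"
      using ps_homogeneous[OF X_uminus] by (simp add: signed_def)
    then show ?thesis using T_signed[of p "[]" k _ "[]"] by (simp add: D1_def D2_def)
  qed
  have D21: "D2 j p (D1 q a) = - signed k (B.T p [B.T q [a], \<alpha> j])" if "a \<in> X k" for p q a
    using T_signed[of q "[]" k _ "[]"] T_signed[of p "[]" k _ "[\<alpha> j]"]
    by (simp add: D1_def D2_def ps_homogeneous[OF that])
  have rel: "(\<Sum>(p, q) | p + q = e'. D1 p (D2 j q a)) =
      (\<Sum>(p, q) | p + q = e'. D2 j p (D1 q a)) - signed k (t (coeff (pderiv_series j P) e') a)"
    if a: "a \<in> X k" for e' a
  proof -
    have "(\<Sum>(p, q) | p + q = e'. D1 p (D2 j q a)) - (\<Sum>(p, q) | p + q = e'. D2 j p (D1 q a)) =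
        signed k (\<Sum>(p, q) | p + q = e'. B.T p [B.T q [a], \<alpha> j] + B.T p [B.T q [a, \<alpha> j]])"
      by (simp add: D12[OF a] D21[OF a] signed_sum signed_simps sum.distrib sum_negf case_prod_beta)
    then show ?thesis unfolding ainf_generator[OF a] by (simp add: signed_simps algebra_simps)
  qed
  have "coeff (d (R j f)) e = (\<Sum>(e', r) | e' + r = e.
      (\<Sum>(p, q) | p + q = e'. D2 j p (D1 q (coeff f r))) - signed k (t (coeff (pderiv_series j P) e') (coeff f r)))"
    by (simp add: d_cv R_cv cv_cv[OF D1_add] rel[OF f])
  also have "\<dots> = coeff (R j (d f) - signed k (sscale t (pderiv_series j P) f)) e"
    by (simp add: d_cv R_cv cv_cv[OF D2_add] coeff_signed coeff_sscale signed_sum sum_subtractf case_prod_beta)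
  finally show "coeff (d (R j f)) e = coeff (R j (d f) - signed k (sscale t (pderiv_series j P) f)) e" .
qed

subsection \<open>The basis of left products\<close>

abbreviation G where "G \<equiv> def_alg n A bd"

definition w :: "nat set \<Rightarrow> 'x series"
  where "w I = left_product G (\<lambda>i. sconst (lift_basis s v A \<phi> i)) (sorted_list_of_set I)"

lemma w_empty: "w {} = sconst un"
  by (simp add: w_def def_alg_def)

lemma R_unit: "R j (sconst un) = sconst (\<alpha> j)"
proof (rule series_eqI)
  fix e
  have z: "B.T p [0, \<alpha> j] = 0" for p using B.T_zero[of p "[]" "[\<alpha> j]"] by simp
  have "coeff (R j (sconst un)) e = D2 j e (coeff (sconst un) {#})"
    unfolding R_cv coeff_cv by (rule sum_splits_empty_right) (simp add: coeff_sconst D2_def z)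
  then show "coeff (R j (sconst un)) e = coeff (sconst (\<alpha> j)) e"
    by (simp add: coeff_sconst D2_def T_unit_left[OF \<alpha>_X])
qed

lemma d_unit: "d (sconst un) = 0"
proof (rule series_eqI)
  fix e
  have "D1 p (coeff (sconst un) q) = 0" for p q
    using ps_homogeneous[OF unit_X] T_unit[of p] D1_add[of p 0 0]
    by (auto simp: D1_def coeff_sconst signed_def)
  then show "coeff (d (sconst un)) e = coeff 0 e"
    by (simp add: d_cv coeff_cv)
qed

text \<open>Left products grow at their right end, so here the largest index is stripped, whereas
  the inductions on Clifford words strip the smallest.\<close>

lemma w_insert:
  assumes "finite I" "\<And>k. k \<in> I \<Longrightarrow> k < j" "j < n"
  shows "w (insert j I) = R j (w I)"
proof -
  have eq: "sorted_list_of_set (insert j I) = sorted_list_of_set I @ [j]"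
    using assms(1,2) by (rule sorted_list_of_set_insert_max)
  show ?thesis
  proof (cases "sorted_list_of_set I")
    case Nil
    then have "I = {}" using assms(1) by simp
    then show ?thesis using R_unit[of j] assms(3)
      by (simp add: w_def[of "{j}"] w_empty) (simp add: \<alpha>_def)
  next
    case (Cons i l)
    then show ?thesis unfolding w_def eq using assms(3)
      by (simp add: \<alpha>_def) (simp add: def_alg_def)
  qed
qed

text \<open>The invariant that makes the left products triangular: the constant coefficient has
  leading term v_I, and the coefficients of all other monomials lie one level lower.\<close>

definition good :: "nat set \<Rightarrow> 'x series \<Rightarrow> bool"
  where "good I f \<longleftrightarrow> f \<in> series_over n \<and> (\<forall>e. coeff f e \<in> X (int (card I))) \<and>
    coeff f {#} \<in> Fl (int (card I)) \<and> lam (int (card I)) (coeff f {#}) = del I \<and>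
    (\<forall>e. e \<noteq> {#} \<longrightarrow> coeff f e \<in> Fl (int (card I) - 1))"

lemma good_unit: "good {} (sconst un)"
  by (auto simp: good_def coeff_sconst unit_X unit_Fl lam_unit X_zero Fl_zero)

lemma E_vw_insert_max:
  assumes "I \<subseteq> {..<n}" "j < n" "\<And>k. k \<in> I \<Longrightarrow> k < j"
  shows "E.ev (E.canon (del I)) (del {j}) = del (insert j I)"
proof -
  have fin: "finite I" using assms(1) by (rule finite_subset) simp
  have "sorted_list_of_set (insert j I) = sorted_list_of_set I @ [j]"
    by (rule sorted_list_of_set_insert_max[OF fin]) (rule assms(3))
  then have "E.vw (insert j I) = E.vw I * mono_word [v j]"
    by (simp only: E.vw_def map_append list.map mono_word_append)
  moreover have "E.ev (mono_word [v j]) (del {}) = del {j}"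
    using assms(2) lop_del[of "{}" j E.\<beta>] by (simp add: E.act_v)
  ultimately have "E.ev (E.vw (insert j I)) (del {}) = E.ev (E.vw I) (del {j})"
    by (simp add: E.ev_mult)
  moreover have "E.ev (E.vw (insert j I)) (del {}) = del (insert j I)"
    using assms by (intro E.ev_vw) auto
  ultimately show ?thesis using assms(1) by (simp add: E.canon_del)
qed

text \<open>The top level is reached only by the constant coefficient without insertions. With an
  insertion the operation has more than two arguments and drops a level; the other coefficients of
  \<open>f\<close> are lower from the start.\<close>

lemma good_R:
  assumes f: "good I f" and I: "I \<subseteq> {..<n}" "j < n" "\<And>k. k \<in> I \<Longrightarrow> k < j"
  shows "good (insert j I) (R j f)"
proof -
  have fin: "finite I" using I(1) by (rule finite_subset) simp
  define p where "p = int (card I)"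
  have "j \<notin> I" using I(3) by blast
  then have card: "int (card (insert j I)) = p + 1" using fin by (simp add: p_def)
  have f0: "coeff f {#} \<in> Fl p" "lam p (coeff f {#}) = del I" using f by (simp_all add: good_def p_def)
  have fX: "coeff f e \<in> X p" for e using f by (simp add: good_def p_def)
  have f1: "coeff f e \<in> Fl (p - 1)" if "e \<noteq> {#}" for e using f that by (simp add: good_def p_def)
  have fFl: "coeff f e \<in> Fl p" for e
    using f0 f1 Fl_mono[of "p - 1" p] by (cases "e = {#}") auto
  have TX: "D2 j a (coeff f b) \<in> X (p + 1)" for a b
    unfolding D2_def using T_X[of "[coeff f b, \<alpha> j]" "[p, 1]" a] fX \<alpha>_X by (simp add: X_uminus add.commute)
  have TFl: "D2 j a (coeff f b) \<in> Fl (p + 1)" for a b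
    unfolding D2_def using T_Fl(1)[of "[coeff f b, \<alpha> j]" "[p, 1]" a] fFl \<alpha>_Fl by (simp add: Fl_uminus add.commute)
  have TFl': "D2 j a (coeff f b) \<in> Fl p" if "a \<noteq> {#} \<or> b \<noteq> {#}" for a b
  proof (cases "b = {#}")
    case True
    with that have "size a + length [coeff f b, \<alpha> j] \<noteq> 2" by simp
    then show ?thesis
      unfolding D2_def using T_Fl(2)[of "[coeff f b, \<alpha> j]" "[p, 1]" a] fFl \<alpha>_Fl by (simp add: Fl_uminus add.commute)
  next
    case False
    then show ?thesis
      unfolding D2_def using T_Fl(1)[of "[coeff f b, \<alpha> j]" "[p - 1, 1]" a] f1 \<alpha>_Fl by (simp add: Fl_uminus add.commute)
  qed
  have R0: "coeff (R j f) {#} = D2 j {#} (coeff f {#})"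
    unfolding R_cv coeff_cv by (rule sum_splits_empty_left) auto
  have "lam (p + 1) (coeff (R j f) {#}) = - lam (p + 1) (ops A [coeff f {#}, \<alpha> j])"
    unfolding R0 D2_def T_empty \<mu>_def
    using ops_Fl[of "[coeff f {#}, \<alpha> j]" "[p, 1]"] f0 \<alpha>_Fl by (simp add: lam_uminus add.commute)
  also have "\<dots> = E.ev (E.canon (del I)) (del {j})"
    using lam_ops2[OF f0(1) \<alpha>_Fl, of j] I(2) f0(2) by (simp add: lam_\<alpha> signed_def)
  also have "\<dots> = del (insert j I)" by (rule E_vw_insert_max[OF I])
  finally have lam: "lam (p + 1) (coeff (R j f) {#}) = del (insert j I)" .
  show ?thesis
    unfolding good_def card
  proof (intro conjI allI impI lam)
    show "R j f \<in> series_over n" using f by (simp add: good_def R_series_over)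
    show "coeff (R j f) e \<in> X (p + 1)" for e
      unfolding R_cv coeff_cv case_prod_beta by (intro X_sum TX)
    show "coeff (R j f) {#} \<in> Fl (p + 1)" unfolding R0 by (rule TFl)
    show "coeff (R j f) e \<in> Fl (p + 1 - 1)" if "e \<noteq> {#}" for e
      unfolding R_cv coeff_cv case_prod_beta add_diff_cancel_right'
    proof (intro Fl_sum TFl')
      fix z assume "z \<in> {z. fst z + snd z = e}"
      then show "fst z \<noteq> {#} \<or> snd z \<noteq> {#}" using that by auto
    qed
  qed
qed

lemma good_w: "I \<subseteq> {..<n} \<Longrightarrow> good I (w I)"
proof -
  assume I: "I \<subseteq> {..<n}"
  then have "finite I" by (rule finite_subset) simp
  from this I show ?thesis
  proof (induction I rule: finite_linorder_max_induct)
    case empty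
    show ?case unfolding w_empty by (rule good_unit)
  next
    case (insert j I)
    then have w: "w (insert j I) = R j (w I)" by (intro w_insert) auto
    show ?case unfolding w using insert by (intro good_R) auto
  qed
qed

text \<open>Induction on the largest index j by the Leibniz rule \<open>d_R\<close>: the terms of
  the earlier factors keep their signs when j is appended.\<close>

lemma d_w:
  "I \<subseteq> {..<n} \<Longrightarrow> d (w I) = (\<Sum>i\<in>I. sscale t (sg i I * - pderiv_series i P) (w (I - {i})))"
proof -
  assume I: "I \<subseteq> {..<n}"
  then have "finite I" by (rule finite_subset) simp
  from this I show ?thesis
  proof (induction I rule: finite_linorder_max_induct)
    case empty
    then show ?case by (simp add: w_empty d_unit)
  next
    case (insert j I)
    then have I: "I \<subseteq> {..<n}" and j: "j < n" and max: "\<And>k. k \<in> I \<Longrightarrow> k < j" and fin: "finite I"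
      by auto
    have "j \<notin> I" using max by blast
    have IH: "d (w I) = (\<Sum>i\<in>I. sscale t (sg i I * - pderiv_series i P) (w (I - {i})))"
      using insert.IH I by blast
    have w: "w (insert j I) = R j (w I)" using fin max j by (rule w_insert)
    have dw: "d (w (insert j I)) = R j (d (w I)) - signed (int (card I)) (sscale t (pderiv_series j P) (w I))"
      unfolding w by (rule d_R) (use good_w[OF I] in \<open>simp add: good_def\<close>)
    have Rd: "R j (d (w I)) = (\<Sum>i\<in>I. sscale t (sg i (insert j I) * - pderiv_series i P) (w (insert j I - {i})))"
      unfolding IH R_sum R_sscale
    proof (rule sum.cong[OF refl])
      fix i assume i: "i \<in> I"
      then have "i < j" by (rule max)
      then have "insert j I - {i} = insert j (I - {i})" by auto
      moreover have "w (insert j (I - {i})) = R j (w (I - {i}))"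
        using fin max j by (intro w_insert) auto
      moreover have "(sg i (insert j I) :: 'r series) = sg i I" using \<open>i < j\<close> by (simp add: sg_insert)
      ultimately show "sscale t (sg i I * - pderiv_series i P) (R j (w (I - {i}))) =
          sscale t (sg i (insert j I) * - pderiv_series i P) (w (insert j I - {i}))" by simp
    qed
    have "- signed (int (card I)) (sscale t (pderiv_series j P) (w I)) =
        sscale t (sg j (insert j I) * - pderiv_series j P) (w (insert j I - {j}))"
    proof -
      \<comment> \<open>All of \<open>I\<close> precedes j, so the degree sign of the Leibniz rule
        is the contraction sign \<open>sg\<close>.\<close>
      have "{k \<in> insert j I. k < j} = I" using max by auto
      then have "(sg j (insert j I) :: 'r series) = (- 1) ^ card I" by (simp only: sg_def)
      moreover have "insert j I - {j} = I" using \<open>j \<notin> I\<close> by simp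
      ultimately show ?thesis
        by (cases "even (card I)") (simp_all add: signed_def sscale_uminus_left)
    qed
    moreover have "x - y = z + x" if "- y = z" for x y z :: "'x series"
      by (simp flip: that)
    ultimately show ?case
      unfolding dw Rd sum.insert[OF fin \<open>j \<notin> I\<close>] by blast
  qed
qed

definition \<Psi> :: "(nat set \<Rightarrow> 'r series) \<Rightarrow> 'x series"
  where "\<Psi> c = (\<Sum>I\<in>Pow {..<n}. sscale t (c I) (w I))"

lemma \<Psi>_add: "\<Psi> (f + g) = \<Psi> f + \<Psi> g"
  by (simp add: \<Psi>_def sscale_add_left sum.distrib)

lemma \<Psi>_zero: "\<Psi> 0 = 0"
  by (simp add: \<Psi>_def sscale_zero_left)

lemma \<Psi>_uminus: "\<Psi> (- f) = - \<Psi> f"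
  using \<Psi>_add[of f "- f"] by (simp add: \<Psi>_zero minus_unique)

lemma \<Psi>_diff: "\<Psi> (f - g) = \<Psi> f - \<Psi> g"
  using \<Psi>_add[of f "- g"] by (simp add: \<Psi>_uminus)

lemma \<Psi>_scl: "\<Psi> (scl c f) = sscale t c (\<Psi> f)"
  by (simp add: \<Psi>_def sscale_mult sscale_sum)

lemma \<Psi>_series_over: "f \<in> H.Mdl \<Longrightarrow> \<Psi> f \<in> series_over n"
  unfolding \<Psi>_def using good_w
  by (intro series_over_sum series_over_sscale) (auto simp: H.Mdl_def good_def)

lemma sscale_sum_left: "sscale t (\<Sum>i\<in>I. c i) f = (\<Sum>i\<in>I. sscale t (c i) f)"
  by (rule additive_sum[of "\<lambda>c. sscale t c f"]) (rule sscale_add_left)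

text \<open>Summing over \<open>K = I - {i}\<close> and i outside \<open>K\<close>, instead of over
  \<open>I\<close> and i in \<open>I\<close>, turns the formula of \<open>d_w\<close> into the
  contraction; the sign is unchanged because i itself does not count in it.\<close>

lemma d_\<Psi>: "d (\<Psi> f) = \<Psi> (contrs n (\<lambda>i. - pderiv_series i P) f)"
proof -
  let ?p = "\<lambda>i. - pderiv_series i P"
  have "d (\<Psi> f) = (\<Sum>I\<in>Pow {..<n}. \<Sum>i\<in>I. sscale t (f I * (sg i I * ?p i)) (w (I - {i})))"
    by (simp add: \<Psi>_def d_sum d_sscale d_w sscale_sum flip: sscale_mult)
  also have "\<dots> = (\<Sum>(I, i)\<in>(SIGMA I:Pow {..<n}. I). sscale t (f I * (sg i I * ?p i)) (w (I - {i})))"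
    by (rule sum.Sigma) (auto intro: finite_subset)
  also have "\<dots> = (\<Sum>(K, i)\<in>(SIGMA K:Pow {..<n}. {..<n} - K). sscale t (?p i * (sg i K * f (insert i K))) (w K))"
    by (rule sum.reindex_bij_witness[of _ "\<lambda>(K, i). (insert i K, i)" "\<lambda>(I, i). (I - {i}, i)"])
      (auto simp: insert_absorb sg_remove mult_ac)
  also have "\<dots> = (\<Sum>K\<in>Pow {..<n}. \<Sum>i\<in>{..<n} - K. sscale t (?p i * (sg i K * f (insert i K))) (w K))"
    by (rule sum.Sigma[symmetric]) auto
  also have "\<dots> = (\<Sum>K\<in>Pow {..<n}. sscale t (contrs n ?p f K) (w K))"
  proof (rule sum.cong[OF refl])
    fix K
    have "(\<Sum>i<n. ?p i * contr i f K) = (\<Sum>i\<in>{..<n} - K. ?p i * contr i f K)"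
      by (rule sum.mono_neutral_right) (simp_all add: contr_def)
    also have "\<dots> = (\<Sum>i\<in>{..<n} - K. ?p i * (sg i K * f (insert i K)))"
      by (rule sum.cong[OF refl]) (simp add: contr_def)
    finally have eq: "contrs n ?p f K = (\<Sum>i\<in>{..<n} - K. ?p i * (sg i K * f (insert i K)))"
      by (simp only: contrs_apply)
    show "(\<Sum>i\<in>{..<n} - K. sscale t (?p i * (sg i K * f (insert i K))) (w K)) =
        sscale t (contrs n ?p f K) (w K)"
      unfolding eq sscale_sum_left ..
  qed
  finally show ?thesis by (simp add: \<Psi>_def)
qed

lemma leading_term_w:
  assumes c: "\<And>I. k < card I \<Longrightarrow> c I = 0" and I: "I \<subseteq> {..<n}"
  shows "coeff (sscale t (c I) (w I)) e \<in> Fl (int k)"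
    and "lam (int k) (coeff (sscale t (c I) (w I)) e) = scl (if card I = k then coeff (c I) e else 0) (del I)"
proof -
  have g: "good I (w I)" by (rule good_w[OF I])
  have Fl: "t (coeff (c I) a) (coeff (w I) b) \<in> Fl (int k)"
    and low: "b \<noteq> {#} \<Longrightarrow> lam (int k) (t (coeff (c I) a) (coeff (w I) b)) = 0"
    and top: "lam (int k) (t (coeff (c I) a) (coeff (w I) {#})) =
      scl (if card I = k then coeff (c I) a else 0) (del I)" for a b
  proof -
    consider "k < card I" | "card I = k" | "card I < k" by linarith
    then have "t (coeff (c I) a) (coeff (w I) b) \<in> Fl (int k) \<and>
      (b \<noteq> {#} \<longrightarrow> lam (int k) (t (coeff (c I) a) (coeff (w I) b)) = 0) \<and>
      lam (int k) (t (coeff (c I) a) (coeff (w I) {#})) =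
      scl (if card I = k then coeff (c I) a else 0) (del I)"
    proof cases
      case 1
      then show ?thesis using c[OF 1] by (simp add: t_zero_left Fl_zero lam_zero scl_simps)
    next
      case 2
      have w0: "coeff (w I) {#} \<in> Fl (int k)" "lam (int k) (coeff (w I) {#}) = del I"
        using g 2 by (simp_all add: good_def)
      have w1: "coeff (w I) b \<in> Fl (int k - 1)" if "b \<noteq> {#}" for b
        using g 2 that by (simp add: good_def)
      have wFl: "coeff (w I) b \<in> Fl (int k)" for b
        using w0 w1 Fl_mono[of "int k - 1" "int k"] by (cases "b = {#}") auto
      have "lam (int k) (t (coeff (c I) a) (coeff (w I) b)) = 0" if "b \<noteq> {#}"
        by (subst lam_eq_zero) (simp_all add: Fl_scale wFl w1 that)
      then show ?thesis using 2 w0 wFl by (simp add: Fl_scale lam_scale)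
    next
      case 3
      have "coeff (w I) b \<in> Fl (int (card I))" for b
        using g Fl_mono[of "int (card I) - 1" "int (card I)"] by (cases "b = {#}") (auto simp: good_def)
      then have wFl: "t (coeff (c I) a) (coeff (w I) b) \<in> Fl (int k - 1)" for b
        using Fl_mono[of "int (card I)" "int k - 1"] 3 by (intro Fl_scale) auto
      have wFl': "t (coeff (c I) a) (coeff (w I) b) \<in> Fl (int k)" for b
        using wFl Fl_mono[of "int k - 1" "int k"] by auto
      have "lam (int k) (t (coeff (c I) a) (coeff (w I) b)) = 0" for b
        by (subst lam_eq_zero) (rule wFl' wFl)+
      then show ?thesis using 3 wFl' by (simp add: scl_simps)
    qed
    then show "t (coeff (c I) a) (coeff (w I) b) \<in> Fl (int k)"
      "b \<noteq> {#} \<Longrightarrow> lam (int k) (t (coeff (c I) a) (coeff (w I) b)) = 0"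
      "lam (int k) (t (coeff (c I) a) (coeff (w I) {#})) =
      scl (if card I = k then coeff (c I) a else 0) (del I)" by blast+
  qed
  show "coeff (sscale t (c I) (w I)) e \<in> Fl (int k)"
    unfolding coeff_sscale case_prod_beta by (intro Fl_sum Fl)
  have "lam (int k) (coeff (sscale t (c I) (w I)) e) =
      (\<Sum>z\<in>{(a, b). a + b = e}. lam (int k) (t (coeff (c I) (fst z)) (coeff (w I) (snd z))))"
    unfolding coeff_sscale by (subst lam_sum) (auto simp: Fl case_prod_beta)
  also have "\<dots> = (\<Sum>(a, b) | a + b = e. lam (int k) (t (coeff (c I) a) (coeff (w I) b)))"
    by (simp add: case_prod_beta)
  also have "\<dots> = lam (int k) (t (coeff (c I) e) (coeff (w I) {#}))"
    by (rule sum_splits_empty_right) (rule low)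
  finally show "lam (int k) (coeff (sscale t (c I) (w I)) e) =
      scl (if card I = k then coeff (c I) e else 0) (del I)" unfolding top .
qed

text \<open>Smaller sets and nonconstant coefficients of \<open>w I\<close> fall below level k, so
  at that level only the coordinates at sets of size k are seen. This triangularity yields both
  surjectivity and injectivity of \<open>\<Psi>\<close>.\<close>

lemma leading_term_\<Psi>:
  assumes "c \<in> H.Mdl" "\<And>I. k < card I \<Longrightarrow> c I = 0"
  shows "coeff (\<Psi> c) e \<in> Fl (int k)"
    and "lam (int k) (coeff (\<Psi> c) e) = (\<lambda>I. if card I = k then coeff (c I) e else 0)"
proof -
  show "coeff (\<Psi> c) e \<in> Fl (int k)"
    unfolding \<Psi>_def coeff_sum by (intro Fl_sum leading_term_w(1) assms(2)) auto
  let ?f = "\<lambda>I. if card I = k then coeff (c I) e else 0"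
  have "lam (int k) (coeff (\<Psi> c) e) = (\<Sum>I\<in>Pow {..<n}. lam (int k) (coeff (sscale t (c I) (w I)) e))"
    unfolding \<Psi>_def coeff_sum by (rule lam_sum) (auto intro!: leading_term_w(1) assms(2))
  also have "\<dots> = (\<Sum>I\<in>Pow {..<n}. scl (?f I) (del I))"
    by (rule sum.cong[OF refl], rule leading_term_w(2)) (auto intro: assms(2))
  also have "\<dots> = ?f"
  proof (rule supp_in_expand[symmetric])
    show "supp_in {..<n} ?f"
      unfolding supp_in_def
    proof (intro allI impI)
      fix I assume "?f I \<noteq> 0"
      then have "c I \<noteq> 0" by (metis coeff_zero)
      then show "I \<subseteq> {..<n}" using assms(1) by (simp add: H.Mdl_def supp_in_def)
    qed
  qed simp
  finally show "lam (int k) (coeff (\<Psi> c) e) = ?f" .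
qed

text \<open>The leading terms of \<open>f\<close> at level k are coordinates of a combination of the
  \<open>w I\<close> with sets of size k, and subtracting it lowers \<open>f\<close> by a level. All
  monomials are treated at once, so n + 1 steps suffice and no limit is taken.\<close>

lemma \<Psi>_surj:
  assumes "f \<in> series_over n"
  shows "\<exists>c\<in>H.Mdl. f = \<Psi> c"
proof -
  have "f \<in> series_over n \<Longrightarrow> (\<forall>e. coeff f e \<in> Fl (int k - 1)) \<Longrightarrow> \<exists>c\<in>H.Mdl. f = \<Psi> c" for k f
  proof (induction k arbitrary: f)
    case 0
    then have "f = 0" using Fl_negative[of "- 1"] by (intro series_eqI) simp
    then show ?case using H.Mdl_zero \<Psi>_zero by metis
  next
    case (Suc k)
    have fFl: "coeff f e \<in> Fl (int k)" for e using Suc.prems(2) by simp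
    define c where "c I = Series (\<lambda>e. lam (int k) (coeff f e) I)" for I
    have c: "coeff (c I) e = lam (int k) (coeff f e) I" for I e by (simp add: c_def)
    have Hom: "lam (int k) (coeff f e) \<in> Hom (int k)" for e by (rule lam_Hom[OF fFl])
    have card: "c I = 0" if "card I \<noteq> k" for I
      by (rule series_eqI) (use Hom that in \<open>auto simp: c Hom_def\<close>)
    have Mdl: "c \<in> H.Mdl"
    proof -
      have "c I \<in> series_over n" for I
      proof (rule series_overI, rule ccontr)
        fix e assume "coeff (c I) e \<noteq> 0" "\<not> set_mset e \<subseteq> {..<n}"
        then show False using Suc.prems(1) by (simp add: c series_overD lam_zero)
      qed
      moreover have "I \<subseteq> {..<n}" if nz: "c I \<noteq> 0" for I
      proof (rule ccontr)
        assume I: "\<not> I \<subseteq> {..<n}"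
        have "coeff (c I) e = 0" for e using Hom[of e] I by (auto simp: c Hom_def supp_in_def)
        then have "c I = 0" by (intro series_eqI) simp
        with nz show False by simp
      qed
      ultimately show ?thesis by (auto simp: H.Mdl_def supp_in_def)
    qed
    have "coeff (f - \<Psi> c) e \<in> Fl (int k - 1)" for e
    proof -
      have "lam (int k) (coeff (\<Psi> c) e) = (\<lambda>I. if card I = k then coeff (c I) e else 0)"
        by (rule leading_term_\<Psi>(2)[OF Mdl]) (simp add: card)
      also have "\<dots> = lam (int k) (coeff f e)"
        using card[THEN arg_cong[of _ _ "\<lambda>x. coeff x e"]] by (auto simp: fun_eq_iff c)
      finally have "lam (int k) (coeff f e) = lam (int k) (coeff (\<Psi> c) e)" by simp
      moreover have "coeff (\<Psi> c) e \<in> Fl (int k)"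
        by (rule leading_term_\<Psi>(1)[OF Mdl]) (simp add: card)
      ultimately show ?thesis using lam_cong[OF fFl] by simp
    qed
    moreover have "f - \<Psi> c \<in> series_over n" using Suc.prems(1) \<Psi>_series_over[OF Mdl] by auto
    ultimately obtain c' where c': "c' \<in> H.Mdl" "f - \<Psi> c = \<Psi> c'" using Suc.IH by blast
    then have "f = \<Psi> (c + c')" by (simp add: \<Psi>_add algebra_simps)
    then show ?case using H.Mdl_add[OF Mdl c'(1)] by blast
  qed
  from this[of f "Suc n"] show ?thesis using assms Fl_top by simp
qed

text \<open>Coordinates are eliminated from the largest sets downwards: those at the largest size
  left are leading terms of the zero series.\<close>

lemma \<Psi>_eq_zero:
  assumes "c \<in> H.Mdl" "\<Psi> c = 0"
  shows "c = 0"
proof -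
  have "\<forall>I. n < card I + m \<longrightarrow> c I = 0" for m
  proof (induction m)
    case 0
    show ?case
    proof (intro allI impI, rule ccontr)
      fix I assume "n < card I + 0" "c I \<noteq> 0"
      moreover from this have "I \<subseteq> {..<n}" using assms(1) by (auto simp: H.Mdl_def supp_in_def)
      ultimately show False using card_mono[of "{..<n}" I] by simp
    qed
  next
    case (Suc m)
    show ?case
    proof (intro allI impI)
      fix I :: "nat set" assume I: "n < card I + Suc m"
      show "c I = 0"
      proof (cases "n < card I + m")
        case True
        then show ?thesis using Suc.IH by blast
      next
        case False
        with I have m: "card I + m = n" by simp
        have "lam (int (card I)) (coeff (\<Psi> c) e) = (\<lambda>I'. if card I' = card I then coeff (c I') e else 0)" for e
          by (rule leading_term_\<Psi>(2)[OF assms(1)]) (use Suc.IH m in auto)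
        then have *: "(\<lambda>I'. if card I' = card I then coeff (c I') e else 0) = 0" for e
          by (simp add: assms(2) lam_zero)
        have "coeff (c I) e = 0" for e using fun_cong[OF *[of e], of I] by simp
        then show ?thesis by (intro series_eqI) simp
      qed
    qed
  qed
  from this[of "Suc n"] show ?thesis by (auto simp: fun_eq_iff)
qed

lemma \<Psi>_inj: "f \<in> H.Mdl \<Longrightarrow> g \<in> H.Mdl \<Longrightarrow> \<Psi> f = \<Psi> g \<Longrightarrow> f = g"
  using \<Psi>_eq_zero[OF H.Mdl_diff, of f g] by (simp add: \<Psi>_diff)

subsection \<open>Cohomology of the deformed algebra\<close>

abbreviation J where "J \<equiv> jac_ideal n P"
abbreviation dP where "dP \<equiv> \<lambda>i. - pderiv_series i P"

lemma G_simps: "carrier G = series_over n" "zero G = 0" "add G = (+)"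
  by (simp_all add: def_alg_def)

lemma G_group: "abelian_group G"
proof (rule abelian_groupI)
  fix x assume "x \<in> carrier G"
  then show "\<exists>y\<in>carrier G. y \<oplus>\<^bsub>G\<^esub> x = \<zero>\<^bsub>G\<^esub>"
    by (intro bexI[of _ "- x"]) (auto simp: G_simps)
qed (auto simp: G_simps algebra_simps)

lemma dP_J: "i < n \<Longrightarrow> dP i \<in> J"
  using H.J_uminus pderiv_jac_ideal[OF P_series_over] by blast

lemma dP_K: "i < n \<Longrightarrow> dP i \<in> series_over n"
  using dP_J H.J_K by blast

definition JG :: "'x series set"
  where "JG = ideal_mult J (sscale t) G"

text \<open>As in \<open>JC_iff\<close>, freeness on the \<open>w I\<close> identifies the multiples
  of the Jacobian ideal with the elements whose coordinates lie in that ideal.\<close>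

lemma JG_iff: "f \<in> JG \<longleftrightarrow> (\<exists>c\<in>H.Mdl. Jval J c \<and> f = \<Psi> c)"
proof
  interpret G: abelian_group G by (rule G_group)
  define S where "S = {\<Psi> c | c. c \<in> H.Mdl \<and> Jval J c}"
  have S_carrier: "S \<subseteq> carrier G" by (auto simp: S_def G_simps \<Psi>_series_over)
  have S_zero: "0 \<in> S" unfolding S_def using H.Mdl_zero H.Jval_zero \<Psi>_zero by (metis (mono_tags) mem_Collect_eq)
  have S_scale: "sscale t r x \<in> S" if rx: "r \<in> J" "x \<in> carrier G" for r x
  proof -
    obtain c where c: "c \<in> H.Mdl" "x = \<Psi> c" using \<Psi>_surj rx(2) by (auto simp: G_simps)
    have "r \<in> series_over n" using rx(1) H.J_K by blast
    then have "scl r c \<in> H.Mdl" "Jval J (scl r c)" "sscale t r x = \<Psi> (scl r c)"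
      using c rx(1) by (simp_all add: H.Mdl_scl H.Jval_scl_left \<Psi>_scl)
    then show ?thesis unfolding S_def by blast
  qed
  have S_add: "x + y \<in> S" if "x \<in> S" "y \<in> S" for x y
  proof -
    obtain c c' where c: "c \<in> H.Mdl" "Jval J c" "x = \<Psi> c" "c' \<in> H.Mdl" "Jval J c'" "y = \<Psi> c'"
      using \<open>x \<in> S\<close> \<open>y \<in> S\<close> unfolding S_def by blast
    then have "x + y = \<Psi> (c + c')" "c + c' \<in> H.Mdl" "Jval J (c + c')"
      by (simp_all only: \<Psi>_add H.Mdl_add H.Jval_add)
    then show ?thesis unfolding S_def by blast
  qed
  have S_uminus: "- x \<in> S" if x: "x \<in> S" for x
  proof -
    obtain c where c: "c \<in> H.Mdl" "Jval J c" "x = \<Psi> c" using x unfolding S_def by blast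
    then have "- x = \<Psi> (- c)" "- c \<in> H.Mdl" "Jval J (- c)"
      by (simp_all only: \<Psi>_uminus H.Mdl_uminus H.Jval_uminus)
    then show ?thesis unfolding S_def by blast
  qed
  have inv_eq: "inv\<^bsub>add_monoid G\<^esub> x = - x" if "x \<in> carrier G" for x
  proof -
    have "\<ominus>\<^bsub>G\<^esub> x = - x"
      using that by (intro G.minus_equality) (simp_all add: G_simps series_over_uminus)
    then show ?thesis by (simp only: a_inv_def)
  qed
  assume "f \<in> JG"
  then have "f \<in> S"
    unfolding JG_def ideal_mult_def
  proof (induction rule: generate.induct)
    case one
    show ?case using S_zero by (simp add: def_alg_def)
  next
    case (incl h)
    then show ?case using S_scale by blast
  next
    case (inv h)
    then have "h \<in> S" using S_scale by blast
    moreover from this have "inv\<^bsub>add_monoid G\<^esub> h = - h" using S_carrier inv_eq by blast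
    ultimately show ?case using S_uminus by simp
  next
    case (eng h1 h2)
    then show ?case using S_add[of h1 h2] by (simp add: def_alg_def)
  qed
  then show "\<exists>c\<in>H.Mdl. Jval J c \<and> f = \<Psi> c" unfolding S_def by blast
next
  assume "\<exists>c\<in>H.Mdl. Jval J c \<and> f = \<Psi> c"
  then obtain c where c: "c \<in> H.Mdl" "Jval J c" "f = \<Psi> c" by blast
  have "(\<Sum>I\<in>S. sscale t (c I) (w I)) \<in> JG" if "S \<subseteq> Pow {..<n}" for S
  proof -
    have "finite S" using that by (rule finite_subset) simp
    from this that show ?thesis
    proof (induction S)
      case empty
      show ?case unfolding JG_def ideal_mult_def
        using generate.one[of "add_monoid G"] by (simp add: def_alg_def)
    next
      case (insert I S)
      have "w I \<in> carrier G" using insert.prems good_w[of I] by (simp add: good_def G_simps)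
      moreover have "c I \<in> J" using c(2) by (simp add: Jval_def)
      ultimately have "sscale t (c I) (w I) \<in> JG"
        unfolding JG_def ideal_mult_def by (intro generate.incl) blast
      moreover have "(\<Sum>I\<in>S. sscale t (c I) (w I)) \<in> JG" using insert by simp
      ultimately have "sscale t (c I) (w I) \<otimes>\<^bsub>add_monoid G\<^esub> (\<Sum>I\<in>S. sscale t (c I) (w I)) \<in> JG"
        unfolding JG_def ideal_mult_def by (rule generate.eng)
      then show ?case using insert.hyps by (simp add: def_alg_def)
    qed
  qed
  from this[of "Pow {..<n}"] show "f \<in> JG" by (simp add: c(3) \<Psi>_def)
qed

lemma JG_coset: "x \<in> JG +>\<^bsub>G\<^esub> \<Psi> f \<longleftrightarrow> (\<exists>c\<in>H.Mdl. Jval J c \<and> x = \<Psi> c + \<Psi> f)"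
  by (auto simp: a_r_coset_def' G_simps JG_iff)

text \<open>Coordinate vectors for the same coset differ by one with values in the Jacobian ideal.
  So the definite description in \<open>basis_iso\<close> does not depend on the coordinates
  used.\<close>

lemma canon_\<Psi>_coset:
  assumes "f \<in> H.Mdl" "g \<in> H.Mdl" "\<Psi> g \<in> JG +>\<^bsub>G\<^esub> \<Psi> f"
  shows "H.jcl (H.canon g) = H.jcl (H.canon f)"
proof -
  obtain c where c: "c \<in> H.Mdl" "Jval J c" "\<Psi> g = \<Psi> c + \<Psi> f" using assms(3) JG_coset by blast
  then have "\<Psi> g = \<Psi> (c + f)" by (simp only: \<Psi>_add)
  then have "g = c + f" by (rule \<Psi>_inj[OF assms(2) H.Mdl_add[OF c(1) assms(1)]])
  then have "g - f = c" by simp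
  have "H.ev (H.canon g - H.canon f) (del {}) = g - f"
    using assms(1,2) by (simp add: H.ev_diff H.ev_canon)
  then show ?thesis
    unfolding \<open>g - f = c\<close> using c(2) assms(1,2) by (subst H.jcl_eq_iff) (simp_all add: H.F_canon)
qed

lemma hess_eq:
  "hess_clifford n s v P = H.C" "hess_class n s v P = H.cls" "hess_act n s v P = H.cact"
  "hess_part n s v P = H.cpart" "jac_hess n s v P = H.JC" "jac_clifford n s v P = H.CJ"
  "jac_class n s v P x = H.JC +>\<^bsub>H.C\<^esub> x"
  by (simp_all add: hess_clifford_def hess_class_def hess_act_def hess_part_def jac_hess_def
      jac_clifford_def jac_class_def H.JC_def)

lemma basis_iso_\<Psi>:
  assumes f: "f \<in> H.Mdl"
  shows "basis_iso n s v A \<phi> P (JG +>\<^bsub>G\<^esub> \<Psi> f) = H.jcl (H.canon f)"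
  unfolding basis_iso_def
proof (rule the_equality)
  have sum: "(\<Sum>I\<in>Pow {..<n}. sscale t (c I)
      (left_product G (\<lambda>i. sconst (lift_basis s v A \<phi> i)) (sorted_list_of_set I))) = \<Psi> c" for c
    by (simp add: \<Psi>_def w_def)
  have can: "jac_class n s v P (hess_class n s v P (\<Sum>I\<in>Pow {..<n}. scalar (c I) *
      mono_word (map (\<lambda>i. sconst (v i)) (sorted_list_of_set I)))) = H.jcl (H.canon c)" for c
    by (simp add: hess_eq H.canon_def H.vw_def)
  have "\<Psi> f \<in> JG +>\<^bsub>G\<^esub> \<Psi> f"
    unfolding JG_coset using H.Mdl_zero H.Jval_zero \<Psi>_zero add_0 by metis
  then show "\<exists>c\<in>Pow {..<n} \<rightarrow> series_over n.
      (\<Sum>I\<in>Pow {..<n}. sscale t (c I)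
        (left_product G (\<lambda>i. sconst (lift_basis s v A \<phi> i)) (sorted_list_of_set I))) \<in> JG +>\<^bsub>G\<^esub> \<Psi> f \<and>
      H.jcl (H.canon f) = jac_class n s v P (hess_class n s v P (\<Sum>I\<in>Pow {..<n}. scalar (c I) *
        mono_word (map (\<lambda>i. sconst (v i)) (sorted_list_of_set I))))"
    unfolding sum can using f by (intro bexI[of _ f]) (auto simp: H.Mdl_def)
  fix z assume "\<exists>c\<in>Pow {..<n} \<rightarrow> series_over n.
      (\<Sum>I\<in>Pow {..<n}. sscale t (c I)
        (left_product G (\<lambda>i. sconst (lift_basis s v A \<phi> i)) (sorted_list_of_set I))) \<in> JG +>\<^bsub>G\<^esub> \<Psi> f \<and>
      z = jac_class n s v P (hess_class n s v P (\<Sum>I\<in>Pow {..<n}. scalar (c I) *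
        mono_word (map (\<lambda>i. sconst (v i)) (sorted_list_of_set I))))"
  then obtain c where c: "c \<in> Pow {..<n} \<rightarrow> series_over n" "\<Psi> c \<in> JG +>\<^bsub>G\<^esub> \<Psi> f" "z = H.jcl (H.canon c)"
    unfolding sum can by blast
  \<comment> \<open>The coordinates under the definite description are free outside the subsets of
    \<open>{..<n}\<close>; setting them to 0 there brings them into \<open>Mdl\<close>.\<close>
  define c' where "c' I = (if I \<subseteq> {..<n} then c I else 0)" for I
  have "c' \<in> H.Mdl" using c(1) by (auto simp: H.Mdl_def supp_in_def c'_def)
  moreover have "\<Psi> c' = \<Psi> c" "H.canon c' = H.canon c"
    unfolding \<Psi>_def H.canon_def by (rule sum.cong; simp add: c'_def)+
  ultimately show "z = H.jcl (H.canon f)" using canon_\<Psi>_coset[OF f, of c'] c by simp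
qed

text \<open>Through \<open>\<Psi>\<close> the cocycles are the cycles of the contraction, and
  boundaries have coordinates in the Jacobian ideal. Passing to the coset modulo \<open>JG\<close>
  and on to the Clifford algebra therefore keeps just the coordinates of the cocycle.\<close>

lemma embed_def_cohomology:
  "embed_def n s v A \<phi> P ` cohomology G d = {H.jcl (H.canon f) | f. f \<in> H.Mdl \<and> contrs n dP f = 0}"
proof -
  have coset: "embed_def n s v A \<phi> P (d ` carrier G +>\<^bsub>G\<^esub> \<Psi> f) = H.jcl (H.canon f)" if f: "f \<in> H.Mdl" for f
  proof -
    have "(d ` carrier G +>\<^bsub>G\<^esub> \<Psi> f) <+>\<^bsub>G\<^esub> JG = JG +>\<^bsub>G\<^esub> \<Psi> f"
    proof (rule a_coset_set_add[OF G_group])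
      show "d ` carrier G \<subseteq> JG"
      proof
        fix x assume "x \<in> d ` carrier G"
        then obtain y where y: "y \<in> series_over n" "x = d y" by (auto simp: G_simps)
        obtain c where c: "c \<in> H.Mdl" "y = \<Psi> c" using \<Psi>_surj[OF y(1)] by blast
        have "contrs n dP c \<in> H.Mdl" by (rule H.Mdl_contrs[OF c(1)]) (rule dP_K)
        moreover have "Jval J (contrs n dP c)" by (rule H.Jval_contrs_left[OF _ c(1)]) (rule dP_J)
        moreover have "x = \<Psi> (contrs n dP c)" by (simp only: y(2) c(2) d_\<Psi>)
        ultimately show "x \<in> JG" unfolding JG_iff by blast
      qed
      have "d 0 = 0" using d_add[of 0 0] by simp
      then show "\<zero>\<^bsub>G\<^esub> \<in> d ` carrier G" unfolding G_simps by (metis image_eqI series_over_zero)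
      show "JG \<subseteq> carrier G" by (auto simp: JG_iff G_simps \<Psi>_series_over)
      show "\<Psi> f \<in> carrier G" using f by (simp add: G_simps \<Psi>_series_over)
      fix x y assume "x \<in> JG" "y \<in> JG"
      then obtain c c' where c: "c \<in> H.Mdl" "Jval J c" "x = \<Psi> c" "c' \<in> H.Mdl" "Jval J c'" "y = \<Psi> c'"
        unfolding JG_iff by blast
      then have "x \<oplus>\<^bsub>G\<^esub> y = \<Psi> (c + c')" "c + c' \<in> H.Mdl" "Jval J (c + c')"
        by (simp_all only: \<Psi>_add H.Mdl_add H.Jval_add G_simps)
      then show "x \<oplus>\<^bsub>G\<^esub> y \<in> JG" unfolding JG_iff by blast
    qed
    then show ?thesis unfolding embed_def_def Let_def JG_def[symmetric] using basis_iso_\<Psi>[OF f] by simp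
  qed
  have cyc: "d (\<Psi> f) = \<zero>\<^bsub>G\<^esub> \<longleftrightarrow> contrs n dP f = 0" if f: "f \<in> H.Mdl" for f
  proof -
    have "contrs n dP f \<in> H.Mdl" by (rule H.Mdl_contrs[OF f]) (rule dP_K)
    then show ?thesis unfolding d_\<Psi> G_simps using \<Psi>_eq_zero \<Psi>_zero by metis
  qed
  show ?thesis
  proof (intro equalityI subsetI)
    fix x assume "x \<in> embed_def n s v A \<phi> P ` cohomology G d"
    then obtain z where z: "z \<in> series_over n" "d z = \<zero>\<^bsub>G\<^esub>"
      "x = embed_def n s v A \<phi> P (d ` carrier G +>\<^bsub>G\<^esub> z)"
      by (auto simp: cohomology_def G_simps(1))
    obtain f where f: "f \<in> H.Mdl" "z = \<Psi> f" using \<Psi>_surj[OF z(1)] by blast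
    then have "contrs n dP f = 0" using z(2) cyc by simp
    moreover have "x = H.jcl (H.canon f)" using z(3) f coset by simp
    ultimately show "x \<in> {H.jcl (H.canon f) | f. f \<in> H.Mdl \<and> contrs n dP f = 0}" using f(1) by blast
  next
    fix x assume "x \<in> {H.jcl (H.canon f) | f. f \<in> H.Mdl \<and> contrs n dP f = 0}"
    then obtain f where f: "f \<in> H.Mdl" "contrs n dP f = 0" "x = H.jcl (H.canon f)" by blast
    have "\<Psi> f \<in> {z \<in> carrier G. d z = \<zero>\<^bsub>G\<^esub>}" using f cyc by (simp add: G_simps(1) \<Psi>_series_over)
    then have "(d ` carrier G +>\<^bsub>G\<^esub> \<Psi> f) \<in> cohomology G d" unfolding cohomology_def by (rule imageI)
    then show "x \<in> embed_def n s v A \<phi> P ` cohomology G d"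
      unfolding f(3) coset[OF f(1), symmetric] by (rule imageI)
  qed
qed

lemma contraction_eq: "contraction n s v P = H.\<delta> dP"
proof -
  have "contraction n s v P = (THE d. H.derivation dP d)"
    unfolding contraction_def Let_def hess_eq H.derivation_def ..
  also have "\<dots> = H.\<delta> dP" by (rule H.The_derivation) (rule dP_K)
  finally show ?thesis .
qed

lemma embed_cl_cohomology:
  "embed_cl n s v P ` cohomology (hess_clifford n s v P) (contraction n s v P) =
    {H.jcl (H.canon f) | f. f \<in> H.Mdl \<and> contrs n dP f = 0}"
proof -
  have "embed_cl n s v P = (\<lambda>\<xi>. \<xi> <+>\<^bsub>H.C\<^esub> H.JC)"
    by (rule ext) (simp add: embed_cl_def hess_eq)
  then show ?thesis unfolding contraction_eq hess_eq using H.embed_cohomology[of dP] dP_J by simp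
qed

text \<open>Differentiating the cycle condition in \<open>x\<^sub>j\<close> exhibits the commutator with \<open>v j\<close> as a boundary
  up to sign, and boundaries lie in the Jacobian ideal.\<close>

lemma cycle_bracket:
  assumes f: "f \<in> H.Mdl" "contrs n dP f = 0" and j: "j < n"
  shows "Jval J (contrs n (H.brac j) f)"
  unfolding Jval_def
proof
  fix L
  \<comment> \<open>The polar form of the negative half Hessian consists of the derivatives of the
    components of -dP; on the diagonal this is \<open>pderiv_series_twice\<close>.\<close>
  have brac: "H.brac j i = pderiv_series j (dP i)" for i
    by (simp add: H.brac_def pderiv_series_uminus pderiv_series_twice)
  have "(\<Sum>i<n. dP i * contr i f L) = 0"
    using fun_cong[OF f(2), of L] by (simp add: contrs_apply)
  then have "pderiv_series j (\<Sum>i<n. dP i * contr i f L) = 0" by simp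
  \<comment> \<open>By the product rule one part is the contraction with the bracket, while each
    term of the other keeps a factor -d_i P.\<close>
  then have "contrs n (H.brac j) f L + (\<Sum>i<n. dP i * pderiv_series j (contr i f L)) = 0"
    unfolding contrs_apply brac pderiv_series_sum pderiv_series_mult sum.distrib .
  then have "contrs n (H.brac j) f L = - (\<Sum>i<n. dP i * pderiv_series j (contr i f L))"
    by (rule eq_neg_iff_add_eq_0[THEN iffD2])
  moreover have "(\<Sum>i<n. dP i * pderiv_series j (contr i f L)) \<in> J"
  proof -
    have summand: "dP i * pderiv_series j (contr i f L) \<in> J" if "i < n" for i
    proof (rule H.J_mult_right[OF dP_J[OF that]])
      have "contr i f \<in> H.Mdl" by (rule H.Mdl_contr[OF f(1)])
      then show "pderiv_series j (contr i f L) \<in> series_over n" by (auto simp: H.Mdl_def)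
    qed
    show ?thesis by (rule H.J_sum) (rule summand, simp)
  qed
  ultimately show "contrs n (H.brac j) f L \<in> J" using H.J_uminus by simp
qed

lemma cycles_central:
  "{H.jcl (H.canon f) | f. f \<in> H.Mdl \<and> contrs n dP f = 0}
    \<subseteq> graded_centre (jac_clifford n s v P) (jac_part n s v P)"
proof
  fix x assume "x \<in> {H.jcl (H.canon f) | f. f \<in> H.Mdl \<and> contrs n dP f = 0}"
  then obtain f where f: "f \<in> H.Mdl" "contrs n dP f = 0" "x = H.jcl (H.canon f)" by blast
  have part: "jac_part n s v P = (\<lambda>p. (\<lambda>x. H.JC +>\<^bsub>H.C\<^esub> x) ` H.cpart p)"
    by (rule ext) (simp add: jac_part_def hess_eq)
  show "x \<in> graded_centre (jac_clifford n s v P) (jac_part n s v P)"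
    unfolding f(3) part hess_eq(6)
    by (rule H.cycle_graded_central[OF dP_J cycle_bracket f(1,2)])
qed

end

theorem proposition5p13:
  fixes s :: "'r::comm_ring_1 \<Rightarrow> 'v::ab_group_add \<Rightarrow> 'v"
    and n :: nat and v :: "nat \<Rightarrow> 'v"
    and A :: "('r, 'x::ab_group_add) filtered_ainf"
    and \<phi> :: "int \<Rightarrow> 'x set \<Rightarrow> ('v word \<Rightarrow>\<^sub>0 'r) set"
    and P :: "'r series"
  assumes "free_basis s n v"
    and "superfiltered_deformation s A \<phi>"
    and "P = disc_potential n s v A \<phi>"
  shows "embed_def n s v A \<phi> P `
           cohomology (def_alg n A (bounding n s v A \<phi>)) (def_diff A (bounding n s v A \<phi>))
         \<subseteq> graded_centre (jac_clifford n s v P) (jac_part n s v P) \<and>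
         embed_def n s v A \<phi> P `
           cohomology (def_alg n A (bounding n s v A \<phi>)) (def_diff A (bounding n s v A \<phi>))
         = embed_cl n s v P ` cohomology (hess_clifford n s v P) (contraction n s v P)"
proof -
  interpret D: deformation s n v A \<phi>
    by (rule deformation.intro[OF free_module.intro[OF assms(1)] deformation_axioms.intro[OF assms(2)]])
  have P: "P = D.P" by (simp add: assms(3) D.P_def)
  show ?thesis
    unfolding P D.embed_def_cohomology D.embed_cl_cohomology using D.cycles_central by simp
qed

end
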